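(* Let $X$ be a spectrally negative Lévy process (paths of bounded or unbounded variation). Fix $a>0$, $q\ge0$, $x\in\mathbb R$ and $p>0$. Then, as measures in $y\in\mathbb R$, $$\begin{aligned} \int_0^\infty e^{-pt}\,&\mathbb E_x\Big[e^{-q\int_0^t\mathbf 1_{(0,a)}(X_s)\,\mathrm ds};X_t\in\mathrm dy\Big]\mathrm dt\\ ={}&e^{-\Phi(p)a}\,\frac{\mathcal H^{(p,q)}(x)-q\int_a^xW^{(p)}(x-z)\mathcal H^{(p,q)}(z)\,\mathrm dz}{\psi'(\Phi(p))+q\int_0^ae^{-\Phi(p)z}\mathcal H^{(p,q)}(z)\,\mathrm dz}\\ &\times\Big\{\mathcal H^{(p,q)}(a-y)-q\int_0^{-y}\mathcal H^{(p,q)}(a-y-z)W^{(p)}(z)\,\mathrm dz\Big\}\mathrm dy\\ &-\Big\{\mathcal W^{(p,q)}_{x-a}(x-y)-q\int_0^{-y}\mathcal W^{(p,q)}_{x-a}(x-y-z)W^{(p)}(z)\,\mathrm dz\Big\}\mathrm dy . \end{aligned}$$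
   Context: $X=\{X_t,t\ge0\}$ is a spectrally negative Lévy process (no positive jumps) whose paths are not monotone; $\mathbb P_x,\mathbb E_x$ denote law and expectation when $X_0=x$, and $\mathbb E[Z;A]=\mathbb E[Z\mathbf 1_A]$. Laplace exponent: $\psi(\lambda)=\log\mathbb E_0[e^{\lambda X_1}]$, $\lambda\ge0$, with derivative $\psi'$; $\Phi(q)=\sup\{\lambda\ge0:\psi(\lambda)=q\}$ for $q\ge0$. For $q\ge0$, the $q$-scale function $W^{(q)}$ is $0$ on $(-\infty,0)$ and on $[0,\infty)$ is the continuous function with $\int_0^\infty e^{-\lambda y}W^{(q)}(y)\,\mathrm dy=1/(\psi(\lambda)-q)$ for $\lambda>\Phi(q)$. For $p\ge0$, $q\in\mathbb R$ with $p+q\ge0$ and $x\in\mathbb R$: $\mathcal H^{(p,q)}(x)=e^{\Phi(p)x}\big[1+q\int_0^xe^{-\Phi(p)z}W^{(p+q)}(z)\,\mathrm dz\big]$ (so $\mathcal H^{(p,q)}(x)=e^{\Phi(p)x}$ for $x<0$). For $p,p+q\ge0$ and $a,x\in\mathbb R$: $\mathcal W^{(p,q)}_a(x)=W^{(p+q)}(x)-q\int_0^aW^{(p+q)}(x-z)W^{(p)}(z)\,\mathrm dz$. Integrals $\int_u^v$ with $v<u$ are oriented: $\int_u^v=-\int_v^u$. *)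

theory Defs
  imports "HOL-Probability.Probability"
begin

text \<open>A L\'evy process started at 0, given as a family of real random variables
  X t on a probability space M, indexed by time t (only t \<ge> 0 matters).
  Paths are taken cadlag for every sample point (a cadlag version).\<close>

definition cadlag_path :: "(real \<Rightarrow> real) \<Rightarrow> bool" where
  "cadlag_path f \<longleftrightarrow>
     (\<forall>t\<ge>0. continuous (at_right t) f) \<and> (\<forall>t>0. \<exists>l. (f \<longlongrightarrow> l) (at_left t))"

definition levy_process :: "'a measure \<Rightarrow> (real \<Rightarrow> 'a \<Rightarrow> real) \<Rightarrow> bool" where
  "levy_process M X \<longleftrightarrow>
     prob_space M \<and>
     (\<forall>t. X t \<in> borel_measurable M) \<and>
     (\<forall>\<omega>\<in>space M. X 0 \<omega> = 0) \<and>
     (\<forall>\<omega>\<in>space M. cadlag_path (\<lambda>t. X t \<omega>)) \<and>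
     (\<forall>(n::nat) (ts::nat \<Rightarrow> real). 0 \<le> ts 0 \<and> (\<forall>i<n. ts i \<le> ts (Suc i)) \<longrightarrow>
        prob_space.indep_vars M (\<lambda>_. borel) (\<lambda>i \<omega>. X (ts (Suc i)) \<omega> - X (ts i) \<omega>) {..<n}) \<and>
     (\<forall>s t. 0 \<le> s \<and> s \<le> t \<longrightarrow>
        distr M borel (\<lambda>\<omega>. X t \<omega> - X s \<omega>) = distr M borel (X (t - s)))"

definition spectrally_negative_levy :: "'a measure \<Rightarrow> (real \<Rightarrow> 'a \<Rightarrow> real) \<Rightarrow> bool" where
  "spectrally_negative_levy M X \<longleftrightarrow>
     levy_process M X \<and>
     (\<forall>\<omega>\<in>space M. \<forall>t>0. \<forall>l. ((\<lambda>s. X s \<omega>) \<longlongrightarrow> l) (at_left t) \<longrightarrow> X t \<omega> \<le> l) \<and>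
     \<not> (AE \<omega> in M. mono_on {0..} (\<lambda>t. X t \<omega>)) \<and>
     \<not> (AE \<omega> in M. antimono_on {0..} (\<lambda>t. X t \<omega>))"

definition levy_psi :: "'a measure \<Rightarrow> (real \<Rightarrow> 'a \<Rightarrow> real) \<Rightarrow> real \<Rightarrow> real" where
  "levy_psi M X l = ln (\<integral>\<omega>. exp (l * X 1 \<omega>) \<partial>M)"

definition levy_Phi :: "'a measure \<Rightarrow> (real \<Rightarrow> 'a \<Rightarrow> real) \<Rightarrow> real \<Rightarrow> real" where
  "levy_Phi M X q = Sup {l. l \<ge> 0 \<and> levy_psi M X l = q}"

definition scale_W :: "'a measure \<Rightarrow> (real \<Rightarrow> 'a \<Rightarrow> real) \<Rightarrow> real \<Rightarrow> real \<Rightarrow> real" where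
  "scale_W M X q = (THE W. (\<forall>y<0. W y = 0) \<and> continuous_on {0..} W \<and>
      (\<forall>l>levy_Phi M X q.
         ((\<lambda>y. exp (- l * y) * W y) has_integral 1 / (levy_psi M X l - q)) {0..}))"

text \<open>H^(p,q)(x); integrals are oriented (interval_lebesgue_integral).\<close>
definition scale_H :: "'a measure \<Rightarrow> (real \<Rightarrow> 'a \<Rightarrow> real) \<Rightarrow> real \<Rightarrow> real \<Rightarrow> real \<Rightarrow> real" where
  "scale_H M X p q x = exp (levy_Phi M X p * x) *
     (1 + q * (LBINT z=0..x. exp (- levy_Phi M X p * z) * scale_W M X (p + q) z))"

definition scale_Wpq :: "'a measure \<Rightarrow> (real \<Rightarrow> 'a \<Rightarrow> real) \<Rightarrow> real \<Rightarrow> real \<Rightarrow> real \<Rightarrow> real \<Rightarrow> real" where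
  "scale_Wpq M X p q a x = scale_W M X (p + q) x -
     q * (LBINT z=0..a. scale_W M X (p + q) (x - z) * scale_W M X p z)"

end

theory Submission
  imports Defs
begin

text \<open>Let T be an independent exponential time with rate p. A path without positive jumps crosses
  every level y continuously, so the strong Markov property at the first passage time over y and the
  lack of memory of T show that S, the supremum of X up to T, is exponentially distributed and
  independent of D = S - X(T). Its parameter c is identified as \<open>\<Phi>(p)\<close>. Since D has no atoms off 0,
  \<open>(c / p) E[exp (c (x - D)); D \<le> x]\<close> is continuous on the half line; it is the scale function, and
  the p-resolvent of X has the density \<open>exp (c (x - y)) / \<psi>'(c) - W(x - y)\<close>.

  By the Feynman-Kac formula the killed resolvent K satisfies \<open>K = r - q r 1_(0,a) K\<close> with this
  kernel r, which is a rank-one kernel minus a Volterra kernel. The identity \<open>V = W + q W * V\<close>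
  between the scale functions of orders p and p + q reduces it to a scalar linear equation, which
  gives the stated density on bounded sets; positivity of K then extends it to all Borel sets.\<close>

section \<open>Uniqueness of Laplace transforms\<close>

lemma has_integral_atLeast_imp_tendsto:
  fixes h :: "real \<Rightarrow> real"
  assumes "(h has_integral i) {0..}"
  shows "((\<lambda>y. integral {0..y} h) \<longlongrightarrow> i) at_top"
proof (rule tendstoI)
  fix e :: real assume "e > 0"
  then obtain B where B: "B > 0" "\<And>a b. ball 0 B \<subseteq> cbox a b \<Longrightarrow>
      norm (integral (cbox a b) (\<lambda>x. if x \<in> {0..} then h x else 0) - i) < e"
    using assms unfolding has_integral_alt' by blast
  have "dist (integral {0..y} h) i < e" if "y \<ge> B" for y
  proof -
    have "ball 0 B \<subseteq> cbox (-y) y" using that by (auto simp: dist_real_def)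
    moreover have "{0..} \<inter> cbox (-y) y = {0..y}" using that B(1) by auto
    then have "integral (cbox (-y) y) (\<lambda>x. if x \<in> {0..} then h x else 0) = integral {0..y} h"
      by (metis integral_restrict_Int)
    ultimately show ?thesis using B(2)[of "-y" y] by (simp add: dist_norm)
  qed
  then show "\<forall>\<^sub>F y in at_top. dist (integral {0..y} h) i < e"
    using eventually_at_top_linorder by blast
qed

lemma has_integral_atLeast_nn_integral:
  fixes f :: "real \<Rightarrow> real"
  assumes [measurable]: "f \<in> borel_measurable borel" and "\<And>y. 0 \<le> f y" "\<And>y. y < 0 \<Longrightarrow> f y = 0"
    and "(\<integral>\<^sup>+y. ennreal (f y) \<partial>lborel) = ennreal r" "r \<ge> 0"
  shows "(f has_integral r) {0..}"
proof -
  have "has_bochner_integral lborel f r"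
    using assms by (intro has_bochner_integral_nn_integral) auto
  then have "(f has_integral r) UNIV"
    using has_integral_integral_lborel[of f] by (simp only: has_bochner_integral_iff)
  then have "((\<lambda>y. if y \<in> {0..} then f y else 0) has_integral r) UNIV"
    by (rule has_integral_cong[THEN iffD1, rotated]) (auto simp: assms(3))
  then show ?thesis by (simp only: has_integral_restrict_UNIV)
qed

lemma continuous_on_atLeast_tendsto_bounded:
  fixes F :: "real \<Rightarrow> real"
  assumes cont: "continuous_on {a..} F" and lim: "(F \<longlongrightarrow> l) at_top"
  obtains B where "B > 0" "\<And>y. y \<ge> a \<Longrightarrow> \<bar>F y\<bar> \<le> B"
proof -
  have "\<forall>\<^sub>F y in at_top. \<bar>F y\<bar> < \<bar>l\<bar> + 1"
    using order_tendstoD(2)[OF tendsto_rabs[OF lim]] by simp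
  then obtain Y where Y: "\<And>y. y \<ge> Y \<Longrightarrow> \<bar>F y\<bar> < \<bar>l\<bar> + 1" unfolding eventually_at_top_linorder by blast
  have "compact (F ` {a..max a Y})"
    by (rule compact_continuous_image) (auto intro: continuous_on_subset[OF cont])
  then have "bounded (F ` {a..max a Y})" by (rule compact_imp_bounded)
  then obtain C where C: "\<And>y. y \<in> {a..max a Y} \<Longrightarrow> \<bar>F y\<bar> \<le> C"
    unfolding bounded_iff by (metis image_eqI real_norm_def)
  have "\<bar>F y\<bar> \<le> max (\<bar>l\<bar> + 1) C" if "y \<ge> a" for y
    using Y[of y] C[of y] that by (cases "y \<le> max a Y") (auto simp: le_max_iff_disj)
  then show ?thesis using that[of "max (\<bar>l\<bar> + 1) C"] by auto
qed

lemma continuous_on_compose_neg_ln: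
  fixes F :: "real \<Rightarrow> real"
  assumes cont: "continuous_on {0..} F" and lim: "(F \<longlongrightarrow> 0) at_top"
  shows "continuous_on {0..1} (\<lambda>u. if u \<le> 0 then 0 else F (- ln u))" (is "continuous_on _ ?h")
  unfolding continuous_on_eq_continuous_within
proof
  fix u :: real assume u: "u \<in> {0..1}"
  show "continuous (at u within {0..1}) ?h"
  proof (cases "u = 0")
    case True
    have "((\<lambda>u. F (- ln u)) \<longlongrightarrow> 0) (at_right 0)"
      by (rule filterlim_compose[OF lim]) (simp add: filterlim_uminus_at_top ln_at_0)
    then have "(?h \<longlongrightarrow> 0) (at_right 0)"
      by (rule Lim_transform_eventually) (auto simp: eventually_at_right_field intro: exI[of _ 1])
    then have "(?h \<longlongrightarrow> ?h 0) (at 0 within {0..1})"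
      by (simp add: at_within_Icc_at_right)
    with True show ?thesis by (simp add: continuous_within)
  next
    case False
    with u have "0 < u" by auto
    have "continuous_on {0<..1} (\<lambda>u. F (- ln u))"
      by (rule continuous_on_compose2[OF cont]) (auto intro!: continuous_intros)
    then have "continuous_on {0<..1} ?h"
      by (rule continuous_on_eq) auto
    then have "continuous (at u within {0<..1}) ?h"
      using u \<open>0 < u\<close> by (auto simp: continuous_on_eq_continuous_within)
    moreover have "at u within {0..1} = at u within {0<..1}"
      by (rule at_within_nhd[of _ "{0<..}"]) (use \<open>0 < u\<close> in auto)
    ultimately show ?thesis by simp
  qed
qed

lemma exp_polynomial_uniform_approx:
  fixes F :: "real \<Rightarrow> real"
  assumes "continuous_on {0..} F" "(F \<longlongrightarrow> 0) at_top" "e > 0"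
  obtains a and N :: nat where "\<And>z. z \<ge> 0 \<Longrightarrow> \<bar>F z - (\<Sum>i\<le>N. a i * exp (- z) ^ i)\<bar> < e"
proof -
  let ?h = "\<lambda>u. if u \<le> 0 then 0 else F (- ln u)"
  obtain P where P: "real_polynomial_function P" "\<And>u. u \<in> {0..1} \<Longrightarrow> \<bar>?h u - P u\<bar> < e"
    using Stone_Weierstrass_real_polynomial_function[OF compact_Icc continuous_on_compose_neg_ln assms(3)] assms
    by metis
  obtain a N where "P = (\<lambda>x. \<Sum>i\<le>(N::nat). a i * x ^ i)"
    using P(1) unfolding real_polynomial_function_iff_sum by auto
  then have "\<bar>F z - (\<Sum>i\<le>N. a i * exp (- z) ^ i)\<bar> < e" if "z \<ge> 0" for z
    using P(2)[of "exp (- z)"] that by simp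
  then show ?thesis by (rule that)
qed

lemma tendsto_integral_exp_polynomial_zero:
  fixes F :: "real \<Rightarrow> real" and a :: "nat \<Rightarrow> real"
  assumes cont: "continuous_on {0..} F"
    and moments: "\<And>n::nat. ((\<lambda>Y. integral {0..Y} (\<lambda>z. exp (- (real n + 1) * z) * F z)) \<longlongrightarrow> 0) at_top"
  shows "((\<lambda>Y. integral {0..Y} (\<lambda>z. exp (- z) * F z * (\<Sum>i\<le>N. a i * exp (- z) ^ i))) \<longlongrightarrow> 0) at_top"
proof -
  have "integral {0..Y} (\<lambda>z. exp (- z) * F z * (\<Sum>i\<le>N. a i * exp (- z) ^ i)) =
      (\<Sum>i\<le>N. a i * integral {0..Y} (\<lambda>z. exp (- (real i + 1) * z) * F z))" for Y
  proof -
    have "exp (- z) * exp (- z) ^ i = exp (- (real i + 1) * z)" for z :: real and i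
      unfolding exp_of_nat_mult[symmetric] exp_add[symmetric] by (simp add: algebra_simps)
    then have "exp (- z) * F z * (\<Sum>i\<le>N. a i * exp (- z) ^ i) = (\<Sum>i\<le>N. a i * (exp (- (real i + 1) * z) * F z))" for z
      unfolding sum_distrib_left by (intro sum.cong refl) (metis mult.assoc mult.commute)
    moreover have "(\<lambda>z. a i * (exp (- (real i + 1) * z) * F z)) integrable_on {0..Y}" for i
      by (intro integrable_continuous_interval continuous_intros continuous_on_subset[OF cont]) auto
    ultimately show ?thesis
      by (simp only: integral_sum[OF finite_atMost] integral_mult_right)
  qed
  moreover have "((\<lambda>Y. \<Sum>i\<le>N. a i * integral {0..Y} (\<lambda>z. exp (- (real i + 1) * z) * F z)) \<longlongrightarrow> (\<Sum>i\<le>N. a i * 0)) at_top"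
    by (intro tendsto_intros moments)
  ultimately show ?thesis by simp
qed

lemma integral_exp_mult_le:
  fixes F G :: "real \<Rightarrow> real"
  assumes cont: "continuous_on {0..Y} F" "continuous_on {0..Y} G" and Y: "Y \<ge> 0"
    and bounds: "\<And>z. z \<in> {0..Y} \<Longrightarrow> \<bar>F z\<bar> \<le> B" "\<And>z. z \<in> {0..Y} \<Longrightarrow> \<bar>G z\<bar> \<le> e" and "0 \<le> B" "0 \<le> e"
  shows "integral {0..Y} (\<lambda>z. exp (- z) * F z * G z) \<le> B * e"
proof -
  have primitive: "((\<lambda>z. B * e * exp (- z)) has_integral (- (B * e) * exp (- Y) - - (B * e) * exp (- 0))) {0..Y}"
    by (rule fundamental_theorem_of_calculus[OF Y])
       (auto intro!: derivative_eq_intros simp: has_real_derivative_iff_has_vector_derivative[symmetric])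
  have "integral {0..Y} (\<lambda>z. exp (- z) * F z * G z) \<le> integral {0..Y} (\<lambda>z. B * e * exp (- z))"
  proof (rule integral_le)
    show "(\<lambda>z. exp (- z) * F z * G z) integrable_on {0..Y}"
      by (intro integrable_continuous_interval continuous_intros cont)
    show "(\<lambda>z. B * e * exp (- z)) integrable_on {0..Y}" using primitive by blast
    fix z assume z: "z \<in> {0..Y}"
    have "F z * G z \<le> \<bar>F z\<bar> * \<bar>G z\<bar>" by (metis abs_ge_self abs_mult)
    also have "\<dots> \<le> B * e" by (intro mult_mono bounds z) (use assms in auto)
    finally show "exp (- z) * F z * G z \<le> B * e * exp (- z)"
      by (simp add: mult.assoc mult.commute[of _ "exp (- z)"])
  qed
  also have "\<dots> = - (B * e) * exp (- Y) - - (B * e) * exp (- 0)" using primitive by (rule integral_unique)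
  also have "\<dots> \<le> B * e" using assms by simp
  finally show ?thesis .
qed

lemma integral_exp_square_le:
  fixes F :: "real \<Rightarrow> real"
  assumes cont: "continuous_on {0..} F" and lim: "(F \<longlongrightarrow> 0) at_top" and B: "\<And>y. y \<ge> 0 \<Longrightarrow> \<bar>F y\<bar> \<le> B" "B \<ge> 0"
    and moments: "\<And>n::nat. ((\<lambda>Y. integral {0..Y} (\<lambda>z. exp (- (real n + 1) * z) * F z)) \<longlongrightarrow> 0) at_top"
    and y: "y \<ge> 0" and e: "e > 0"
  shows "integral {0..y} (\<lambda>z. exp (- z) * (F z)\<^sup>2) \<le> B * e"
proof -
  let ?sq = "\<lambda>z. exp (- z) * (F z)\<^sup>2"
  have contF: "continuous_on {0..Y} F" for Y by (rule continuous_on_subset[OF cont]) auto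
  obtain a and N :: nat where approx: "\<And>z. z \<ge> 0 \<Longrightarrow> \<bar>F z - (\<Sum>i\<le>N. a i * exp (- z) ^ i)\<bar> < e"
    using exp_polynomial_uniform_approx[OF cont lim e] by blast
  define P where "P z = (\<Sum>i\<le>N. a i * exp (- z) ^ i)" for z :: real
  have contP: "continuous_on S P" for S unfolding P_def by (intro continuous_intros)
  have "integral {0..y} ?sq \<le> B * e + integral {0..Y} (\<lambda>z. exp (- z) * F z * P z)" if Y: "Y \<ge> y" for Y
  proof -
    have "integral {0..y} ?sq \<le> integral {0..Y} ?sq"
      by (rule integral_subset_le) (use Y in \<open>auto intro!: integrable_continuous_interval continuous_intros contF\<close>)
    also have "\<dots> = integral {0..Y} (\<lambda>z. exp (- z) * F z * (F z - P z) + exp (- z) * F z * P z)"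
      by (simp add: algebra_simps power2_eq_square)
    also have "\<dots> = integral {0..Y} (\<lambda>z. exp (- z) * F z * (F z - P z)) + integral {0..Y} (\<lambda>z. exp (- z) * F z * P z)"
      by (intro integral_add integrable_continuous_interval continuous_intros contF contP)
    also have "integral {0..Y} (\<lambda>z. exp (- z) * F z * (F z - P z)) \<le> B * e"
      by (intro integral_exp_mult_le continuous_intros contF contP)
         (use B approx e Y y in \<open>auto simp: P_def intro!: less_imp_le[OF approx]\<close>)
    finally show ?thesis by simp
  qed
  then have "\<forall>\<^sub>F Y in at_top. integral {0..y} ?sq \<le> B * e + integral {0..Y} (\<lambda>z. exp (- z) * F z * P z)"
    using eventually_at_top_linorder by blast
  moreover have "((\<lambda>Y. B * e + integral {0..Y} (\<lambda>z. exp (- z) * F z * P z)) \<longlongrightarrow> B * e + 0) at_top"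
    unfolding P_def by (intro tendsto_intros tendsto_integral_exp_polynomial_zero[OF cont moments])
  ultimately show ?thesis
    using tendsto_lowerbound[OF _ _ trivial_limit_at_top_linorder] by fastforce
qed

lemma exp_moments_zero_imp_zero:
  fixes F :: "real \<Rightarrow> real"
  assumes cont: "continuous_on {0..} F" and lim: "(F \<longlongrightarrow> 0) at_top"
    and moments: "\<And>n::nat. ((\<lambda>Y. integral {0..Y} (\<lambda>z. exp (- (real n + 1) * z) * F z)) \<longlongrightarrow> 0) at_top"
    and y: "y > 0"
  shows "F y = 0"
proof -
  let ?sq = "\<lambda>z. exp (- z) * (F z)\<^sup>2"
  obtain B where B: "B > 0" "\<And>y. y \<ge> 0 \<Longrightarrow> \<bar>F y\<bar> \<le> B"
    using continuous_on_atLeast_tendsto_bounded[OF cont lim] by blast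
  have cont_sq: "continuous_on {0..y} ?sq" by (intro continuous_intros continuous_on_subset[OF cont]) auto
  then have integrable: "?sq integrable_on {0..y}" by (rule integrable_continuous_interval)
  have "integral {0..y} ?sq \<le> 0 + e" if "e > 0" for e
    using integral_exp_square_le[OF cont lim B(2) _ moments, of y "e / B"] that B(1) y by simp
  then have "integral {0..y} ?sq \<le> 0" by (rule field_le_epsilon)
  moreover have "integral {0..y} ?sq \<ge> 0" by (rule integral_nonneg[OF integrable]) auto
  ultimately have "(?sq has_integral 0) (cbox 0 y)"
    using integrable_integral[OF integrable] by simp
  then have "?sq y = 0"
    using has_integral_0_cbox_imp_0[of 0 y ?sq y] cont_sq y by auto
  then show ?thesis by simp
qed

lemma integral_exp_mult_primitive:
  fixes g :: "real \<Rightarrow> real"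
  assumes cont: "continuous_on {0..y} g" and y: "y \<ge> 0" and n: "n \<noteq> 0"
  defines "G \<equiv> \<lambda>z. integral {0..z} g"
  shows "integral {0..y} (\<lambda>z. exp (- n * z) * G z) = (integral {0..y} (\<lambda>z. exp (- n * z) * g z) - exp (- n * y) * G y) / n"
proof -
  have deriv: "(G has_real_derivative g z) (at z within {0..y})" if "z \<in> {0..y}" for z
    unfolding G_def by (rule integral_has_real_derivative[OF cont that])
  then have contG: "continuous_on {0..y} G"
    by (meson DERIV_continuous continuous_on_eq_continuous_within)
  have "((\<lambda>z. exp (- n * z) * g z - n * (exp (- n * z) * G z)) has_integral (exp (- n * y) * G y - exp (- n * 0) * G 0)) {0..y}"
  proof (rule fundamental_theorem_of_calculus[OF y])
    fix x assume x: "x \<in> {0..y}"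
    have "((\<lambda>z. exp (- n * z) * G z) has_real_derivative exp (- n * x) * g x - n * (exp (- n * x) * G x)) (at x within {0..y})"
      by (rule derivative_eq_intros deriv x refl | simp add: algebra_simps)+
    then show "((\<lambda>z. exp (- n * z) * G z) has_vector_derivative exp (- n * x) * g x - n * (exp (- n * x) * G x)) (at x within {0..y})"
      by (simp add: has_real_derivative_iff_has_vector_derivative)
  qed
  then have "exp (- n * y) * G y = integral {0..y} (\<lambda>z. exp (- n * z) * g z - n * (exp (- n * z) * G z))"
    by (simp add: integral_unique G_def)
  also have "\<dots> = integral {0..y} (\<lambda>z. exp (- n * z) * g z) - integral {0..y} (\<lambda>z. n * (exp (- n * z) * G z))"
    by (rule integral_diff) (intro integrable_continuous_interval continuous_intros cont contG)+
  also have "integral {0..y} (\<lambda>z. n * (exp (- n * z) * G z)) = n * integral {0..y} (\<lambda>z. exp (- n * z) * G z)"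
    by (simp only: integral_mult_right)
  finally show ?thesis using n by (simp add: field_simps)
qed

lemma continuous_on_atLeast_integral:
  fixes g :: "real \<Rightarrow> real"
  assumes "continuous_on {0..} g"
  shows "continuous_on {0..} (\<lambda>y. integral {0..y} g)"
  unfolding continuous_on_eq_continuous_within
proof
  fix z :: real assume z: "z \<in> {0..}"
  have "continuous_on {0..z + 1} (\<lambda>y. integral {0..y} g)"
    by (intro indefinite_integral_continuous_1 integrable_continuous_interval continuous_on_subset[OF assms]) auto
  then have "continuous (at z within {0..z + 1}) (\<lambda>y. integral {0..y} g)"
    using z by (auto simp: continuous_on_eq_continuous_within)
  moreover have "at z within {0..} = at z within {0..z + 1}"
    by (rule at_within_nhd[of _ "{..<z + 1}"]) auto
  ultimately show "continuous (at z within {0..}) (\<lambda>y. integral {0..y} g)" by simp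
qed

lemma primitive_zero_imp_zero:
  fixes g :: "real \<Rightarrow> real"
  assumes cont: "continuous_on {0..} g" and zero: "\<And>z. z \<ge> 0 \<Longrightarrow> integral {0..z} g = 0" and y: "y \<ge> 0"
  shows "g y = 0"
proof -
  have "((\<lambda>z. integral {0..z} g) has_real_derivative g y) (at y within {0..y + 1})"
    by (rule integral_has_real_derivative) (use y in \<open>auto intro: continuous_on_subset[OF cont]\<close>)
  then have "((\<lambda>z. 0) has_real_derivative g y) (at y within {0..y + 1})"
    by (rule has_field_derivative_transform_within[where d=1]) (use y zero in auto)
  then show ?thesis
    using has_field_derivative_unique[of "\<lambda>z. 0" "g y" y "{0..y + 1}" 0] y
    by (simp add: trivial_limit_within islimpt_Icc)
qed

lemma exp_moment_primitive_tendsto_zero: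
  fixes g :: "real \<Rightarrow> real"
  assumes cont: "continuous_on {0..} g" and r: "r > 0"
    and transform: "((\<lambda>y. exp (- r * y) * g y) has_integral 0) {0..}"
    and lim: "((\<lambda>y. integral {0..y} g) \<longlongrightarrow> 0) at_top"
  shows "((\<lambda>y. integral {0..y} (\<lambda>z. exp (- r * z) * integral {0..z} g)) \<longlongrightarrow> 0) at_top"
proof -
  have "((\<lambda>y. exp (- r * y)) \<longlongrightarrow> 0) at_top"
    by (intro filterlim_compose[OF exp_at_bot] filterlim_tendsto_neg_mult_at_bot[OF tendsto_const _ filterlim_ident])
       (use r in simp)
  then have "((\<lambda>y. (integral {0..y} (\<lambda>z. exp (- r * z) * g z) - exp (- r * y) * integral {0..y} g) / r) \<longlongrightarrow> (0 - 0 * 0) / r) at_top"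
    using r by (intro tendsto_intros has_integral_atLeast_imp_tendsto transform lim) auto
  moreover have "\<forall>\<^sub>F y in at_top. (integral {0..y} (\<lambda>z. exp (- r * z) * g z) - exp (- r * y) * integral {0..y} g) / r
      = integral {0..y} (\<lambda>z. exp (- r * z) * integral {0..z} g)"
    using eventually_ge_at_top[of 0]
  proof eventually_elim
    case (elim y)
    have "continuous_on {0..y} g" by (rule continuous_on_subset[OF cont]) auto
    from integral_exp_mult_primitive[OF this elim, of r] show ?case using r by simp
  qed
  ultimately show ?thesis using Lim_transform_eventually by fastforce
qed

lemma laplace_transform_zero_imp_zero:
  fixes f :: "real \<Rightarrow> real"
  assumes cont: "continuous_on {0..} f"
    and transform: "\<And>l. l > L \<Longrightarrow> ((\<lambda>y. exp (- l * y) * f y) has_integral 0) {0..}"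
    and y: "y \<ge> 0"
  shows "f y = 0"
proof -
  define g where "g z = exp (- (L + 1) * z) * f z" for z
  let ?G = "\<lambda>y. integral {0..y} g"
  have contg: "continuous_on {0..} g" unfolding g_def by (intro continuous_intros cont)
  have transform_g: "((\<lambda>y. exp (- r * y) * g y) has_integral 0) {0..}" if "r \<ge> 0" for r
  proof -
    have "exp (- r * y) * g y = exp (- (L + 1 + r) * y) * f y" for y
      by (simp add: g_def exp_add[symmetric] algebra_simps)
    then show ?thesis using transform[of "L + 1 + r"] that by simp
  qed
  have limG: "(?G \<longlongrightarrow> 0) at_top"
    using has_integral_atLeast_imp_tendsto[OF transform_g[of 0]] by simp
  have "?G z = 0" if z: "z > 0" for z
    by (rule exp_moments_zero_imp_zero[OF continuous_on_atLeast_integral[OF contg] limG _ z])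
       (intro exp_moment_primitive_tendsto_zero contg transform_g limG; simp)
  then have "?G z = 0" if "z \<ge> 0" for z using that by (cases "z = 0") auto
  then have "g y = 0" by (rule primitive_zero_imp_zero[OF contg _ y])
  then show ?thesis by (simp add: g_def)
qed

section \<open>Integrals over compact intervals\<close>

lemma integrable_bounded_support:
  fixes h :: "'b \<Rightarrow> real"
  assumes "h \<in> borel_measurable N" "S \<in> sets N" "emeasure N S < \<infinity>"
    and "\<And>z. z \<in> space N \<Longrightarrow> \<bar>h z\<bar> \<le> B * indicator S z"
  shows "integrable N h"
proof (rule Bochner_Integration.integrable_bound)
  show "integrable N (\<lambda>z. B * indicator S z :: real)" using assms(2,3) by simp
  show "AE x in N. norm (h x) \<le> norm (B * indicator S x :: real)"
    using assms(4) by (intro AE_I2) (smt (verit) real_norm_def)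
qed fact

lemma emeasure_lborel_pair_Icc_Icc_finite:
  fixes s t u v :: real
  shows "emeasure (lborel \<Otimes>\<^sub>M lborel) ({s..t} \<times> {u..v}) < \<infinity>"
  by (simp add: lborel.emeasure_pair_measure_Times emeasure_lborel_Icc_eq ennreal_mult_less_top)

lemma set_integrable_Icc_bounded:
  fixes f :: "real \<Rightarrow> real"
  assumes [measurable]: "f \<in> borel_measurable borel" and bound: "\<And>z. u \<le> z \<Longrightarrow> z \<le> v \<Longrightarrow> \<bar>f z\<bar> \<le> B"
  shows "set_integrable lborel {u..v} f"
  unfolding set_integrable_def
  by (rule integrable_bounded_support[where S="{u..v}" and B=B])
     (use bound in \<open>auto simp: indicator_def emeasure_lborel_Icc_eq\<close>)

lemma abs_set_integral_Icc_le:
  fixes f :: "real \<Rightarrow> real"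
  assumes "f \<in> borel_measurable borel" and bound: "\<And>z. u \<le> z \<Longrightarrow> z \<le> v \<Longrightarrow> \<bar>f z\<bar> \<le> B"
  shows "\<bar>LBINT z:{u..v}. f z\<bar> \<le> B * max 0 (v - u)"
proof -
  have "norm (LBINT z:{u..v}. f z) \<le> (\<integral>z. B * indicator {u..v} z \<partial>lborel)"
    unfolding set_lebesgue_integral_def
  proof (rule Bochner_Integration.integral_norm_bound_integral)
    show "integrable lborel (\<lambda>z. indicator {u..v} z *\<^sub>R f z)"
      using set_integrable_Icc_bounded[OF assms] by (simp add: set_integrable_def)
    show "norm (indicator {u..v} z *\<^sub>R f z) \<le> B * indicator {u..v} z" for z
      using bound[of z] by (auto simp: indicator_def)
  qed (auto simp: emeasure_lborel_Icc_eq)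
  also have "\<dots> = B * max 0 (v - u)" by (cases "u \<le> v") auto
  finally show ?thesis by simp
qed

lemma set_integral_Icc_degenerate:
  fixes f :: "real \<Rightarrow> real"
  assumes "v \<le> u"
  shows "(LBINT z:{u..v}. f z) = 0"
proof (cases "v = u")
  case True
  then show ?thesis by (simp add: set_integral_at_point)
qed (use assms in \<open>simp add: set_lebesgue_integral_def\<close>)

lemma set_integral_Icc_combine:
  fixes f :: "real \<Rightarrow> real"
  assumes "u \<le> w" "w \<le> v" "set_integrable lborel {u..v} f"
  shows "(LBINT z:{u..v}. f z) = (LBINT z:{u..w}. f z) + (LBINT z:{w..v}. f z)"
proof -
  have "{u..v} = {u..w} \<union> {w..v}" using assms by auto
  moreover have "AE z in lborel. \<not> (z \<in> {u..w} \<and> z \<in> {w..v})"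
    using AE_lborel_singleton[of w] by eventually_elim auto
  moreover have "set_integrable lborel {u..w} f" "set_integrable lborel {w..v} f"
    by (rule set_integrable_subset[OF assms(3)]; use assms in auto)+
  ultimately show ?thesis by (simp add: set_integral_Un_AE)
qed

lemma set_integral_Icc_shift:
  fixes f :: "real \<Rightarrow> real"
  shows "(LBINT z:{u + r..v + r}. f z) = (LBINT z:{u..v}. f (z + r))"
  unfolding set_lebesgue_integral_def
  by (subst lborel_integral_real_affine[where c=1 and t=r])
     (auto simp: indicator_def add.commute intro!: Bochner_Integration.integral_cong)

lemma set_integral_Icc_reflect:
  fixes f :: "real \<Rightarrow> real"
  shows "(LBINT z:{u..v}. f z) = (LBINT z:{r - v..r - u}. f (r - z))"
  unfolding set_lebesgue_integral_def
  by (subst lborel_integral_real_affine[where c="-1" and t=r])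
     (auto simp: indicator_def intro!: Bochner_Integration.integral_cong)

lemma interval_integral_eq_set_integral_Icc:
  fixes f :: "real \<Rightarrow> real"
  assumes "\<And>z. v < z \<Longrightarrow> z < u \<Longrightarrow> f z = 0"
  shows "(LBINT z=ereal u..ereal v. f z) = (LBINT z:{u..v}. f z)"
proof (cases "u \<le> v")
  case False
  have "(LBINT z=ereal u..ereal v. f z) = - (LBINT z=ereal v..ereal u. f z)"
    by (rule interval_integral_endpoints_reverse)
  also have "(LBINT z=ereal v..ereal u. f z) = (LBINT z=ereal v..ereal u. 0)"
    by (rule interval_integral_cong) (use False assms in \<open>auto simp: einterval_def min_def max_def\<close>)
  finally show ?thesis using False by (simp add: set_lebesgue_integral_def)
qed (simp add: interval_integral_Icc)

lemma set_integral_subset_Icc: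
  fixes h :: "real \<Rightarrow> real"
  assumes "A \<subseteq> {u..v}"
  shows "(LBINT y:A. h y) = (LBINT y:{u..v}. indicator A y * h y)"
  unfolding set_lebesgue_integral_def
  by (rule Bochner_Integration.integral_cong) (use assms in \<open>auto simp: indicator_def\<close>)

lemma set_integral_Icc_swap:
  fixes h :: "real \<Rightarrow> real \<Rightarrow> real"
  assumes [measurable]: "case_prod h \<in> borel_measurable (lborel \<Otimes>\<^sub>M lborel)"
    and bound: "\<And>x y. s \<le> x \<Longrightarrow> x \<le> t \<Longrightarrow> u \<le> y \<Longrightarrow> y \<le> v \<Longrightarrow> \<bar>h x y\<bar> \<le> B"
  shows "(LBINT x:{s..t}. LBINT y:{u..v}. h x y) = (LBINT y:{u..v}. LBINT x:{s..t}. h x y)"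
proof -
  have int: "integrable (lborel \<Otimes>\<^sub>M lborel) (\<lambda>(x, y). indicator {s..t} x * (indicator {u..v} y * h x y))"
    by (rule integrable_bounded_support[OF _ _ emeasure_lborel_pair_Icc_Icc_finite, where B=B])
       (use bound in \<open>auto simp: indicator_def\<close>)
  have "(LBINT x:{s..t}. LBINT y:{u..v}. h x y)
      = (\<integral>x. \<integral>y. indicator {s..t} x * (indicator {u..v} y * h x y) \<partial>lborel \<partial>lborel)"
    by (simp add: set_lebesgue_integral_def)
  also have "\<dots> = (\<integral>y. \<integral>x. indicator {s..t} x * (indicator {u..v} y * h x y) \<partial>lborel \<partial>lborel)"
    by (rule lborel_pair.Fubini_integral[OF int, symmetric])
  also have "\<dots> = (\<integral>y. \<integral>x. indicator {u..v} y * (indicator {s..t} x * h x y) \<partial>lborel \<partial>lborel)"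
    by (simp only: mult.left_commute)
  also have "\<dots> = (LBINT y:{u..v}. LBINT x:{s..t}. h x y)"
    by (simp add: set_lebesgue_integral_def)
  finally show ?thesis .
qed

lemma measurable_set_integral_Icc [measurable (raw)]:
  fixes h :: "'b \<Rightarrow> real \<Rightarrow> real"
  assumes [measurable]: "u \<in> borel_measurable N" "v \<in> borel_measurable N"
    and [measurable]: "case_prod h \<in> borel_measurable (N \<Otimes>\<^sub>M lborel)"
  shows "(\<lambda>x. LBINT z:{u x..v x}. h x z) \<in> borel_measurable N"
proof -
  have "(LBINT z:{u x..v x}. h x z) = (\<integral>z. (if u x \<le> z \<and> z \<le> v x then h x z else 0) \<partial>lborel)" for x
    unfolding set_lebesgue_integral_def
    by (rule Bochner_Integration.integral_cong) (auto simp: indicator_def)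
  then show ?thesis by simp
qed

section \<open>Convolution of locally bounded functions on the half line\<close>

definition loc_bounded :: "(real \<Rightarrow> real) \<Rightarrow> bool" where
  "loc_bounded f \<longleftrightarrow> f \<in> borel_measurable borel \<and> (\<forall>T. \<exists>B. \<forall>x\<in>{0..T}. \<bar>f x\<bar> \<le> B)"

definition conv :: "(real \<Rightarrow> real) \<Rightarrow> (real \<Rightarrow> real) \<Rightarrow> real \<Rightarrow> real" where
  "conv f g x = (LBINT z:{0..x}. f (x - z) * g z)"

lemma loc_boundedD:
  assumes "loc_bounded f"
  obtains B where "B \<ge> 0" "\<And>x. 0 \<le> x \<Longrightarrow> x \<le> T \<Longrightarrow> \<bar>f x\<bar> \<le> B"
proof -
  obtain B where "\<forall>x\<in>{0..T}. \<bar>f x\<bar> \<le> B" using assms unfolding loc_bounded_def by blast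
  then show ?thesis using that[of "max 0 B"] by (simp add: le_max_iff_disj)
qed

lemma loc_bounded_atMostD:
  assumes "loc_bounded f" "\<And>x. x < 0 \<Longrightarrow> f x = 0"
  obtains B where "B \<ge> 0" "\<And>x. x \<le> T \<Longrightarrow> \<bar>f x\<bar> \<le> B"
proof -
  obtain B where B: "B \<ge> 0" "\<And>x. 0 \<le> x \<Longrightarrow> x \<le> T \<Longrightarrow> \<bar>f x\<bar> \<le> B" using loc_boundedD[OF assms(1)] by metis
  have "\<bar>f x\<bar> \<le> B" if "x \<le> T" for x using that B assms(2)[of x] by (cases "x < 0") auto
  then show ?thesis using that B(1) by blast
qed

lemma loc_bounded_multD:
  assumes "loc_bounded f" "loc_bounded g"
  obtains B where "B \<ge> 0" "\<And>x y. 0 \<le> x \<Longrightarrow> x \<le> T \<Longrightarrow> 0 \<le> y \<Longrightarrow> y \<le> T \<Longrightarrow> \<bar>f x * g y\<bar> \<le> B"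
proof -
  obtain Bf where Bf: "Bf \<ge> 0" "\<And>x. 0 \<le> x \<Longrightarrow> x \<le> T \<Longrightarrow> \<bar>f x\<bar> \<le> Bf" using loc_boundedD[OF assms(1)] by metis
  obtain Bg where Bg: "Bg \<ge> 0" "\<And>x. 0 \<le> x \<Longrightarrow> x \<le> T \<Longrightarrow> \<bar>g x\<bar> \<le> Bg" using loc_boundedD[OF assms(2)] by metis
  have "\<bar>f x * g y\<bar> \<le> Bf * Bg" if "0 \<le> x" "x \<le> T" "0 \<le> y" "y \<le> T" for x y
    unfolding abs_mult using that by (intro mult_mono Bf Bg) auto
  then show ?thesis using that[of "Bf * Bg"] Bf(1) Bg(1) by simp
qed

lemma loc_bounded_measurable: "loc_bounded f \<Longrightarrow> f \<in> borel_measurable borel"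
  by (simp add: loc_bounded_def)

lemma loc_bounded_continuous:
  assumes "f \<in> borel_measurable borel" "continuous_on {0..} f"
  shows "loc_bounded f"
  unfolding loc_bounded_def
proof (intro conjI allI assms)
  fix T
  have "compact (f ` {0..T})"
    by (rule compact_continuous_image) (auto intro: continuous_on_subset[OF assms(2)])
  then have "bounded (f ` {0..T})" by (rule compact_imp_bounded)
  then show "\<exists>B. \<forall>x\<in>{0..T}. \<bar>f x\<bar> \<le> B" unfolding bounded_iff by (metis image_eqI real_norm_def)
qed

lemma loc_bounded_mult:
  assumes "loc_bounded f" "loc_bounded g"
  shows "loc_bounded (\<lambda>z. f z * g z)"
  unfolding loc_bounded_def
proof (intro conjI allI)
  show "(\<lambda>z. f z * g z) \<in> borel_measurable borel" using assms by (auto simp: loc_bounded_def)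
  fix T show "\<exists>B. \<forall>x\<in>{0..T}. \<bar>f x * g x\<bar> \<le> B"
    using loc_bounded_multD[OF assms, of T] by (metis atLeastAtMost_iff)
qed

lemma loc_bounded_add_scaled:
  assumes f: "loc_bounded f" and g: "loc_bounded g"
  shows "loc_bounded (\<lambda>z. f z + r * g z)"
  unfolding loc_bounded_def
proof (intro conjI allI)
  show "(\<lambda>z. f z + r * g z) \<in> borel_measurable borel" using f g by (auto simp: loc_bounded_def)
  fix T
  obtain Bf where Bf: "\<And>z. 0 \<le> z \<Longrightarrow> z \<le> T \<Longrightarrow> \<bar>f z\<bar> \<le> Bf" using loc_boundedD[OF f] by metis
  obtain Bg where Bg: "\<And>z. 0 \<le> z \<Longrightarrow> z \<le> T \<Longrightarrow> \<bar>g z\<bar> \<le> Bg" using loc_boundedD[OF g] by metis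
  have "\<bar>f x + r * g x\<bar> \<le> Bf + \<bar>r\<bar> * Bg" if "x \<in> {0..T}" for x
  proof -
    have "\<bar>f x + r * g x\<bar> \<le> \<bar>f x\<bar> + \<bar>r\<bar> * \<bar>g x\<bar>" by (metis abs_mult abs_triangle_ineq)
    also have "\<dots> \<le> Bf + \<bar>r\<bar> * Bg" using that by (intro add_mono mult_left_mono Bf Bg) auto
    finally show ?thesis .
  qed
  then show "\<exists>B. \<forall>x\<in>{0..T}. \<bar>f x + r * g x\<bar> \<le> B" by blast
qed

lemma loc_bounded_const: "loc_bounded (\<lambda>_. r)"
  by (auto simp: loc_bounded_def)

lemma loc_bounded_scaled: "loc_bounded f \<Longrightarrow> loc_bounded (\<lambda>z. r * f z)"
  by (rule loc_bounded_mult[OF loc_bounded_const])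

lemma loc_bounded_exp: "loc_bounded (\<lambda>z. exp (r * z))"
  by (rule loc_bounded_continuous) (auto intro!: continuous_intros)

lemma loc_bounded_set_integrable:
  assumes f: "loc_bounded f"
  shows "set_integrable lborel {0..T} f"
proof -
  obtain B where "\<And>z. 0 \<le> z \<Longrightarrow> z \<le> T \<Longrightarrow> \<bar>f z\<bar> \<le> B" using loc_boundedD[OF f] by metis
  then show ?thesis by (rule set_integrable_Icc_bounded[OF loc_bounded_measurable[OF f]])
qed

lemma conv_set_integrable:
  assumes f: "loc_bounded f" and g: "loc_bounded g"
  shows "set_integrable lborel {0..x} (\<lambda>z. f (x - z) * g z)"
proof -
  note [measurable] = assms[THEN loc_bounded_measurable]
  obtain B where "\<And>u v. 0 \<le> u \<Longrightarrow> u \<le> x \<Longrightarrow> 0 \<le> v \<Longrightarrow> v \<le> x \<Longrightarrow> \<bar>f u * g v\<bar> \<le> B"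
    using loc_bounded_multD[OF f g] by metis
  then show ?thesis by (intro set_integrable_Icc_bounded[where B=B]) auto
qed

lemma conv_eq_0: "x < 0 \<Longrightarrow> conv f g x = 0"
  by (simp add: conv_def set_lebesgue_integral_def)

lemma conv_nonneg:
  assumes "\<And>z. 0 \<le> f z" "\<And>z. 0 \<le> g z"
  shows "0 \<le> conv f g x"
  unfolding conv_def set_lebesgue_integral_def
  by (rule Bochner_Integration.integral_nonneg) (simp add: assms)

lemma conv_cong:
  assumes "\<And>z. 0 \<le> z \<Longrightarrow> z \<le> x \<Longrightarrow> f z = f' z" "\<And>z. 0 \<le> z \<Longrightarrow> z \<le> x \<Longrightarrow> g z = g' z"
  shows "conv f g x = conv f' g' x"
  unfolding conv_def by (rule set_lebesgue_integral_cong) (auto simp: assms)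

lemma conv_commute: "conv f g x = conv g f x"
  unfolding conv_def by (subst set_integral_Icc_reflect[where r=x]) (simp add: mult.commute)

lemma conv_measurable:
  assumes [measurable]: "f \<in> borel_measurable borel" "g \<in> borel_measurable borel"
  shows "conv f g \<in> borel_measurable borel"
  unfolding conv_def[abs_def] by measurable

lemma conv_exp: "conv (\<lambda>z. exp (c * z)) f x = exp (c * x) * (LBINT z:{0..x}. exp (- c * z) * f z)"
proof -
  have "exp (c * (x - z)) = exp (c * x) * exp (- c * z)" for z
    unfolding exp_add[symmetric] by (simp add: algebra_simps)
  then show ?thesis unfolding conv_def by (simp only: mult.assoc set_integral_mult_right)
qed

lemma abs_conv_le:
  assumes [measurable]: "f \<in> borel_measurable borel" "g \<in> borel_measurable borel"
    and f: "\<And>z. 0 \<le> z \<Longrightarrow> z \<le> x \<Longrightarrow> \<bar>f z\<bar> \<le> F" and g: "\<And>z. 0 \<le> z \<Longrightarrow> z \<le> x \<Longrightarrow> \<bar>g z\<bar> \<le> G" and "F \<ge> 0"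
  shows "\<bar>conv f g x\<bar> \<le> F * G * max 0 x"
proof -
  have "\<bar>f (x - z) * g z\<bar> \<le> F * G" if "0 \<le> z" "z \<le> x" for z
    unfolding abs_mult using that \<open>F \<ge> 0\<close> by (intro mult_mono f g) auto
  then show ?thesis unfolding conv_def using abs_set_integral_Icc_le[of "\<lambda>z. f (x - z) * g z" 0 x "F * G"] by simp
qed

lemma conv_loc_bounded:
  assumes f: "loc_bounded f" and g: "loc_bounded g"
  shows "loc_bounded (conv f g)"
  unfolding loc_bounded_def
proof (intro conjI allI)
  note [measurable] = assms[THEN loc_bounded_measurable]
  show "conv f g \<in> borel_measurable borel" by (rule conv_measurable) measurable
  fix T
  obtain B where B: "B \<ge> 0" "\<And>u v. 0 \<le> u \<Longrightarrow> u \<le> T \<Longrightarrow> 0 \<le> v \<Longrightarrow> v \<le> T \<Longrightarrow> \<bar>f u * g v\<bar> \<le> B"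
    using loc_bounded_multD[OF f g] by metis
  have "\<bar>conv f g x\<bar> \<le> B * T" if x: "x \<in> {0..T}" for x
  proof -
    have "\<bar>conv f g x\<bar> \<le> B * max 0 (x - 0)"
      unfolding conv_def by (rule abs_set_integral_Icc_le, measurable) (use B x in auto)
    also have "\<dots> \<le> B * T" using x B(1) by (intro mult_left_mono) auto
    finally show ?thesis .
  qed
  then show "\<exists>B. \<forall>x\<in>{0..T}. \<bar>conv f g x\<bar> \<le> B" by blast
qed

lemma conv_conv_integrable:
  assumes f: "loc_bounded f" and g: "loc_bounded g" and h: "loc_bounded h"
  shows "integrable (lborel \<Otimes>\<^sub>M lborel)
    (\<lambda>(z, u). if 0 \<le> u \<and> u \<le> z \<and> z \<le> x then f (x - z) * (g (z - u) * h u) else 0)" (is "integrable _ ?F")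
proof -
  note [measurable] = assms[THEN loc_bounded_measurable]
  obtain Bf where Bf: "Bf \<ge> 0" "\<And>z. 0 \<le> z \<Longrightarrow> z \<le> x \<Longrightarrow> \<bar>f z\<bar> \<le> Bf" using loc_boundedD[OF f] by metis
  obtain B where B: "B \<ge> 0" "\<And>u v. 0 \<le> u \<Longrightarrow> u \<le> x \<Longrightarrow> 0 \<le> v \<Longrightarrow> v \<le> x \<Longrightarrow> \<bar>g u * h v\<bar> \<le> B"
    using loc_bounded_multD[OF g h] by metis
  have bound: "\<bar>f (x - z) * (g (z - u) * h u)\<bar> \<le> Bf * B" if "0 \<le> u" "u \<le> z" "z \<le> x" for z u
    unfolding abs_mult[of "f (x - z)"] using that by (intro mult_mono Bf B) auto
  show ?thesis
  proof (rule integrable_bounded_support[OF _ _ emeasure_lborel_pair_Icc_Icc_finite])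
    show "\<bar>?F w\<bar> \<le> Bf * B * indicator ({0..x} \<times> {0..x}) w" for w
      using bound Bf(1) B(1) by (auto simp: indicator_def split: prod.split)
  qed auto
qed

lemma conv_assoc:
  assumes f: "loc_bounded f" and g: "loc_bounded g" and h: "loc_bounded h"
  shows "conv f (conv g h) x = conv (conv f g) h x"
proof -
  define F where "F z u = (if 0 \<le> u \<and> u \<le> z \<and> z \<le> x then f (x - z) * (g (z - u) * h u) else 0)" for z u
  have "conv f (conv g h) x = (\<integral>z. (\<integral>u. F z u \<partial>lborel) \<partial>lborel)"
    unfolding conv_def set_lebesgue_integral_def real_scaleR_def
  proof (rule Bochner_Integration.integral_cong[OF refl])
    fix z
    show "indicator {0..x} z * (f (x - z) * (\<integral>u. indicator {0..z} u * (g (z - u) * h u) \<partial>lborel)) = (\<integral>u. F z u \<partial>lborel)"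
      unfolding integral_mult_right_zero[symmetric]
      by (rule Bochner_Integration.integral_cong) (auto simp: F_def indicator_def)
  qed
  also have "\<dots> = (\<integral>u. (\<integral>z. F z u \<partial>lborel) \<partial>lborel)"
    unfolding F_def by (rule lborel_pair.Fubini_integral[OF conv_conv_integrable[OF f g h], symmetric])
  also have "\<dots> = conv (conv f g) h x"
    unfolding conv_def[of "conv f g"] set_lebesgue_integral_def real_scaleR_def
  proof (rule Bochner_Integration.integral_cong[OF refl])
    fix u
    have "(\<integral>z. F z u \<partial>lborel) = (\<integral>s. F (u + 1 * s) u \<partial>lborel)"
      by (subst lborel_integral_real_affine[where c=1 and t=u]) auto
    also have "\<dots> = indicator {0..x} u * (conv f g (x - u) * h u)"
      unfolding conv_def set_lebesgue_integral_def real_scaleR_def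
        integral_mult_left_zero[symmetric] integral_mult_right_zero[symmetric]
      by (rule Bochner_Integration.integral_cong) (auto simp: F_def indicator_def algebra_simps)
    finally show "(\<integral>z. F z u \<partial>lborel) = indicator {0..x} u * (conv f g (x - u) * h u)" .
  qed
  finally show ?thesis .
qed

lemma conv_add_scaled_right:
  assumes "loc_bounded f" "loc_bounded g" "loc_bounded h"
  shows "conv f (\<lambda>z. g z + r * h z) x = conv f g x + r * conv f h x"
proof -
  have "conv f (\<lambda>z. g z + r * h z) x = (LBINT z:{0..x}. f (x - z) * g z + r * (f (x - z) * h z))"
    by (simp add: conv_def algebra_simps)
  also have "\<dots> = conv f g x + r * conv f h x"
    using conv_set_integrable[OF assms(1,2)] conv_set_integrable[OF assms(1,3)] by (simp add: conv_def)
  finally show ?thesis .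
qed

lemma conv_add_scaled_left:
  assumes "loc_bounded f" "loc_bounded g" "loc_bounded h"
  shows "conv (\<lambda>z. g z + r * h z) f x = conv g f x + r * conv h f x"
  using conv_add_scaled_right[OF assms] by (simp add: conv_commute)

lemma conv_scaled_right: "conv f (\<lambda>z. r * g z) x = r * conv f g x"
  by (simp add: conv_def mult.left_commute)

lemma conv_integrand_tendsto:
  fixes f g :: "real \<Rightarrow> real"
  assumes f: "continuous_on {0..} f" and s: "s \<longlonglongrightarrow> x" and "z \<noteq> x"
  shows "(\<lambda>n. indicator {0..s n} z * (f (s n - z) * g z)) \<longlonglongrightarrow> indicator {0..x} z * (f (x - z) * g z)"
proof (cases "z < x")
  case True
  have before: "\<forall>\<^sub>F n in sequentially. z < s n" using order_tendstoD(1)[OF s True] .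
  have "(\<lambda>n. f (max 0 (s n - z))) \<longlonglongrightarrow> f (max 0 (x - z))"
    by (rule continuous_on_tendsto_compose[OF f]) (auto intro!: tendsto_max tendsto_diff s)
  then have "(\<lambda>n. f (s n - z)) \<longlonglongrightarrow> f (x - z)"
    using True by (rule_tac Lim_transform_eventually[where f="\<lambda>n. f (max 0 (s n - z))"])
      (use before in \<open>auto elim: eventually_mono\<close>)
  then have "(\<lambda>n. indicator {0..x} z * (f (s n - z) * g z)) \<longlonglongrightarrow> indicator {0..x} z * (f (x - z) * g z)"
    by (intro tendsto_intros)
  moreover have "\<forall>\<^sub>F n in sequentially. indicator {0..x} z * (f (s n - z) * g z) = indicator {0..s n} z * (f (s n - z) * g z)"
    using before by eventually_elim (use True in \<open>auto simp: indicator_def\<close>)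
  ultimately show ?thesis by (rule Lim_transform_eventually)
next
  case False
  then have "x < z" using \<open>z \<noteq> x\<close> by simp
  then have "\<forall>\<^sub>F n in sequentially. s n < z" by (rule order_tendstoD(2)[OF s])
  then have "\<forall>\<^sub>F n in sequentially. 0 = indicator {0..s n} z * (f (s n - z) * g z)"
    by eventually_elim (auto simp: indicator_def)
  then show ?thesis using \<open>x < z\<close> by (auto intro: Lim_transform_eventually[OF tendsto_const])
qed

lemma conv_continuous:
  assumes f: "loc_bounded f" "continuous_on {0..} f" and g: "loc_bounded g"
  shows "continuous_on {0..} (conv f g)"
  unfolding continuous_on_sequentially comp_def
proof (intro ballI allI impI, elim conjE)
  note [measurable] = f(1)[THEN loc_bounded_measurable] g[THEN loc_bounded_measurable]
  fix x :: real and s assume s: "\<forall>n. s n \<in> {0..}" "s \<longlonglongrightarrow> x"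
  obtain T where T: "\<And>n. s n \<le> T"
    using convergent_imp_Bseq[OF convergentI[OF s(2)]] unfolding Bseq_def by (metis abs_le_D1 real_norm_def)
  obtain B where B: "B \<ge> 0" "\<And>u v. 0 \<le> u \<Longrightarrow> u \<le> T \<Longrightarrow> 0 \<le> v \<Longrightarrow> v \<le> T \<Longrightarrow> \<bar>f u * g v\<bar> \<le> B"
    using loc_bounded_multD[OF f(1) g] by metis
  show "(\<lambda>n. conv f g (s n)) \<longlonglongrightarrow> conv f g x"
    unfolding conv_def set_lebesgue_integral_def real_scaleR_def
  proof (rule integral_dominated_convergence[where w="\<lambda>z. B * indicator {0..T} z"])
    show "integrable lborel (\<lambda>z. B * indicator {0..T} z)" by (simp add: emeasure_lborel_Icc_eq)
    show "AE z in lborel. norm (indicator {0..s n} z * (f (s n - z) * g z)) \<le> B * indicator {0..T} z" for n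
      using T[of n] s(1) B by (intro AE_I2) (auto simp: indicator_def)
    show "AE z in lborel. (\<lambda>n. indicator {0..s n} z * (f (s n - z) * g z)) \<longlonglongrightarrow> indicator {0..x} z * (f (x - z) * g z)"
      using AE_lborel_singleton[of x] by eventually_elim (rule conv_integrand_tendsto[OF f(2) s(2)])
  qed measurable
qed

lemma nn_integral_conv:
  fixes f g :: "real \<Rightarrow> real"
  assumes f: "loc_bounded f" "\<And>z. 0 \<le> f z" "\<And>z. z < 0 \<Longrightarrow> f z = 0"
    and g: "loc_bounded g" "\<And>z. 0 \<le> g z" "\<And>z. z < 0 \<Longrightarrow> g z = 0"
  shows "(\<integral>\<^sup>+y. ennreal (conv f g y) \<partial>lborel) = (\<integral>\<^sup>+y. ennreal (f y) \<partial>lborel) * (\<integral>\<^sup>+y. ennreal (g y) \<partial>lborel)"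
proof -
  note [measurable] = f(1)[THEN loc_bounded_measurable] g(1)[THEN loc_bounded_measurable]
  have "ennreal (conv f g y) = (\<integral>\<^sup>+z. ennreal (f (y - z)) * ennreal (g z) \<partial>lborel)" for y
  proof -
    have "indicator {0..y} z *\<^sub>R (f (y - z) * g z) = f (y - z) * g z" for z
      using f(3)[of "y - z"] g(3)[of z] by (cases "z < 0"; cases "y < z") (auto simp: indicator_def)
    moreover have "ennreal (conv f g y) = (\<integral>\<^sup>+z. ennreal (indicator {0..y} z *\<^sub>R (f (y - z) * g z)) \<partial>lborel)"
      unfolding conv_def set_lebesgue_integral_def
      by (rule nn_integral_eq_integral[symmetric])
         (use conv_set_integrable[OF f(1) g(1)] f(2) g(2) in \<open>auto simp: set_integrable_def\<close>)
    ultimately show ?thesis using f(2) g(2) by (simp only: ennreal_mult)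
  qed
  then have "(\<integral>\<^sup>+y. ennreal (conv f g y) \<partial>lborel) = (\<integral>\<^sup>+y. (\<integral>\<^sup>+z. ennreal (f (y - z)) * ennreal (g z) \<partial>lborel) \<partial>lborel)"
    by simp
  also have "\<dots> = (\<integral>\<^sup>+z. (\<integral>\<^sup>+y. ennreal (f (y - z)) * ennreal (g z) \<partial>lborel) \<partial>lborel)"
    by (rule lborel_pair.Fubini'[symmetric]) measurable
  also have "\<dots> = (\<integral>\<^sup>+z. (\<integral>\<^sup>+y. ennreal (f y) \<partial>lborel) * ennreal (g z) \<partial>lborel)"
  proof (rule nn_integral_cong)
    fix z
    have "(\<integral>\<^sup>+y. ennreal (f (y - z)) \<partial>lborel) = (\<integral>\<^sup>+y. ennreal (f y) \<partial>lborel)"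
      by (subst nn_integral_real_affine[where c=1 and t=z]) auto
    then show "(\<integral>\<^sup>+y. ennreal (f (y - z)) * ennreal (g z) \<partial>lborel) = (\<integral>\<^sup>+y. ennreal (f y) \<partial>lborel) * ennreal (g z)"
      by (simp add: nn_integral_multc)
  qed
  also have "\<dots> = (\<integral>\<^sup>+y. ennreal (f y) \<partial>lborel) * (\<integral>\<^sup>+y. ennreal (g y) \<partial>lborel)"
    by (rule nn_integral_cmult) measurable
  finally show ?thesis .
qed

lemma exp_mult_conv: "exp (c * x) * conv f g x = conv (\<lambda>z. exp (c * z) * f z) (\<lambda>z. exp (c * z) * g z) x"
proof -
  have "exp (c * x) * (f (x - z) * g z) = exp (c * (x - z)) * f (x - z) * (exp (c * z) * g z)" for z
  proof -
    have "exp (c * x) = exp (c * (x - z)) * exp (c * z)"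
      unfolding exp_add[symmetric] by (simp add: algebra_simps)
    then show ?thesis by simp
  qed
  then show ?thesis unfolding conv_def set_integral_mult_right[symmetric] by (simp only:)
qed

lemma nn_integral_exp_mult_conv:
  fixes f g :: "real \<Rightarrow> real"
  assumes f: "loc_bounded f" "\<And>z. 0 \<le> f z" "\<And>z. z < 0 \<Longrightarrow> f z = 0"
    and g: "loc_bounded g" "\<And>z. 0 \<le> g z" "\<And>z. z < 0 \<Longrightarrow> g z = 0"
  shows "(\<integral>\<^sup>+y. ennreal (exp (c * y) * conv f g y) \<partial>lborel) =
    (\<integral>\<^sup>+y. ennreal (exp (c * y) * f y) \<partial>lborel) * (\<integral>\<^sup>+y. ennreal (exp (c * y) * g y) \<partial>lborel)"
  unfolding exp_mult_conv
  by (rule nn_integral_conv) (use f g in \<open>auto intro!: loc_bounded_mult loc_bounded_exp\<close>)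

section \<open>Dyadic approximation from the right\<close>

definition dyadic_above :: "nat \<Rightarrow> real \<Rightarrow> real" where
  "dyadic_above n s = (of_int \<lfloor>2 ^ n * s\<rfloor> + 1) / 2 ^ n"

lemma dyadic_above_gt: "s < dyadic_above n s"
  unfolding dyadic_above_def by (simp add: field_simps) linarith

lemma dyadic_above_le: "dyadic_above n s \<le> s + (1/2)^n"
  unfolding dyadic_above_def by (simp add: field_simps power_one_over)

lemma dyadic_above_tendsto: "(\<lambda>n. dyadic_above n s) \<longlonglongrightarrow> s"
proof (rule tendsto_sandwich)
  show "(\<lambda>n. s) \<longlonglongrightarrow> s" by simp
  have "(\<lambda>n. s + (1/2)^n) \<longlonglongrightarrow> s + 0" by (intro tendsto_intros LIMSEQ_power_zero) simp
  then show "(\<lambda>n. s + (1/2)^n) \<longlonglongrightarrow> s" by simp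
qed (simp_all add: less_imp_le dyadic_above_gt dyadic_above_le)

lemma dyadic_above_at_right: "filterlim (\<lambda>n. dyadic_above n s) (at_right s) sequentially"
  unfolding filterlim_at by (simp add: dyadic_above_tendsto dyadic_above_gt less_imp_neq[symmetric])

lemma dyadic_above_nat: "r \<ge> 0 \<Longrightarrow> dyadic_above n r = real (nat \<lfloor>2 ^ n * r\<rfloor> + 1) / 2 ^ n"
  by (simp add: dyadic_above_def)

lemma dyadic_above_Rats: "dyadic_above n s \<in> \<rat>"
  unfolding dyadic_above_def by auto

lemma dyadic_above_mono: "s \<le> t \<Longrightarrow> dyadic_above n s \<le> dyadic_above n t"
  unfolding dyadic_above_def by (intro divide_right_mono add_right_mono) (auto intro!: floor_mono)

lemma multiplicative_right_continuous_exp: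
  fixes f :: "real \<Rightarrow> real"
  assumes pos: "\<And>t. t \<ge> 0 \<Longrightarrow> f t > 0"
    and mult: "\<And>s t. s \<ge> 0 \<Longrightarrow> t \<ge> 0 \<Longrightarrow> f (s + t) = f s * f t"
    and right_cont: "\<And>t. t \<ge> 0 \<Longrightarrow> (f \<longlongrightarrow> f t) (at_right t)"
    and t: "t \<ge> 0"
  shows "f t = exp (t * ln (f 1))"
proof -
  define g where "g t = ln (f t)" for t
  have add: "g (s + t) = g s + g t" if "s \<ge> 0" "t \<ge> 0" for s t
    using that pos by (simp add: g_def mult ln_mult less_imp_neq[symmetric] less_imp_le)
  have g_zero: "g 0 = 0" using add[of 0 0] by simp
  have g_multiple: "g (real n * t) = real n * g t" if "t \<ge> 0" for n t
    by (induction n) (use that in \<open>auto simp: g_zero distrib_right add\<close>)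
  have g_dyadic: "g (real k / 2 ^ n) = real k / 2 ^ n * g 1" for k n
  proof -
    have "2 ^ n * g (real k / 2 ^ n) = g (real (2 ^ n) * (real k / 2 ^ n))" by (subst g_multiple) auto
    also have "\<dots> = g (real k * 1)" by simp
    also have "\<dots> = real k * g 1" by (rule g_multiple) simp
    finally show ?thesis by (simp add: field_simps)
  qed
  have g_dyadic_above: "g (dyadic_above n t) = dyadic_above n t * g 1" for n
  proof -
    have "of_int \<lfloor>2 ^ n * t\<rfloor> + 1 = real (nat \<lfloor>2 ^ n * t\<rfloor> + 1)" using t by simp
    then show ?thesis unfolding dyadic_above_def using g_dyadic[of "nat \<lfloor>2 ^ n * t\<rfloor> + 1" n] by (simp only:)
  qed
  have "(\<lambda>n. f (dyadic_above n t)) \<longlonglongrightarrow> f t"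
    by (rule filterlim_compose[OF right_cont[OF t] dyadic_above_at_right])
  then have "(\<lambda>n. g (dyadic_above n t)) \<longlonglongrightarrow> g t"
    unfolding g_def by (rule tendsto_ln) (use pos[OF t] in auto)
  moreover have "(\<lambda>n. g (dyadic_above n t)) \<longlonglongrightarrow> t * g 1"
    unfolding g_dyadic_above by (intro tendsto_intros dyadic_above_tendsto)
  ultimately have "g t = t * g 1" using LIMSEQ_unique by blast
  then show ?thesis using pos[OF t] by (metis exp_ln g_def)
qed

section \<open>Paths without positive jumps\<close>

definition sn_path :: "(real \<Rightarrow> real) \<Rightarrow> bool" where
  "sn_path f \<longleftrightarrow> cadlag_path f \<and> (\<forall>t>0. \<forall>l. (f \<longlongrightarrow> l) (at_left t) \<longrightarrow> f t \<le> l)"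

definition run_sup :: "(real \<Rightarrow> real) \<Rightarrow> real \<Rightarrow> real \<Rightarrow> real" where
  "run_sup f s t = Sup (f ` {s..t})"

lemma sn_pathI:
  assumes right: "\<And>t. t \<ge> 0 \<Longrightarrow> (f \<longlongrightarrow> f t) (at_right t)"
    and left: "\<And>t. t > 0 \<Longrightarrow> \<exists>l. (f \<longlongrightarrow> l) (at_left t) \<and> f t \<le> l"
  shows "sn_path f"
  unfolding sn_path_def cadlag_path_def
proof (intro conjI allI impI)
  fix t :: real assume "0 \<le> t" then show "continuous (at_right t) f" using right by (simp add: continuous_within)
next
  fix t :: real assume "0 < t" then show "\<exists>l. (f \<longlongrightarrow> l) (at_left t)" using left by blast
next
  fix t l :: real assume "0 < t" and l: "(f \<longlongrightarrow> l) (at_left t)"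
  then obtain l' where "(f \<longlongrightarrow> l') (at_left t)" "f t \<le> l'" using left by blast
  then show "f t \<le> l" using tendsto_unique[OF _ l] by fastforce
qed

lemma sn_path_right_cont: "sn_path f \<Longrightarrow> t \<ge> 0 \<Longrightarrow> (f \<longlongrightarrow> f t) (at_right t)"
  by (simp add: sn_path_def cadlag_path_def continuous_within)

lemma sn_path_dyadic_tendsto: "sn_path f \<Longrightarrow> t \<ge> 0 \<Longrightarrow> (\<lambda>n. f (dyadic_above n t)) \<longlonglongrightarrow> f t"
  by (rule filterlim_compose[OF sn_path_right_cont dyadic_above_at_right])

lemma sn_path_left_limit:
  assumes "sn_path f" "t > 0"
  obtains l where "(f \<longlongrightarrow> l) (at_left t)" "f t \<le> l"
  using assms unfolding sn_path_def cadlag_path_def by blast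

lemma sn_path_right_open:
  assumes "sn_path f" "u \<ge> 0" "open S" "f u \<in> S"
  obtains e where "e > 0" "\<And>x. u \<le> x \<Longrightarrow> x < u + e \<Longrightarrow> f x \<in> S"
proof -
  have "\<forall>\<^sub>F x in at_right u. f x \<in> S" by (rule topological_tendstoD[OF sn_path_right_cont[OF assms(1,2)] assms(3,4)])
  then obtain b where b: "b > u" "\<And>x. x > u \<Longrightarrow> x < b \<Longrightarrow> f x \<in> S"
    unfolding eventually_at_right_field by blast
  have "f x \<in> S" if "u \<le> x" "x < u + (b - u)" for x
    using b(2)[of x] assms(4) that by (cases "x = u") auto
  then show ?thesis using that[of "b - u"] b(1) by simp
qed

lemma sn_path_right_less:
  assumes "sn_path f" "u \<ge> 0" "f u < a"
  obtains e where "e > 0" "\<And>x. u \<le> x \<Longrightarrow> x < u + e \<Longrightarrow> f x < a"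
  using sn_path_right_open[OF assms(1,2) open_lessThan[of a]] assms(3) by auto

lemma sn_path_left_gt:
  assumes "sn_path f" "u > 0" "f u > a"
  obtains e where "e > 0" "\<And>x. u - e < x \<Longrightarrow> x \<le> u \<Longrightarrow> f x > a"
proof -
  obtain l where l: "(f \<longlongrightarrow> l) (at_left u)" "f u \<le> l" using sn_path_left_limit[OF assms(1,2)] .
  have "\<forall>\<^sub>F x in at_left u. f x > a" using order_tendstoD(1)[OF l(1), of a] assms(3) l(2) by simp
  then obtain b where b: "b < u" "\<And>x. x > b \<Longrightarrow> x < u \<Longrightarrow> f x > a"
    unfolding eventually_at_left_field by blast
  have "f x > a" if "u - (u - b) < x" "x \<le> u" for x
    using b(2)[of x] assms(3) that by (cases "x = u") auto
  then show ?thesis using that[of "u - b"] b(1) by simp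
qed

lemma sn_path_locally_bdd_above:
  assumes f: "sn_path f" and x: "x \<ge> 0"
  obtains e B where "e > 0" "\<And>z. 0 \<le> z \<Longrightarrow> \<bar>z - x\<bar> < e \<Longrightarrow> f z \<le> B"
proof -
  obtain e1 where e1: "e1 > 0" "\<And>z. x \<le> z \<Longrightarrow> z < x + e1 \<Longrightarrow> f z < f x + 1"
    using sn_path_right_less[OF f x, of "f x + 1"] by auto
  obtain e2 B where e2: "e2 > 0" "\<And>z. 0 \<le> z \<Longrightarrow> x - e2 < z \<Longrightarrow> z < x \<Longrightarrow> f z \<le> B"
  proof (cases "x = 0")
    case True
    show ?thesis by (rule that[of 1 0]) (use True in auto)
  next
    case False
    then obtain l where "(f \<longlongrightarrow> l) (at_left x)" using sn_path_left_limit[OF f, of x] x by auto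
    then have "\<forall>\<^sub>F z in at_left x. f z < l + 1" by (rule order_tendstoD) simp
    then obtain b where "b < x" "\<And>z. z > b \<Longrightarrow> z < x \<Longrightarrow> f z < l + 1"
      unfolding eventually_at_left_field by blast
    then show ?thesis using that[of "x - b" "l + 1"] by (simp add: less_imp_le)
  qed
  have "f z \<le> max (f x + 1) B" if "0 \<le> z" "\<bar>z - x\<bar> < min e1 e2" for z
    using e1(2)[of z] e2(2)[of z] that by (cases "z < x") (auto simp: le_max_iff_disj)
  then show ?thesis using that[of "min e1 e2" "max (f x + 1) B"] e1(1) e2(1) by auto
qed

lemma sn_path_bdd_above:
  assumes f: "sn_path f" and s: "0 \<le> s" and st: "s \<le> t"
  shows "bdd_above (f ` {s..t})"
proof -
  have "0 \<le> s \<longrightarrow> bdd_above (f ` {s..t})"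
  proof (rule Bolzano[OF st])
    fix a b c :: real
    assume bdd: "0 \<le> a \<longrightarrow> bdd_above (f ` {a..b})" "0 \<le> b \<longrightarrow> bdd_above (f ` {b..c})" and "a \<le> b" "b \<le> c"
    then have "f ` {a..c} = f ` {a..b} \<union> f ` {b..c}"
      unfolding image_Un[symmetric] by (intro arg_cong2[where f="(`)"] refl) auto
    then show "0 \<le> a \<longrightarrow> bdd_above (f ` {a..c})" using bdd \<open>a \<le> b\<close> by (simp add: bdd_above_Un)
  next
    fix x assume "s \<le> x" "x \<le> t"
    then obtain e B where e: "e > 0" "\<And>z. 0 \<le> z \<Longrightarrow> \<bar>z - x\<bar> < e \<Longrightarrow> f z \<le> B"
      using sn_path_locally_bdd_above[OF f, of x] s by auto
    have "bdd_above (f ` {a..b})" if "a \<le> x" "x \<le> b" "b - a < e" "0 \<le> a" for a b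
      by (rule bdd_aboveI2[where M=B]) (use that e(2) in auto)
    then show "\<exists>d>0. \<forall>a b. a \<le> x \<and> x \<le> b \<and> b - a < d \<longrightarrow> 0 \<le> a \<longrightarrow> bdd_above (f ` {a..b})"
      using e(1) by (intro exI[of _ e]) auto
  qed
  then show ?thesis using s by simp
qed

lemma run_sup_upper: "sn_path f \<Longrightarrow> 0 \<le> s \<Longrightarrow> s \<le> u \<Longrightarrow> u \<le> t \<Longrightarrow> f u \<le> run_sup f s t"
  unfolding run_sup_def by (rule cSup_upper) (auto intro: sn_path_bdd_above)

lemma run_sup_least: "s \<le> t \<Longrightarrow> (\<And>u. s \<le> u \<Longrightarrow> u \<le> t \<Longrightarrow> f u \<le> B) \<Longrightarrow> run_sup f s t \<le> B"
  unfolding run_sup_def by (rule cSup_least) auto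

lemma run_sup_gtE:
  assumes "sn_path f" "0 \<le> s" "s \<le> t" "a < run_sup f s t"
  obtains u where "s \<le> u" "u \<le> t" "f u > a"
  using assms run_sup_least[of s t f a] by (meson linorder_not_less)

lemma run_sup_mono:
  assumes f: "sn_path f" and "0 \<le> s'" "s' \<le> s" "s \<le> t" "t \<le> t'"
  shows "run_sup f s t \<le> run_sup f s' t'"
  by (rule run_sup_least) (use assms in \<open>auto intro!: run_sup_upper[OF f]\<close>)

lemma run_sup_cong: "(\<And>u. s \<le> u \<Longrightarrow> u \<le> t \<Longrightarrow> f u = g u) \<Longrightarrow> run_sup f s t = run_sup g s t"
  unfolding run_sup_def by (auto intro!: arg_cong[where f=Sup] image_cong)

lemma run_sup_combine:
  assumes f: "sn_path f" and "0 \<le> r" "r \<le> s" "s \<le> t"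
  shows "run_sup f r t = max (run_sup f r s) (run_sup f s t)"
proof (rule antisym)
  show "run_sup f r t \<le> max (run_sup f r s) (run_sup f s t)"
  proof (rule run_sup_least)
    fix u assume "r \<le> u" "u \<le> t"
    then show "f u \<le> max (run_sup f r s) (run_sup f s t)"
      using run_sup_upper[OF f, of r u s] run_sup_upper[OF f, of s u t] assms
      by (cases "u \<le> s") (auto simp: le_max_iff_disj)
  qed (use assms in simp)
  show "max (run_sup f r s) (run_sup f s t) \<le> run_sup f r t"
    using run_sup_mono[OF f, of r r s t] run_sup_mono[OF f, of r s t t] assms by simp
qed

lemma sn_path_gt_interval:
  assumes f: "sn_path f" and "0 \<le> s" "s < t" "s \<le> u" "u \<le> t" "f u > a"
  obtains v w where "s \<le> v" "v < w" "w \<le> t" "\<And>x. v < x \<Longrightarrow> x < w \<Longrightarrow> f x > a"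
proof (cases "u < t")
  case True
  obtain e where "e > 0" "\<And>x. u \<le> x \<Longrightarrow> x < u + e \<Longrightarrow> f x \<in> {a<..}"
    using sn_path_right_open[OF f, of u "{a<..}"] assms by auto
  then show ?thesis using that[of u "min t (u + e)"] True assms by auto
next
  case False
  then have "u > 0" using assms by linarith
  then obtain e where "e > 0" "\<And>x. u - e < x \<Longrightarrow> x \<le> u \<Longrightarrow> f x > a"
    using sn_path_left_gt[OF f _ assms(6)] by blast
  then show ?thesis using that[of "max s (u - e)" u] False assms by auto
qed

lemma grid_meets_interval:
  fixes s t v w :: real
  assumes "s \<le> v" "v < w" "w \<le> t"
  shows "\<forall>\<^sub>F n in sequentially. \<exists>j\<le>2 ^ n. v < s + real j * (t - s) / 2 ^ n \<and> s + real j * (t - s) / 2 ^ n < w"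
proof -
  have ts: "t - s > 0" using assms by simp
  define r where "r = (v - s) / (t - s)"
  have r: "r \<ge> 0" "s + r * (t - s) = v" using assms ts by (auto simp: r_def)
  have "(\<lambda>n. s + dyadic_above n r * (t - s)) \<longlonglongrightarrow> s + r * (t - s)"
    by (intro tendsto_intros dyadic_above_tendsto)
  then have "\<forall>\<^sub>F n in sequentially. s + dyadic_above n r * (t - s) < w"
    using assms(2) unfolding r(2) by (rule order_tendstoD)
  then show ?thesis
  proof (rule eventually_mono)
    fix n assume less: "s + dyadic_above n r * (t - s) < w"
    define j where "j = nat \<lfloor>2 ^ n * r\<rfloor> + 1"
    have j: "dyadic_above n r = real j / 2 ^ n" using dyadic_above_nat[OF r(1)] by (simp add: j_def)
    have "dyadic_above n r * (t - s) < 1 * (t - s)" using less assms(3) by simp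
    then have "real j < 2 ^ n" using ts by (simp add: j divide_less_eq)
    then have "j \<le> 2 ^ n" by simp
    moreover have "r * (t - s) < dyadic_above n r * (t - s)"
      using ts dyadic_above_gt by (intro mult_strict_right_mono)
    then have "v < s + dyadic_above n r * (t - s)" using r(2) by simp
    ultimately show "\<exists>j\<le>2 ^ n. v < s + real j * (t - s) / 2 ^ n \<and> s + real j * (t - s) / 2 ^ n < w"
      using less by (intro exI[of _ j]) (simp add: j)
  qed
qed

lemma grid_max_tendsto:
  assumes f: "sn_path f" and s: "0 \<le> s" "s \<le> t"
  shows "(\<lambda>n. Max ((\<lambda>j. f (s + real j * (t - s) / 2 ^ n)) ` {..2 ^ n :: nat})) \<longlonglongrightarrow> run_sup f s t"
    (is "?m \<longlonglongrightarrow> _")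
proof (rule order_tendstoI)
  have grid: "s \<le> s + real j * (t - s) / 2 ^ n \<and> s + real j * (t - s) / 2 ^ n \<le> t" if "j \<le> 2 ^ n" for j n
  proof -
    have "real j / 2 ^ n * (t - s) \<le> 1 * (t - s)"
      using that s by (intro mult_right_mono) (auto simp: divide_le_eq_1)
    then show ?thesis using s by simp
  qed
  have "?m n \<le> run_sup f s t" for n
    by (rule Max.boundedI) (use grid in \<open>auto intro!: run_sup_upper[OF f s(1)]\<close>)
  then show "\<forall>\<^sub>F n in sequentially. ?m n < a" if "a > run_sup f s t" for a
    using that by (intro always_eventually allI) (rule order.strict_trans1)
next
  fix a assume a: "a < run_sup f s t"
  obtain u where u: "s \<le> u" "u \<le> t" "f u > a" using run_sup_gtE[OF f s a] .
  show "\<forall>\<^sub>F n in sequentially. ?m n > a"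
  proof (cases "s = t")
    case True
    then have "?m n = f u" for n using u by (simp add: image_constant_conv)
    then show ?thesis using u by simp
  next
    case False
    then obtain v w where vw: "s \<le> v" "v < w" "w \<le> t" "\<And>x. v < x \<Longrightarrow> x < w \<Longrightarrow> f x > a"
      using sn_path_gt_interval[OF f s(1) _ u] s by (metis order_le_less)
    from grid_meets_interval[OF vw(1-3)] show ?thesis
    proof (rule eventually_mono)
      fix n assume "\<exists>j\<le>2 ^ n. v < s + real j * (t - s) / 2 ^ n \<and> s + real j * (t - s) / 2 ^ n < w"
      then obtain j where "j \<le> 2 ^ n" "a < f (s + real j * (t - s) / 2 ^ n)" using vw(4) by blast
      moreover have "f (s + real j * (t - s) / 2 ^ n) \<le> ?m n" by (rule Max_ge) (use \<open>j \<le> 2 ^ n\<close> in auto)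
      ultimately show "a < ?m n" by (rule_tac less_le_trans)
    qed
  qed
qed

lemma run_sup_locally_constant:
  assumes f: "sn_path f" and t: "0 \<le> t" and less: "f t < run_sup f 0 t"
  obtains e where "e > 0" "\<And>s. t \<le> s \<Longrightarrow> s < t + e \<Longrightarrow> run_sup f 0 s = run_sup f 0 t"
proof -
  obtain e where e: "e > 0" "\<And>x. t \<le> x \<Longrightarrow> x < t + e \<Longrightarrow> f x < run_sup f 0 t"
    using sn_path_right_less[OF f t less] by blast
  have "run_sup f 0 s = run_sup f 0 t" if s: "t \<le> s" "s < t + e" for s
  proof -
    have "run_sup f t s \<le> run_sup f 0 t" by (rule run_sup_least) (use s e(2) in \<open>auto intro: less_imp_le\<close>)
    then show ?thesis using run_sup_combine[OF f order_refl t s(1)] by simp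
  qed
  then show ?thesis using that e(1) by blast
qed

lemma countable_right_isolated:
  fixes B :: "real set"
  assumes "\<And>t. t \<in> B \<Longrightarrow> \<exists>u>t. B \<inter> {t<..<u} = {}"
  shows "countable B"
proof -
  obtain u where u: "\<And>t. t \<in> B \<Longrightarrow> t < u t \<and> B \<inter> {t<..<u t} = {}" using assms by metis
  let ?I = "\<lambda>t. {t<..<u t}"
  have less: "?I s \<inter> ?I t = {}" if "s \<in> B" "t \<in> B" "s < t" for s t
  proof -
    have "u s \<le> t" using u[OF \<open>s \<in> B\<close>] that by (auto simp: disjoint_iff not_less)
    then show ?thesis by auto
  qed
  have disjoint: "?I s \<inter> ?I t = {}" if "s \<in> B" "t \<in> B" "s \<noteq> t" for s t
    using less[of s t] less[of t s] that by (metis Int_commute linorder_neqE)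
  have "countable (?I ` B)"
    by (rule countable_disjoint_open_subsets) (auto simp: pairwise_def disjnt_def dest: disjoint)
  moreover have "inj_on ?I B"
    using disjoint u by (intro inj_onI) (metis Int_absorb greaterThanLessThan_empty_iff not_less)
  ultimately show ?thesis by (rule countable_image_inj_on)
qed

text \<open>Between two such times the supremum increases, so it does not stay constant after the first one.\<close>

lemma countable_new_max_below:
  assumes f: "sn_path f" and d: "d > 0"
  shows "countable {t. 0 < t \<and> run_sup f 0 t - f t = d \<and> (\<forall>r\<in>\<rat>. 0 \<le> r \<longrightarrow> r < t \<longrightarrow> run_sup f 0 r < run_sup f 0 t)}"
    (is "countable ?B")
proof (rule countable_right_isolated)
  fix t assume t: "t \<in> ?B"
  then have "f t < run_sup f 0 t" using d by auto
  then obtain e where e: "e > 0" "\<And>s. t \<le> s \<Longrightarrow> s < t + e \<Longrightarrow> run_sup f 0 s = run_sup f 0 t"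
    using run_sup_locally_constant[OF f, of t] t by auto
  have "t' \<notin> ?B" if t': "t < t'" "t' < t + e" for t'
  proof
    assume "t' \<in> ?B"
    obtain r where r: "r \<in> \<rat>" "t < r" "r < t'" using Rats_dense_in_real[OF t'(1)] by auto
    have "run_sup f 0 r < run_sup f 0 t'" using \<open>t' \<in> ?B\<close> r t by auto
    moreover have "run_sup f 0 r = run_sup f 0 t'" using e(2)[of r] e(2)[of t'] r t' by simp
    ultimately show False by simp
  qed
  then have "?B \<inter> {t<..<t + e} = {}" unfolding disjoint_iff greaterThanLessThan_iff by blast
  then show "\<exists>u>t. ?B \<inter> {t<..<u} = {}" using e(1) by (intro exI[of _ "t + e"]) simp
qed

lemma sn_path_antimono_on:
  assumes f: "sn_path f" and rats: "\<And>s t. s \<in> \<rat> \<Longrightarrow> t \<in> \<rat> \<Longrightarrow> 0 \<le> s \<Longrightarrow> s \<le> t \<Longrightarrow> f t \<le> f s"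
  shows "antimono_on {0..} f"
proof (rule monotone_onI)
  fix s t :: real assume st: "s \<in> {0..}" "t \<in> {0..}" "s \<le> t"
  have "f (dyadic_above n t) \<le> f (dyadic_above n s)" for n
    using st dyadic_above_gt[of s n] by (intro rats dyadic_above_Rats dyadic_above_mono) auto
  then show "f t \<le> f s"
    using st by (intro LIMSEQ_le[OF sn_path_dyadic_tendsto[OF f] sn_path_dyadic_tendsto[OF f]]) auto
qed

definition concat_path :: "(real \<Rightarrow> real) \<Rightarrow> real \<Rightarrow> (real \<Rightarrow> real) \<Rightarrow> real \<Rightarrow> real" where
  "concat_path f t g s = (if s \<le> t then f s else f t + g (s - t))"

lemma concat_path_before: "s \<le> t \<Longrightarrow> concat_path f t g s = f s"
  by (simp add: concat_path_def)

lemma concat_path_after: "g 0 = 0 \<Longrightarrow> s \<ge> 0 \<Longrightarrow> concat_path f t g (t + s) = f t + g s"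
  by (simp add: concat_path_def)

lemma all_less_split:
  fixes m n :: nat
  assumes "m \<le> n"
  shows "(\<forall>i<n. Q i) \<longleftrightarrow> (\<forall>i<m. Q i) \<and> (\<forall>i<n - m. Q (m + i))"
proof (intro iffI conjI allI impI)
  fix i assume split: "(\<forall>i<m. Q i) \<and> (\<forall>i<n - m. Q (m + i))" and "i < n"
  then show "Q i" using conjunct2[OF split, rule_format, of "i - m"] by (cases "i < m") auto
qed (use assms in auto)

lemma concat_path_increments_in_iff:
  fixes ts :: "nat \<Rightarrow> real"
  assumes mono: "\<And>i. i < n \<Longrightarrow> ts i \<le> ts (Suc i)" and m: "m \<le> n" "ts m = t" and "g 0 = 0"
  shows "(\<forall>i<n. concat_path f t g (ts (Suc i)) - concat_path f t g (ts i) \<in> A i) \<longleftrightarrow>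
    (\<forall>i<m. f (ts (Suc i)) - f (ts i) \<in> A i) \<and> (\<forall>i<n-m. g (ts (m + Suc i) - t) - g (ts (m + i) - t) \<in> A (m + i))"
proof -
  have ts_mono: "ts i \<le> ts j" if "i \<le> j" "j \<le> n" for i j
    using that by (induction j) (use mono in \<open>auto simp: le_Suc_eq intro: order_trans\<close>)
  have before: "concat_path f t g (ts i) = f (ts i)" if "i \<le> m" for i
    using ts_mono[OF that m(1)] m(2) by (simp add: concat_path_before)
  have after: "concat_path f t g (ts (m + j)) = f t + g (ts (m + j) - t)" if "j \<le> n - m" for j
    using concat_path_after[of g "ts (m + j) - t" f t] \<open>g 0 = 0\<close> ts_mono[of m "m + j"] that m by simp
  have "concat_path f t g (ts (Suc (m + i))) - concat_path f t g (ts (m + i)) = g (ts (m + Suc i) - t) - g (ts (m + i) - t)"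
    if "i < n - m" for i
    using after[of i] after[of "Suc i"] that by simp
  then show ?thesis unfolding all_less_split[OF m(1)] by (simp add: before)
qed

lemma concat_path_right_cont:
  assumes f: "sn_path f" and g: "sn_path g" "g 0 = 0" and s: "s \<ge> 0"
  shows "(concat_path f t g \<longlongrightarrow> concat_path f t g s) (at_right s)"
proof (cases "s < t")
  case True
  have "\<forall>\<^sub>F x in at_right s. f x = concat_path f t g x"
    using True by (auto simp: concat_path_def eventually_at_right_field intro!: exI[of _ t])
  from Lim_transform_eventually[OF sn_path_right_cont[OF f s] this]
  have "(concat_path f t g \<longlongrightarrow> f s) (at_right s)" .
  then show ?thesis using True by (simp add: concat_path_before)
next
  case False
  have "filterlim (\<lambda>x. x - t) (at_right (s - t)) (at_right s)"
    by (simp add: filterlim_def filtermap_at_right_shift)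
  then have "((\<lambda>x. f t + g (x - t)) \<longlongrightarrow> f t + g (s - t)) (at_right s)"
    by (intro tendsto_intros filterlim_compose[OF sn_path_right_cont[OF g(1)]]) (use False in auto)
  moreover have "\<forall>\<^sub>F x in at_right s. f t + g (x - t) = concat_path f t g x"
    using False by (auto simp: concat_path_def eventually_at_right_field intro!: exI[of _ "s + 1"])
  ultimately have "(concat_path f t g \<longlongrightarrow> f t + g (s - t)) (at_right s)" by (rule Lim_transform_eventually)
  then show ?thesis using False g(2) by (cases "s = t") (auto simp: concat_path_def)
qed

lemma concat_path_left_limit:
  assumes f: "sn_path f" and g: "sn_path g" and s: "s > 0"
  shows "\<exists>l. (concat_path f t g \<longlongrightarrow> l) (at_left s) \<and> concat_path f t g s \<le> l"
proof (cases "s \<le> t")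
  case True
  obtain l where l: "(f \<longlongrightarrow> l) (at_left s)" "f s \<le> l" using sn_path_left_limit[OF f s] .
  have "\<forall>\<^sub>F x in at_left s. f x = concat_path f t g x"
    using True by (auto simp: concat_path_def eventually_at_left_field intro!: exI[of _ "s - 1"])
  from Lim_transform_eventually[OF l(1) this] show ?thesis using True l(2) by (auto simp: concat_path_before)
next
  case False
  then obtain l where l: "(g \<longlongrightarrow> l) (at_left (s - t))" "g (s - t) \<le> l" using sn_path_left_limit[OF g, of "s - t"] by auto
  have "filterlim (\<lambda>x. x - t) (at_left (s - t)) (at_left s)"
    by (simp add: filterlim_def filtermap_at_left_shift)
  then have "((\<lambda>x. f t + g (x - t)) \<longlongrightarrow> f t + l) (at_left s)"
    by (intro tendsto_intros filterlim_compose[OF l(1)])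
  moreover have "\<forall>\<^sub>F x in at_left s. f t + g (x - t) = concat_path f t g x"
    using False by (auto simp: concat_path_def eventually_at_left_field intro!: exI[of _ t])
  ultimately have "(concat_path f t g \<longlongrightarrow> f t + l) (at_left s)" by (rule Lim_transform_eventually)
  moreover have "concat_path f t g s \<le> f t + l" using False l(2) by (simp add: concat_path_def)
  ultimately show ?thesis by blast
qed

lemma sn_path_concat_path: "sn_path f \<Longrightarrow> sn_path g \<Longrightarrow> g 0 = 0 \<Longrightarrow> sn_path (concat_path f t g)"
  by (rule sn_pathI) (auto intro: concat_path_right_cont concat_path_left_limit)

lemma run_sup_concat_path_before: "s \<le> t \<Longrightarrow> run_sup (concat_path f t g) r s = run_sup f r s"
  by (rule run_sup_cong) (simp add: concat_path_def)

lemma run_sup_concat_path_after: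
  assumes g: "sn_path g" "g 0 = 0" and u: "0 \<le> u"
  shows "run_sup (concat_path f t g) t (t + u) = f t + run_sup g 0 u"
proof -
  have "concat_path f t g ` {t..t + u} = (\<lambda>v. f t + g v) ` {0..u}"
    using image_image[of "concat_path f t g" "\<lambda>v. t + v" "{0..u}"] g(2)
    by (simp add: concat_path_after add.commute[of u t] cong: image_cong_simp)
  then show ?thesis
    unfolding run_sup_def using sn_path_bdd_above[OF g(1) order_refl u] u by (simp add: Sup_add_eq)
qed

lemma run_sup_concat_path:
  assumes "sn_path f" "sn_path g" "g 0 = 0" "0 \<le> t" "0 \<le> u"
  shows "run_sup (concat_path f t g) 0 (t + u) = max (run_sup f 0 t) (f t + run_sup g 0 u)"
  using run_sup_combine[OF sn_path_concat_path[OF assms(1-3)], of 0 t "t + u"] assms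
  by (simp add: run_sup_concat_path_before run_sup_concat_path_after)

definition first_passage :: "(real \<Rightarrow> real) \<Rightarrow> real \<Rightarrow> real" where
  "first_passage f y = Inf {t. 0 \<le> t \<and> f t > y}"

locale crossing_path =
  fixes f :: "real \<Rightarrow> real" and y :: real
  assumes path: "sn_path f" and start: "f 0 \<le> y" and crosses: "\<exists>t\<ge>0. f t > y"
begin

abbreviation "\<tau> \<equiv> first_passage f y"

lemma passage_times_bdd_below: "bdd_below {t. 0 \<le> t \<and> f t > y}"
  by (rule bdd_belowI[of _ 0]) auto

lemma tau_nonneg: "0 \<le> \<tau>"
  unfolding first_passage_def by (rule cInf_greatest) (use crosses in auto)

lemma below_tau: "0 \<le> s \<Longrightarrow> s < \<tau> \<Longrightarrow> f s \<le> y"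
  using cInf_lower[OF _ passage_times_bdd_below, of s] unfolding first_passage_def by force

lemma at_tau: "f \<tau> \<le> y"
proof (rule ccontr)
  assume "\<not> f \<tau> \<le> y"
  then have above: "f \<tau> > y" by simp
  then have "\<tau> \<noteq> 0" using start by auto
  then have pos: "\<tau> > 0" using tau_nonneg by simp
  obtain e where e: "e > 0" "\<And>x. \<tau> - e < x \<Longrightarrow> x \<le> \<tau> \<Longrightarrow> f x > y" using sn_path_left_gt[OF path pos above] by blast
  define x where "x = max (\<tau> / 2) (\<tau> - e / 2)"
  have "0 \<le> x" "x < \<tau>" "\<tau> - e < x" using pos e(1) by (auto simp: x_def)
  then show False using e(2)[of x] below_tau[of x] by auto
qed

lemma le_tau: "0 \<le> s \<Longrightarrow> s \<le> \<tau> \<Longrightarrow> f s \<le> y"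
  using below_tau at_tau by (cases "s = \<tau>") auto

lemma crosses_after_tau: 
  assumes "e > 0" 
  obtains u where "\<tau> < u" "u < \<tau> + e" "f u > y"
proof -
  have "\<exists>u\<in>{t. 0 \<le> t \<and> f t > y}. u < \<tau> + e"
    using cInf_lessD[of "{t. 0 \<le> t \<and> f t > y}" "\<tau> + e"] crosses assms unfolding first_passage_def by auto
  then obtain u where u: "0 \<le> u" "f u > y" "u < \<tau> + e" by blast
  then have "\<tau> < u" using le_tau[of u] by force
  then show ?thesis using that u by blast
qed

lemma tau_value: "f \<tau> = y"
proof (rule antisym[OF at_tau], rule ccontr)
  assume "\<not> y \<le> f \<tau>"
  then obtain e where e: "e > 0" "\<And>x. \<tau> \<le> x \<Longrightarrow> x < \<tau> + e \<Longrightarrow> f x < y"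
    using sn_path_right_less[OF path tau_nonneg, of y] by auto
  obtain u where "\<tau> < u" "u < \<tau> + e" "f u > y" using crosses_after_tau[OF e(1)] .
  then show False using e(2)[of u] by auto
qed

lemma run_sup_gt_iff: "t \<ge> 0 \<Longrightarrow> run_sup f 0 t > y \<longleftrightarrow> \<tau> < t"
proof
  assume t: "t \<ge> 0" "\<tau> < t"
  obtain u where "\<tau> < u" "u < \<tau> + (t - \<tau>)" "f u > y" using crosses_after_tau[of "t - \<tau>"] t by auto
  then show "run_sup f 0 t > y" using run_sup_upper[OF path, of 0 u t] tau_nonneg by auto
next
  assume t: "t \<ge> 0" "run_sup f 0 t > y"
  obtain u where "0 \<le> u" "u \<le> t" "f u > y" using run_sup_gtE[OF path _ t] by auto
  then show "\<tau> < t" using le_tau[of u] by (meson leD leI order.strict_trans1)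
qed

definition grid_passage :: "nat \<Rightarrow> nat" where
  "grid_passage n = (LEAST k. f (real k / 2 ^ n) > y)"

abbreviation grid_time :: "nat \<Rightarrow> real" where
  "grid_time n \<equiv> real (grid_passage n) / 2 ^ n"

lemma eventually_grid_above: "e > 0 \<Longrightarrow> \<forall>\<^sub>F n in sequentially. \<exists>k. f (real k / 2 ^ n) > y \<and> \<tau> < real k / 2 ^ n \<and> real k / 2 ^ n < \<tau> + e"
proof -
  assume e: "e > 0"
  obtain u where u: "\<tau> < u" "u < \<tau> + e" "f u > y" using crosses_after_tau[OF e] .
  obtain v w where vw: "\<tau> \<le> v" "v < w" "w \<le> \<tau> + e" "\<And>x. v < x \<Longrightarrow> x < w \<Longrightarrow> f x > y"
    using sn_path_gt_interval[OF path tau_nonneg, of "\<tau> + e" u y] u e by auto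
  have "\<forall>\<^sub>F n in sequentially. dyadic_above n v < w"
    using dyadic_above_tendsto vw(2) by (rule order_tendstoD)
  then show ?thesis
  proof (rule eventually_mono)
    fix n assume before_w: "dyadic_above n v < w"
    have "f (dyadic_above n v) > y \<and> \<tau> < dyadic_above n v \<and> dyadic_above n v < \<tau> + e"
      using vw before_w dyadic_above_gt[of v n] by auto
    then show "\<exists>k. f (real k / 2 ^ n) > y \<and> \<tau> < real k / 2 ^ n \<and> real k / 2 ^ n < \<tau> + e"
      using dyadic_above_nat[of v n] vw(1) tau_nonneg by (metis order.trans)
  qed
qed

lemma grid_passage_crosses: "\<forall>\<^sub>F n in sequentially. f (grid_time n) > y \<and> \<tau> < grid_time n"
  using eventually_grid_above[of 1, simplified]
proof (rule eventually_mono)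
  fix n assume "\<exists>k. f (real k / 2 ^ n) > y \<and> \<tau> < real k / 2 ^ n \<and> real k / 2 ^ n < \<tau> + 1"
  then have "f (grid_time n) > y" unfolding grid_passage_def by (metis (mono_tags, lifting) LeastI_ex)
  moreover from this have "\<tau> < grid_time n" using le_tau[of "grid_time n"] by force
  ultimately show "f (grid_time n) > y \<and> \<tau> < grid_time n" by simp
qed

lemma grid_passage_tendsto: "(\<lambda>n. grid_time n) \<longlonglongrightarrow> \<tau>"
proof (rule tendstoI)
  fix e :: real assume e: "e > 0"
  show "\<forall>\<^sub>F n in sequentially. dist (grid_time n) \<tau> < e"
    using eventually_grid_above[OF e] grid_passage_crosses
  proof eventually_elim
    case (elim n)
    then obtain k where k: "f (real k / 2 ^ n) > y" "real k / 2 ^ n < \<tau> + e" by auto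
    have "grid_passage n \<le> k" unfolding grid_passage_def by (rule Least_le) (fact k(1))
    then have "grid_time n \<le> real k / 2 ^ n" by (simp add: divide_right_mono)
    then show ?case using k elim by (auto simp: dist_real_def)
  qed
qed

lemma grid_passage_le: "\<forall>\<^sub>F n in sequentially. grid_passage n \<le> n * 2 ^ n"
proof -
  have "\<forall>\<^sub>F n in sequentially. \<tau> + 1 \<le> real n"
    using eventually_ge_at_top[of "nat \<lceil>\<tau> + 1\<rceil>"] by eventually_elim linarith
  moreover have "\<forall>\<^sub>F n in sequentially. grid_time n < \<tau> + 1"
    using grid_passage_tendsto by (rule order_tendstoD) simp
  ultimately show ?thesis
  proof eventually_elim
    case (elim n)
    then have "grid_time n \<le> real n" by simp
    then have "real (grid_passage n) \<le> real (n * 2 ^ n)" by (simp add: divide_le_eq)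
    then show ?case by (simp only: of_nat_le_iff)
  qed
qed

lemma grid_passage_at_right: "filterlim (\<lambda>n. grid_time n) (at_right \<tau>) sequentially"
  unfolding filterlim_at using grid_passage_tendsto grid_passage_crosses by (auto elim: eventually_mono)

lemma f_grid_passage_tendsto: "(\<lambda>n. f (grid_time n)) \<longlonglongrightarrow> y"
  using filterlim_compose[OF sn_path_right_cont[OF path tau_nonneg] grid_passage_at_right] by (simp add: tau_value)

lemma run_sup_after_passage:
  assumes t: "\<tau> < t"
  shows "(\<lambda>n. run_sup f (grid_time n) t) \<longlonglongrightarrow> run_sup f 0 t"
proof (rule order_tendstoI)
  have grid_time_before: "\<forall>\<^sub>F n in sequentially. grid_time n < u" if "\<tau> < u" for u
    using grid_passage_tendsto that by (rule order_tendstoD)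
  { fix a assume "run_sup f 0 t < a"
    then show "\<forall>\<^sub>F n in sequentially. run_sup f (grid_time n) t < a"
      using grid_time_before[OF t]
    proof (elim eventually_mono)
      fix n assume smaller: "run_sup f 0 t < a" "grid_time n < t"
      have "run_sup f (grid_time n) t \<le> run_sup f 0 t"
        by (rule run_sup_mono[OF path]) (use smaller in auto)
      then show "run_sup f (grid_time n) t < a" using smaller by simp
    qed }
  fix a assume a: "a < run_sup f 0 t"
  have "max a y < run_sup f 0 t" using a run_sup_gt_iff[of t] t tau_nonneg by auto
  then obtain u where u: "0 \<le> u" "u \<le> t" "f u > max a y" using run_sup_gtE[OF path order_refl, of t] t tau_nonneg by (metis less_imp_le order_trans)
  then have "\<tau> < u" using le_tau[of u] by force
  from grid_time_before[OF this] show "\<forall>\<^sub>F n in sequentially. a < run_sup f (grid_time n) t"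
  proof (rule eventually_mono)
    fix n assume "grid_time n < u"
    then have "f u \<le> run_sup f (grid_time n) t" using u by (intro run_sup_upper[OF path]) auto
    then show "a < run_sup f (grid_time n) t" using u by auto
  qed
qed

end

section \<open>The Markov property on path space\<close>

abbreviation path_space :: "(real \<Rightarrow> real) measure" where
  "path_space \<equiv> Pi\<^sub>M {0..} (\<lambda>_. borel)"

text \<open>Right-continuous paths are recovered from their values at countably many times, which makes
  evaluation jointly measurable on the product space.\<close>

definition path_eval :: "(real \<Rightarrow> real) \<Rightarrow> real \<Rightarrow> real" where
  "path_eval w s = lim (\<lambda>n. w (dyadic_above n (max 0 s)))"

definition path_sup :: "(real \<Rightarrow> real) \<Rightarrow> real \<Rightarrow> real \<Rightarrow> real" where
  "path_sup w s t = lim (\<lambda>n. Max ((\<lambda>j. path_eval w (s + real j * (t - s) / 2 ^ n)) ` {..2 ^ n :: nat}))"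

lemma path_eval_measurable [measurable (raw)]:
  assumes [measurable]: "f \<in> measurable N path_space" "g \<in> borel_measurable N"
  shows "(\<lambda>x. path_eval (f x) (g x)) \<in> borel_measurable N"
proof -
  have "(\<lambda>x. f x (dyadic_above n (max 0 (g x)))) \<in> borel_measurable N" for n
  proof -
    have "(\<lambda>x. (\<lambda>i x. f x ((of_int (max 0 i) + 1) / 2 ^ n)) \<lfloor>2 ^ n * max 0 (g x)\<rfloor> x) \<in> borel_measurable N"
    proof (rule measurable_compose_countable[where f="\<lambda>i x. f x ((of_int (max 0 i) + 1) / 2 ^ n)"
          and g="\<lambda>x. \<lfloor>2 ^ n * max 0 (g x)\<rfloor>"])
      fix i :: int
      have "(\<lambda>w. w ((of_int (max 0 i) + 1) / 2 ^ n)) \<in> borel_measurable path_space"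
        by (rule measurable_component_singleton) auto
      then show "(\<lambda>x. f x ((of_int (max 0 i) + 1) / 2 ^ n)) \<in> borel_measurable N"
        by (rule measurable_compose[OF assms(1)])
    qed measurable
    moreover have "(of_int (max 0 \<lfloor>2 ^ n * max 0 (g x)\<rfloor>) + 1) / 2 ^ n = dyadic_above n (max 0 (g x))" for x
      by (simp add: dyadic_above_def)
    ultimately show ?thesis by simp
  qed
  then show ?thesis unfolding path_eval_def by (rule borel_measurable_lim_metric)
qed

lemma path_sup_measurable [measurable (raw)]:
  assumes [measurable]: "f \<in> measurable N path_space" "g \<in> borel_measurable N" "h \<in> borel_measurable N"
  shows "(\<lambda>x. path_sup (f x) (g x) (h x)) \<in> borel_measurable N"
  unfolding path_sup_def by measurable

lemma path_eval_restrict: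
  assumes f: "sn_path f"
  shows "path_eval (restrict f {0..}) s = f (max 0 s)"
proof -
  have "restrict f {0..} (dyadic_above n (max 0 s)) = f (dyadic_above n (max 0 s))" for n
    using dyadic_above_gt[of "max 0 s" n] by simp
  then show ?thesis
    unfolding path_eval_def using sn_path_dyadic_tendsto[OF f, of "max 0 s"] by (simp add: limI)
qed

lemma path_sup_restrict:
  assumes f: "sn_path f" and s: "0 \<le> s" "s \<le> t"
  shows "path_sup (restrict f {0..}) s t = run_sup f s t"
  unfolding path_sup_def path_eval_restrict[OF f] using grid_max_tendsto[OF f s] s by (simp add: limI)

lemma emeasure_distr_PiM_box:
  fixes f :: "nat \<Rightarrow> 'b \<Rightarrow> real"
  assumes [measurable]: "\<And>i. i < n \<Longrightarrow> f i \<in> borel_measurable N" and A: "\<And>i. i < n \<Longrightarrow> A i \<in> sets borel"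
  shows "emeasure (distr N (Pi\<^sub>M {..<n} (\<lambda>_. borel)) (\<lambda>x. \<lambda>i\<in>{..<n}. f i x)) (Pi\<^sub>E {..<n} A) =
    emeasure N {x\<in>space N. \<forall>i<n. f i x \<in> A i}"
proof -
  have "(\<lambda>i\<in>{..<n}. f i x) \<in> Pi\<^sub>E {..<n} A \<longleftrightarrow> (\<forall>i<n. f i x \<in> A i)" for x
    unfolding PiE_iff by (metis lessThan_iff restrict_apply' restrict_extensional)
  then have "(\<lambda>x. \<lambda>i\<in>{..<n}. f i x) -` Pi\<^sub>E {..<n} A \<inter> space N = {x\<in>space N. \<forall>i<n. f i x \<in> A i}"
    by auto
  moreover have "Pi\<^sub>E {..<n} A \<in> sets (Pi\<^sub>M {..<n} (\<lambda>_. borel))" by (rule sets_PiM_I_finite) (use A in auto)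
  moreover have "(\<lambda>x. \<lambda>i\<in>{..<n}. f i x) \<in> measurable N (Pi\<^sub>M {..<n} (\<lambda>_. borel))" by (rule measurable_restrict) auto
  ultimately show ?thesis by (simp add: emeasure_distr)
qed

lemma emeasure_distr_path_space_cylinder:
  fixes Y :: "'b \<Rightarrow> real \<Rightarrow> real"
  assumes [measurable]: "\<And>s. (\<lambda>z. Y z s) \<in> borel_measurable N"
    and J: "finite J" "J \<subseteq> {0..}" and A: "\<And>s. s \<in> J \<Longrightarrow> A s \<in> sets borel"
  shows "emeasure (distr N path_space (\<lambda>z. restrict (Y z) {0..})) (prod_emb {0..} (\<lambda>_. borel) J (Pi\<^sub>E J A)) =
    emeasure N {z\<in>space N. \<forall>s\<in>J. Y z s \<in> A s}"
proof -
  have "(\<lambda>z. restrict (Y z) {0..}) \<in> measurable N path_space" by measurable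
  moreover have "prod_emb {0..} (\<lambda>_. borel) J (Pi\<^sub>E J A) \<in> sets path_space" by (rule sets_PiM_I) (use J A in auto)
  moreover have "restrict (Y z) {0..} \<in> prod_emb {0..} (\<lambda>_. borel) J (Pi\<^sub>E J A) \<longleftrightarrow> (\<forall>s\<in>J. Y z s \<in> A s)" for z
    using J by (auto simp: prod_emb_def PiE_iff space_PiM subset_eq)
  ultimately show ?thesis by (simp add: emeasure_distr vimage_def Int_def conj_commute)
qed

definition increments :: "(nat \<Rightarrow> real) \<Rightarrow> nat \<Rightarrow> (real \<Rightarrow> real) \<Rightarrow> nat \<Rightarrow> real" where
  "increments ts n f = (\<lambda>i\<in>{..<n}. f (ts (Suc i)) - f (ts i))"

lemma sum_increments:
  assumes "k \<le> n" "ts 0 = 0" "f 0 = 0"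
  shows "(\<Sum>i<k. increments ts n f i) = f (ts k)"
proof -
  have "(\<Sum>i<k. increments ts n f i) = (\<Sum>i<k. f (ts (Suc i)) - f (ts i))"
    by (rule sum.cong) (use assms in \<open>auto simp: increments_def\<close>)
  also have "\<dots> = f (ts k)" using sum_lessThan_telescope[of "\<lambda>i. f (ts i)" k] assms by simp
  finally show ?thesis .
qed

lemma measurable_increments:
  fixes Y :: "'b \<Rightarrow> real \<Rightarrow> real"
  assumes [measurable]: "\<And>s. (\<lambda>z. Y z s) \<in> borel_measurable N"
  shows "(\<lambda>z. increments ts n (Y z)) \<in> measurable N (Pi\<^sub>M {..<n} (\<lambda>_. borel))"
  unfolding increments_def by measurable

lemma finite_times_grid:
  fixes J :: "real set"
  assumes J: "finite J" "J \<subseteq> {0..}" and t: "t \<ge> 0"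
  obtains ts :: "nat \<Rightarrow> real" and n m where "ts 0 = 0" "\<And>i. i < n \<Longrightarrow> ts i \<le> ts (Suc i)" "m \<le> n" "ts m = t"
    and "\<And>s. s \<in> J \<Longrightarrow> \<exists>i\<le>n. ts i = s"
proof -
  define L where "L = sorted_list_of_set (insert 0 (insert t J))"
  define n where "n = length L - 1"
  have set_L: "set L = insert 0 (insert t J)" unfolding L_def by (rule set_sorted_list_of_set) (use J in simp)
  then have length_L: "length L = Suc n" unfolding n_def by (cases L) auto
  have sorted: "sorted L" by (simp add: L_def)
  have in_grid: "\<exists>i\<le>n. L ! i = s" if "s \<in> set L" for s
    using that length_L unfolding in_set_conv_nth by (metis less_Suc_eq_le)
  then obtain i m where i: "i \<le> n" "L ! i = 0" and m: "m \<le> n" "L ! m = t" using set_L by (metis insertCI)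
  have "L ! 0 \<le> 0" using sorted_nth_mono[OF sorted, of 0 i] i length_L by simp
  moreover have "L ! 0 \<in> set L" using length_L by simp
  ultimately have "L ! 0 = 0" using set_L J t by auto
  moreover have "L ! i \<le> L ! Suc i" if "i < n" for i
    using sorted_nth_mono[OF sorted, of i "Suc i"] that length_L by simp
  ultimately show ?thesis using that[of "\<lambda>i. L ! i" n m] m in_grid set_L by auto
qed

lemma emeasure_cylinder_eq_if_increments_distr_eq:
  fixes Y :: "'b \<Rightarrow> real \<Rightarrow> real" and Z :: "'c \<Rightarrow> real \<Rightarrow> real"
  assumes Y: "\<And>s. (\<lambda>y. Y y s) \<in> borel_measurable N" "\<And>y. y \<in> space N \<Longrightarrow> Y y 0 = 0"
    and Z: "\<And>s. (\<lambda>z. Z z s) \<in> borel_measurable P" "\<And>z. z \<in> space P \<Longrightarrow> Z z 0 = 0"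
    and ts: "ts 0 = 0" and J: "finite J" "\<And>s. s \<in> J \<Longrightarrow> \<exists>i\<le>n. ts i = s" and A: "\<And>s. s \<in> J \<Longrightarrow> A s \<in> sets borel"
    and distr: "distr N (Pi\<^sub>M {..<n} (\<lambda>_. borel)) (\<lambda>y. increments ts n (Y y)) = distr P (Pi\<^sub>M {..<n} (\<lambda>_. borel)) (\<lambda>z. increments ts n (Z z))"
  shows "emeasure N {y\<in>space N. \<forall>s\<in>J. Y y s \<in> A s} = emeasure P {z\<in>space P. \<forall>s\<in>J. Z z s \<in> A s}"
proof -
  obtain index where index: "\<And>s. s \<in> J \<Longrightarrow> index s \<le> n \<and> ts (index s) = s" using J(2) by metis
  define E where "E = {v \<in> space (Pi\<^sub>M {..<n} (\<lambda>_. borel :: real measure)). \<forall>s\<in>J. (\<Sum>i<index s. v i) \<in> A s}"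
  have E: "E \<in> sets (Pi\<^sub>M {..<n} (\<lambda>_. borel))"
    unfolding E_def
  proof (rule sets.sets_Collect_finite_All[OF _ J(1)])
    fix s assume s: "s \<in> J"
    have [measurable]: "A s \<in> sets borel" using A s by auto
    have "(\<lambda>v. \<Sum>i<index s. v i) \<in> borel_measurable (Pi\<^sub>M {..<n} (\<lambda>_. borel :: real measure))"
      by (rule borel_measurable_sum) (use index[OF s] in auto)
    then show "{v \<in> space (Pi\<^sub>M {..<n} (\<lambda>_. borel :: real measure)). (\<Sum>i<index s. v i) \<in> A s} \<in> sets (Pi\<^sub>M {..<n} (\<lambda>_. borel))"
      by measurable
  qed
  have in_E: "increments ts n f \<in> E \<longleftrightarrow> (\<forall>s\<in>J. f s \<in> A s)" if "f 0 = 0" for f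
  proof -
    have "(\<Sum>i<index s. increments ts n f i) = f s" if "s \<in> J" for s
      using index[OF that] sum_increments[of "index s" n ts f] ts \<open>f 0 = 0\<close> by simp
    moreover have "increments ts n f \<in> space (Pi\<^sub>M {..<n} (\<lambda>_. borel))" by (simp add: space_PiM increments_def)
    ultimately show ?thesis by (simp add: E_def)
  qed
  have "emeasure N {y\<in>space N. \<forall>s\<in>J. Y y s \<in> A s} = emeasure (distr N (Pi\<^sub>M {..<n} (\<lambda>_. borel)) (\<lambda>y. increments ts n (Y y))) E"
    unfolding emeasure_distr[OF measurable_increments[OF Y(1)] E] using in_E Y(2)
    by (intro arg_cong[where f="emeasure N"]) auto
  also have "\<dots> = emeasure P {z\<in>space P. \<forall>s\<in>J. Z z s \<in> A s}"
    unfolding distr emeasure_distr[OF measurable_increments[OF Z(1)] E] using in_E Z(2)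
    by (intro arg_cong[where f="emeasure P"]) auto
  finally show ?thesis .
qed

locale sn_levy = prob_space M for M :: "'a measure" +
  fixes X :: "real \<Rightarrow> 'a \<Rightarrow> real"
  assumes sn: "spectrally_negative_levy M X"
begin

lemma X_measurable [measurable]: "X t \<in> borel_measurable M"
  using sn by (auto simp: spectrally_negative_levy_def levy_process_def)

lemma X_0 [simp]: "\<omega> \<in> space M \<Longrightarrow> X 0 \<omega> = 0"
  using sn by (auto simp: spectrally_negative_levy_def levy_process_def)

lemma sn_path_X: "\<omega> \<in> space M \<Longrightarrow> sn_path (\<lambda>t. X t \<omega>)"
  using sn by (auto simp: spectrally_negative_levy_def levy_process_def sn_path_def)

text \<open>Points z = (t, \<omega>) of the product with the time axis are evaluated at the time max 0 t, which
  keeps these functions measurable on the whole product.\<close>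

definition position :: "real \<times> 'a \<Rightarrow> real" where
  "position z = X (max 0 (fst z)) (snd z)"

definition supremum :: "real \<times> 'a \<Rightarrow> real" where
  "supremum z = run_sup (\<lambda>s. X s (snd z)) 0 (max 0 (fst z))"

definition drawdown :: "real \<times> 'a \<Rightarrow> real" where
  "drawdown z = supremum z - position z"

definition sample :: "'a \<Rightarrow> real \<Rightarrow> real" where
  "sample \<omega> = restrict (\<lambda>s. X s \<omega>) {0..}"

definition restarted :: "real \<Rightarrow> 'a \<times> 'a \<Rightarrow> real \<Rightarrow> real" where
  "restarted t z = restrict (concat_path (\<lambda>s. X s (fst z)) t (\<lambda>s. X s (snd z))) {0..}"

lemma sample_measurable [measurable]: "sample \<in> measurable M path_space"
  unfolding sample_def[abs_def] by measurable

lemma concat_path_measurable [measurable]: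
  "(\<lambda>z. concat_path (\<lambda>s. X s (fst z)) t (\<lambda>s. X s (snd z)) s) \<in> borel_measurable (M \<Otimes>\<^sub>M M)"
  unfolding concat_path_def by measurable

lemma restarted_measurable [measurable]: "restarted t \<in> measurable (M \<Otimes>\<^sub>M M) path_space"
  unfolding restarted_def[abs_def] by measurable

lemma path_eval_sample: "\<omega> \<in> space M \<Longrightarrow> path_eval (sample \<omega>) = (\<lambda>s. position (s, \<omega>))"
  unfolding sample_def position_def by (simp add: fun_eq_iff path_eval_restrict sn_path_X)

lemma path_sup_sample: "\<omega> \<in> space M \<Longrightarrow> 0 \<le> s \<Longrightarrow> s \<le> t \<Longrightarrow> path_sup (sample \<omega>) s t = run_sup (\<lambda>s. X s \<omega>) s t"
  unfolding sample_def by (rule path_sup_restrict[OF sn_path_X])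

lemma path_eval_restarted:
  assumes "\<omega> \<in> space M" "\<omega>' \<in> space M" "t \<ge> 0"
  shows "s \<le> t \<Longrightarrow> path_eval (restarted t (\<omega>, \<omega>')) s = position (s, \<omega>)"
    and "u \<ge> 0 \<Longrightarrow> path_eval (restarted t (\<omega>, \<omega>')) (t + u) = position (t, \<omega>) + position (u, \<omega>')"
  unfolding restarted_def position_def using assms
  by (simp_all add: path_eval_restrict sn_path_concat_path sn_path_X concat_path_before concat_path_after)

lemma path_sup_restarted:
  assumes "\<omega> \<in> space M" "\<omega>' \<in> space M" "t \<ge> 0"
  shows "path_sup (restarted t (\<omega>, \<omega>')) 0 t = supremum (t, \<omega>)"
    and "u \<ge> 0 \<Longrightarrow> path_sup (restarted t (\<omega>, \<omega>')) t (t + u) = position (t, \<omega>) + supremum (u, \<omega>')"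
    and "u \<ge> 0 \<Longrightarrow> path_sup (restarted t (\<omega>, \<omega>')) 0 (t + u) = max (supremum (t, \<omega>)) (position (t, \<omega>) + supremum (u, \<omega>'))"
  unfolding restarted_def position_def supremum_def using assms
  by (simp_all add: path_sup_restrict sn_path_concat_path sn_path_X
      run_sup_concat_path run_sup_concat_path_before run_sup_concat_path_after)

lemma position_measurable [measurable (raw)]:
  assumes [measurable]: "f \<in> measurable N (borel \<Otimes>\<^sub>M M)"
  shows "(\<lambda>x. position (f x)) \<in> borel_measurable N"
proof -
  have [measurable]: "(\<lambda>x. sample (snd (f x))) \<in> measurable N path_space"
    by (rule measurable_compose[OF _ sample_measurable]) measurable
  have "position (f x) = path_eval (sample (snd (f x))) (fst (f x))" if "x \<in> space N" for x
    using measurable_space[OF assms that] by (auto simp: path_eval_sample space_pair_measure)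
  then show ?thesis by (subst measurable_cong) (assumption, measurable)
qed

lemma supremum_measurable [measurable (raw)]:
  assumes [measurable]: "f \<in> measurable N (borel \<Otimes>\<^sub>M M)"
  shows "(\<lambda>x. supremum (f x)) \<in> borel_measurable N"
proof -
  have [measurable]: "(\<lambda>x. sample (snd (f x))) \<in> measurable N path_space"
    by (rule measurable_compose[OF _ sample_measurable]) measurable
  have "supremum (f x) = path_sup (sample (snd (f x))) 0 (max 0 (fst (f x)))" if "x \<in> space N" for x
    using measurable_space[OF assms that] by (auto simp: path_sup_sample supremum_def space_pair_measure)
  then show ?thesis by (subst measurable_cong) (assumption, measurable)
qed

lemma drawdown_measurable [measurable (raw)]:
  assumes [measurable]: "f \<in> measurable N (borel \<Otimes>\<^sub>M M)"
  shows "(\<lambda>x. drawdown (f x)) \<in> borel_measurable N"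
  unfolding drawdown_def by measurable

lemma position_eq: "position z = supremum z - drawdown z"
  by (simp add: drawdown_def)

lemma supremum_nonneg: "\<omega> \<in> space M \<Longrightarrow> 0 \<le> supremum (t, \<omega>)"
  using run_sup_upper[OF sn_path_X, of \<omega> 0 0 "max 0 t"] by (simp add: supremum_def)

lemma supremum_mono: "\<omega> \<in> space M \<Longrightarrow> s \<le> t \<Longrightarrow> supremum (s, \<omega>) \<le> supremum (t, \<omega>)"
  unfolding supremum_def fst_conv snd_conv by (rule run_sup_mono[OF sn_path_X]) auto

lemma position_le_supremum: "\<omega> \<in> space M \<Longrightarrow> position (t, \<omega>) \<le> supremum (t, \<omega>)"
  using run_sup_upper[OF sn_path_X, of \<omega> 0 "max 0 t" "max 0 t"] by (simp add: supremum_def position_def)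

lemma drawdown_nonneg: "\<omega> \<in> space M \<Longrightarrow> 0 \<le> drawdown (t, \<omega>)"
  using position_le_supremum by (simp add: drawdown_def)

lemma distr_increment: "0 \<le> s \<Longrightarrow> s \<le> t \<Longrightarrow> distr M borel (\<lambda>\<omega>. X t \<omega> - X s \<omega>) = distr M borel (X (t - s))"
  using sn by (auto simp: spectrally_negative_levy_def levy_process_def)

lemma emeasure_increments:
  fixes ts :: "nat \<Rightarrow> real"
  assumes ts: "0 \<le> ts 0" "\<And>i. i < n \<Longrightarrow> ts i \<le> ts (Suc i)" and A [measurable]: "\<And>i. A i \<in> sets borel"
  shows "emeasure M {\<omega>\<in>space M. \<forall>i<n. X (ts (Suc i)) \<omega> - X (ts i) \<omega> \<in> A i}
    = (\<Prod>i<n. emeasure M {\<omega>\<in>space M. X (ts (Suc i) - ts i) \<omega> \<in> A i})"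
proof (cases "n = 0")
  case True
  then show ?thesis by (simp add: emeasure_space_1)
next
  case False
  have ts_nonneg: "0 \<le> ts i" if "i \<le> n" for i using that
    by (induction i) (use ts in \<open>auto intro: order_trans\<close>)
  have "indep_vars (\<lambda>_. borel) (\<lambda>i \<omega>. X (ts (Suc i)) \<omega> - X (ts i) \<omega>) {..<n}"
    using sn ts by (auto simp: spectrally_negative_levy_def levy_process_def)
  from indep_varsD_finite[OF this _ _ A]
  have "prob (\<Inter>i<n. (\<lambda>\<omega>. X (ts (Suc i)) \<omega> - X (ts i) \<omega>) -` A i \<inter> space M)
      = (\<Prod>i<n. prob ((\<lambda>\<omega>. X (ts (Suc i)) \<omega> - X (ts i) \<omega>) -` A i \<inter> space M))"
    using False by auto
  also have "(\<Inter>i<n. (\<lambda>\<omega>. X (ts (Suc i)) \<omega> - X (ts i) \<omega>) -` A i \<inter> space M)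
      = {\<omega>\<in>space M. \<forall>i<n. X (ts (Suc i)) \<omega> - X (ts i) \<omega> \<in> A i}"
    using False by auto
  also have "(\<Prod>i<n. prob ((\<lambda>\<omega>. X (ts (Suc i)) \<omega> - X (ts i) \<omega>) -` A i \<inter> space M))
      = (\<Prod>i<n. prob {\<omega>\<in>space M. X (ts (Suc i) - ts i) \<omega> \<in> A i})"
  proof (rule prod.cong[OF refl])
    fix i assume "i \<in> {..<n}"
    then have "measure (distr M borel (\<lambda>\<omega>. X (ts (Suc i)) \<omega> - X (ts i) \<omega>)) (A i)
        = measure (distr M borel (X (ts (Suc i) - ts i))) (A i)"
      using distr_increment[of "ts i" "ts (Suc i)"] ts ts_nonneg by simp
    then show "prob ((\<lambda>\<omega>. X (ts (Suc i)) \<omega> - X (ts i) \<omega>) -` A i \<inter> space M) = prob {\<omega>\<in>space M. X (ts (Suc i) - ts i) \<omega> \<in> A i}"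
      by (simp add: measure_distr vimage_def Int_def conj_commute)
  qed
  finally show ?thesis by (simp add: emeasure_eq_measure prod_ennreal)
qed

sublocale MM: pair_prob_space M M ..

lemma emeasure_restarted_increments:
  fixes ts :: "nat \<Rightarrow> real" and t :: real
  defines "Y \<equiv> \<lambda>z. concat_path (\<lambda>s. X s (fst z)) t (\<lambda>s. X s (snd z))"
  assumes ts: "ts 0 = 0" "\<And>i. i < n \<Longrightarrow> ts i \<le> ts (Suc i)" and m: "m \<le> n" "ts m = t"
    and A [measurable]: "\<And>i. A i \<in> sets borel"
  shows "emeasure (M \<Otimes>\<^sub>M M) {z\<in>space (M \<Otimes>\<^sub>M M). \<forall>i<n. Y z (ts (Suc i)) - Y z (ts i) \<in> A i}
    = (\<Prod>i<n. emeasure M {\<omega>\<in>space M. X (ts (Suc i) - ts i) \<omega> \<in> A i})"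
proof -
  define us where "us i = ts (m + i) - t" for i
  let ?C = "{\<omega>\<in>space M. \<forall>i<m. X (ts (Suc i)) \<omega> - X (ts i) \<omega> \<in> A i}"
  let ?D = "{\<omega>\<in>space M. \<forall>i<n-m. X (us (Suc i)) \<omega> - X (us i) \<omega> \<in> A (m + i)}"
  have "(\<forall>i<n. Y z (ts (Suc i)) - Y z (ts i) \<in> A i) \<longleftrightarrow> fst z \<in> ?C \<and> snd z \<in> ?D" if "z \<in> space (M \<Otimes>\<^sub>M M)" for z
    using concat_path_increments_in_iff[OF ts(2) m, where f="\<lambda>s. X s (fst z)" and g="\<lambda>s. X s (snd z)" and A=A] that
    by (simp add: space_pair_measure mem_Times_iff Y_def us_def)
  then have "{z\<in>space (M \<Otimes>\<^sub>M M). \<forall>i<n. Y z (ts (Suc i)) - Y z (ts i) \<in> A i}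
      = {z\<in>space (M \<Otimes>\<^sub>M M). fst z \<in> ?C \<and> snd z \<in> ?D}" by blast
  also have "\<dots> = ?C \<times> ?D" by (auto simp: space_pair_measure)
  finally have product: "{z\<in>space (M \<Otimes>\<^sub>M M). \<forall>i<n. Y z (ts (Suc i)) - Y z (ts i) \<in> A i} = ?C \<times> ?D" .
  have "emeasure (M \<Otimes>\<^sub>M M) (?C \<times> ?D) = emeasure M ?C * emeasure M ?D"
    by (rule emeasure_pair_measure_Times) auto
  also have "emeasure M ?C = (\<Prod>i<m. emeasure M {\<omega>\<in>space M. X (ts (Suc i) - ts i) \<omega> \<in> A i})"
    by (rule emeasure_increments) (use ts m in auto)
  also have "emeasure M ?D = (\<Prod>i<n-m. emeasure M {\<omega>\<in>space M. X (us (Suc i) - us i) \<omega> \<in> A (m + i)})"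
    by (rule emeasure_increments) (use ts m in \<open>auto simp: us_def\<close>)
  also have "\<dots> = (\<Prod>i=m..<n. emeasure M {\<omega>\<in>space M. X (ts (Suc i) - ts i) \<omega> \<in> A i})"
    by (rule prod.reindex_bij_witness[where i="\<lambda>i. i - m" and j="\<lambda>i. m + i"]) (auto simp: us_def)
  also have "(\<Prod>i<m. emeasure M {\<omega>\<in>space M. X (ts (Suc i) - ts i) \<omega> \<in> A i}) * \<dots> = (\<Prod>i<n. emeasure M {\<omega>\<in>space M. X (ts (Suc i) - ts i) \<omega> \<in> A i})"
    using m(1) by (simp add: lessThan_atLeast0 prod.atLeastLessThan_concat)
  finally show ?thesis unfolding product .
qed

lemma distr_increments_restarted:
  fixes ts :: "nat \<Rightarrow> real"
  assumes ts: "ts 0 = 0" "\<And>i. i < n \<Longrightarrow> ts i \<le> ts (Suc i)" and m: "m \<le> n" "ts m = t"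
  shows "distr M (Pi\<^sub>M {..<n} (\<lambda>_. borel)) (\<lambda>\<omega>. increments ts n (\<lambda>s. X s \<omega>))
    = distr (M \<Otimes>\<^sub>M M) (Pi\<^sub>M {..<n} (\<lambda>_. borel)) (\<lambda>z. increments ts n (concat_path (\<lambda>s. X s (fst z)) t (\<lambda>s. X s (snd z))))"
    (is "?P = ?Q")
proof (rule measure_eqI_PiM_finite[where I="{..<n}" and M="\<lambda>_. borel :: real measure" and A="\<lambda>_. Pi\<^sub>E {..<n} (\<lambda>_. UNIV)"])
  fix A :: "nat \<Rightarrow> real set" assume A: "\<And>i. i \<in> {..<n} \<Longrightarrow> A i \<in> sets borel"
  define B where "B i = (if i < n then A i else {})" for i
  have B [measurable]: "B i \<in> sets borel" for i using A by (simp add: B_def)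
  have "?P (Pi\<^sub>E {..<n} B) = ?Q (Pi\<^sub>E {..<n} B)"
    unfolding increments_def using emeasure_increments[of ts n B] emeasure_restarted_increments[of ts n m t B] assms
    by (simp add: emeasure_distr_PiM_box)
  moreover have "Pi\<^sub>E {..<n} A = Pi\<^sub>E {..<n} B" by (rule PiE_cong) (simp add: B_def)
  ultimately show "?P (Pi\<^sub>E {..<n} A) = ?Q (Pi\<^sub>E {..<n} A)" by simp
next
  interpret P: prob_space ?P by (rule prob_space_distr) (rule measurable_increments, measurable)
  show "?P (Pi\<^sub>E {..<n} (\<lambda>_. UNIV)) \<noteq> \<infinity>" by (simp add: P.emeasure_eq_measure)
qed (auto simp: space_PiM intro!: prod_algebraI_finite)

theorem distr_restarted:
  assumes t: "t \<ge> 0"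
  shows "distr M path_space sample = distr (M \<Otimes>\<^sub>M M) path_space (restarted t)" (is "?P = ?Q")
proof (rule measure_eqI_PiM_infinite[where I="{0..}" and M="\<lambda>_. borel"])
  interpret P: prob_space ?P by (rule prob_space_distr) measurable
  show "finite_measure ?P" by (rule P.finite_measure_axioms)
next
  fix A :: "real \<Rightarrow> real set" and J :: "real set"
  assume J: "finite J" "J \<subseteq> {0..}" and A: "\<And>i. i \<in> J \<Longrightarrow> A i \<in> sets borel"
  obtain ts :: "nat \<Rightarrow> real" and n m where ts: "ts 0 = 0" "\<And>i. i < n \<Longrightarrow> ts i \<le> ts (Suc i)" "m \<le> n" "ts m = t"
    and in_grid: "\<And>s. s \<in> J \<Longrightarrow> \<exists>i\<le>n. ts i = s"
    using finite_times_grid[OF J t] by metis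
  have "emeasure M {\<omega>\<in>space M. \<forall>s\<in>J. X s \<omega> \<in> A s} =
      emeasure (M \<Otimes>\<^sub>M M) {z\<in>space (M \<Otimes>\<^sub>M M). \<forall>s\<in>J. concat_path (\<lambda>s. X s (fst z)) t (\<lambda>s. X s (snd z)) s \<in> A s}"
    by (rule emeasure_cylinder_eq_if_increments_distr_eq[OF _ _ _ _ ts(1) J(1) in_grid A distr_increments_restarted[OF ts]])
       (use t in \<open>auto simp: concat_path_before space_pair_measure\<close>)
  then show "?P (prod_emb {0..} (\<lambda>_. borel) J (Pi\<^sub>E J A)) = ?Q (prod_emb {0..} (\<lambda>_. borel) J (Pi\<^sub>E J A))"
    unfolding sample_def[abs_def] restarted_def[abs_def] using J A
    by (simp add: emeasure_distr_path_space_cylinder)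
qed auto

lemma markov_nn_integral:
  assumes [measurable]: "F \<in> borel_measurable path_space" and t: "t \<ge> 0"
  shows "(\<integral>\<^sup>+\<omega>. F (sample \<omega>) \<partial>M) = (\<integral>\<^sup>+\<omega>. \<integral>\<^sup>+\<omega>'. F (restarted t (\<omega>, \<omega>')) \<partial>M \<partial>M)"
proof -
  have "(\<integral>\<^sup>+\<omega>. F (sample \<omega>) \<partial>M) = (\<integral>\<^sup>+w. F w \<partial>distr M path_space sample)"
    by (simp add: nn_integral_distr)
  also have "\<dots> = (\<integral>\<^sup>+z. F (restarted t z) \<partial>(M \<Otimes>\<^sub>M M))"
    unfolding distr_restarted[OF t] by (simp add: nn_integral_distr)
  also have "\<dots> = (\<integral>\<^sup>+\<omega>. \<integral>\<^sup>+\<omega>'. F (restarted t (\<omega>, \<omega>')) \<partial>M \<partial>M)"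
    by (rule nn_integral_fst[symmetric]) measurable
  finally show ?thesis .
qed

lemma markov_integral:
  fixes F :: "(real \<Rightarrow> real) \<Rightarrow> real"
  assumes [measurable]: "F \<in> borel_measurable path_space" and B: "\<And>w. w \<in> space path_space \<Longrightarrow> \<bar>F w\<bar> \<le> B" and t: "t \<ge> 0"
  shows "(\<integral>\<omega>. F (sample \<omega>) \<partial>M) = (\<integral>\<omega>. \<integral>\<omega>'. F (restarted t (\<omega>, \<omega>')) \<partial>M \<partial>M)"
proof -
  have "(\<integral>\<omega>. F (sample \<omega>) \<partial>M) = (\<integral>w. F w \<partial>distr M path_space sample)"
    by (simp add: integral_distr)
  also have "\<dots> = (\<integral>z. F (restarted t z) \<partial>(M \<Otimes>\<^sub>M M))"
    unfolding distr_restarted[OF t] by (simp add: integral_distr)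
  also have "\<dots> = (\<integral>\<omega>. \<integral>\<omega>'. F (restarted t (\<omega>, \<omega>')) \<partial>M \<partial>M)"
    by (rule MM.integral_fst'[symmetric], rule MM.P.integrable_const_bound[where B=B])
       (use B measurable_space[OF restarted_measurable] in auto)
  finally show ?thesis .
qed

end

section \<open>The supremum at an independent exponential time\<close>

lemma exponential_density_eq: "exponential_density p t = (if t < 0 then 0 else p * exp (- p * t))"
  by (simp add: exponential_density_def mult.commute)

lemma integrable_exponential_density: "p > 0 \<Longrightarrow> integrable lborel (exponential_density p)"
  and integral_exponential_density: "p > 0 \<Longrightarrow> (\<integral>t. exponential_density p t \<partial>lborel) = 1"
proof -
  assume p: "p > 0"
  interpret prob_space "density lborel (exponential_density p)" by (rule prob_space_exponential_density[OF p])
  have "(\<integral>\<^sup>+t. ennreal (exponential_density p t) \<partial>lborel) = 1"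
    using emeasure_space_1 by (simp add: emeasure_density)
  then have "has_bochner_integral lborel (exponential_density p) 1"
    by (intro has_bochner_integral_nn_integral) (auto simp: exponential_density_nonneg[OF p])
  then show "integrable lborel (exponential_density p)" "(\<integral>t. exponential_density p t \<partial>lborel) = 1"
    by (auto simp: has_bochner_integral_iff)
qed

abbreviation exp_mean :: "real \<Rightarrow> (real \<Rightarrow> real) \<Rightarrow> real" where
  "exp_mean p f \<equiv> (\<integral>t. exponential_density p t * f t \<partial>lborel)"

abbreviation nn_exp_mean :: "real \<Rightarrow> (real \<Rightarrow> ennreal) \<Rightarrow> ennreal" where
  "nn_exp_mean p f \<equiv> (\<integral>\<^sup>+t. ennreal (exponential_density p t) * f t \<partial>lborel)"

lemma nn_exp_mean_cong: "(\<And>t. 0 \<le> t \<Longrightarrow> f t = g t) \<Longrightarrow> nn_exp_mean p f = nn_exp_mean p g"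
  by (rule nn_integral_cong) (auto simp: exponential_density_eq)

lemma nn_exp_mean_one: "p > 0 \<Longrightarrow> nn_exp_mean p (\<lambda>_. 1) = 1"
  using integrable_exponential_density[of p] integral_exponential_density[of p]
  by (simp add: nn_integral_eq_integral exponential_density_nonneg)

lemma exp_mean_cong: "(\<And>t. 0 \<le> t \<Longrightarrow> f t = g t) \<Longrightarrow> exp_mean p f = exp_mean p g"
  by (rule Bochner_Integration.integral_cong) (auto simp: exponential_density_eq)

lemma exp_mean_integrable:
  assumes p: "p > 0" and [measurable]: "f \<in> borel_measurable borel" and f: "\<And>t. 0 \<le> t \<Longrightarrow> \<bar>f t\<bar> \<le> B"
  shows "integrable lborel (\<lambda>t. exponential_density p t * f t)"
proof (rule Bochner_Integration.integrable_bound)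
  show "integrable lborel (\<lambda>t. B * exponential_density p t)" using integrable_exponential_density[OF p] by simp
  have "\<bar>exponential_density p t * f t\<bar> \<le> B * exponential_density p t" for t
  proof (cases "0 \<le> t")
    case True
    have "\<bar>f t\<bar> * exponential_density p t \<le> B * exponential_density p t"
      by (rule mult_right_mono[OF f[OF True] exponential_density_nonneg[OF p]])
    then show ?thesis by (simp add: abs_mult exponential_density_nonneg[OF p] mult.commute)
  qed (simp add: exponential_density_eq)
  then show "AE t in lborel. norm (exponential_density p t * f t) \<le> norm (B * exponential_density p t)"
    by (intro AE_I2) (metis abs_ge_self order_trans real_norm_def)
qed measurable

lemma exp_mean_mono:
  assumes p: "p > 0" and "f \<in> borel_measurable borel" "\<And>t. 0 \<le> t \<Longrightarrow> \<bar>f t\<bar> \<le> B"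
    and "g \<in> borel_measurable borel" "\<And>t. 0 \<le> t \<Longrightarrow> \<bar>g t\<bar> \<le> C" and f_le_g: "\<And>t. 0 \<le> t \<Longrightarrow> f t \<le> g t"
  shows "exp_mean p f \<le> exp_mean p g"
proof (rule Bochner_Integration.integral_mono)
  fix t show "exponential_density p t * f t \<le> exponential_density p t * g t"
    using mult_left_mono[OF f_le_g exponential_density_nonneg[OF p], of t t]
    by (cases "0 \<le> t") (auto simp: exponential_density_eq)
qed (use exp_mean_integrable[OF p] assms in auto)

lemma exp_mean_const: "p > 0 \<Longrightarrow> exp_mean p (\<lambda>_. c) = c"
  by (simp add: integral_exponential_density)

lemma abs_exp_mean_le:
  assumes p: "p > 0" and f: "f \<in> borel_measurable borel" "\<And>t. 0 \<le> t \<Longrightarrow> \<bar>f t\<bar> \<le> B"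
  shows "\<bar>exp_mean p f\<bar> \<le> B"
proof -
  have "exp_mean p f \<le> exp_mean p (\<lambda>_. B)"
    by (rule exp_mean_mono[OF p f, where C="\<bar>B\<bar>"]) (use f(2) in \<open>auto simp: abs_le_iff\<close>)
  moreover have "exp_mean p (\<lambda>_. - B) \<le> exp_mean p f"
    by (rule exp_mean_mono[OF p _ _ f, where B="\<bar>B\<bar>"]) (use f(2) in \<open>auto simp: abs_le_iff minus_le_iff\<close>)
  ultimately show ?thesis by (simp only: exp_mean_const[OF p] abs_le_iff) simp
qed

lemma exp_mean_shift:
  assumes T: "T \<ge> 0"
  shows "exp_mean p (\<lambda>t. if T \<le> t then h t else 0) = exp (- p * T) * exp_mean p (\<lambda>u. h (T + u))"
proof -
  have "exp_mean p (\<lambda>t. if T \<le> t then h t else 0) =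
      (\<integral>u. exponential_density p (T + 1 * u) * (if T \<le> T + 1 * u then h (T + 1 * u) else 0) \<partial>lborel)"
    by (subst lborel_integral_real_affine[where c=1 and t=T]) auto
  also have "\<dots> = (\<integral>u. exp (- p * T) * (exponential_density p u * h (T + u)) \<partial>lborel)"
  proof (rule Bochner_Integration.integral_cong[OF refl])
    fix u
    have "exp (- p * (T + u)) = exp (- p * T) * exp (- p * u)" unfolding exp_add[symmetric] by (simp add: algebra_simps)
    then show "exponential_density p (T + 1 * u) * (if T \<le> T + 1 * u then h (T + 1 * u) else 0) =
        exp (- p * T) * (exponential_density p u * h (T + u))"
      using T by (simp add: exponential_density_eq)
  qed
  finally show ?thesis by simp
qed

lemma exp_mean_atLeast:
  assumes "p > 0" "T \<ge> 0"
  shows "exp_mean p (\<lambda>t. if T \<le> t then 1 else 0) = exp (- p * T)"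
  using exp_mean_shift[OF assms(2), of p "\<lambda>_. 1"] by (simp add: integral_exponential_density[OF assms(1)])

lemma exp_mean_cong_AE:
  assumes "f \<in> borel_measurable borel" "g \<in> borel_measurable borel" "AE t in lborel. 0 \<le> t \<longrightarrow> f t = g t"
  shows "exp_mean p f = exp_mean p g"
proof (rule integral_cong_AE)
  show "AE t in lborel. exponential_density p t * f t = exponential_density p t * g t"
    using assms(3) by eventually_elim (auto simp: exponential_density_eq)
qed (use assms in auto)

context sn_levy
begin

definition exp_time :: "real \<Rightarrow> (real \<times> 'a) measure" where
  "exp_time p = density lborel (\<lambda>t. ennreal (exponential_density p t)) \<Otimes>\<^sub>M M"

lemma sets_exp_time [measurable_cong]: "sets (exp_time p) = sets (borel \<Otimes>\<^sub>M M)"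
  unfolding exp_time_def by (rule sets_pair_measure_cong) auto

lemma space_exp_time: "space (exp_time p) = UNIV \<times> space M"
  unfolding exp_time_def by (simp add: space_pair_measure)

lemma prob_space_exp_time: "p > 0 \<Longrightarrow> prob_space (exp_time p)"
  unfolding exp_time_def
  by (intro prob_space_pair prob_space_exponential_density) (auto intro: prob_space_axioms)

lemma exp_time_integral:
  fixes f :: "real \<times> 'a \<Rightarrow> real"
  assumes p: "p > 0" and [measurable]: "f \<in> borel_measurable (borel \<Otimes>\<^sub>M M)"
    and B: "\<And>z. z \<in> space (exp_time p) \<Longrightarrow> \<bar>f z\<bar> \<le> B"
  shows exp_time_integrable: "integrable (exp_time p) f"
    and exp_time_integral_time_inner: "(\<integral>z. f z \<partial>exp_time p) = (\<integral>\<omega>. exp_mean p (\<lambda>t. f (t, \<omega>)) \<partial>M)"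
    and exp_time_integral_time_outer: "(\<integral>z. f z \<partial>exp_time p) = exp_mean p (\<lambda>t. \<integral>\<omega>. f (t, \<omega>) \<partial>M)"
proof -
  let ?E = "density lborel (\<lambda>t. ennreal (exponential_density p t))"
  interpret E: prob_space ?E by (rule prob_space_exponential_density[OF p])
  interpret EM: pair_prob_space ?E M ..
  interpret N: prob_space "exp_time p" by (rule prob_space_exp_time[OF p])
  show "integrable (exp_time p) f"
    by (rule N.integrable_const_bound[where B=B]) (use B in auto)
  then have int: "integrable (?E \<Otimes>\<^sub>M M) (case_prod (\<lambda>t \<omega>. f (t, \<omega>)))" by (simp add: exp_time_def)
  have "(\<integral>z. f z \<partial>exp_time p) = (\<integral>\<omega>. (\<integral>t. f (t, \<omega>) \<partial>?E) \<partial>M)"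
    using EM.integral_snd[OF int] by (simp add: exp_time_def)
  also have "\<dots> = (\<integral>\<omega>. exp_mean p (\<lambda>t. f (t, \<omega>)) \<partial>M)"
    by (rule Bochner_Integration.integral_cong[OF refl], subst integral_real_density)
       (auto simp: exponential_density_nonneg[OF p])
  finally show "(\<integral>z. f z \<partial>exp_time p) = (\<integral>\<omega>. exp_mean p (\<lambda>t. f (t, \<omega>)) \<partial>M)" .
  have "(\<integral>z. f z \<partial>exp_time p) = (\<integral>t. (\<integral>\<omega>. f (t, \<omega>) \<partial>M) \<partial>?E)"
    using EM.integral_fst'[OF int] by (simp add: exp_time_def)
  also have "\<dots> = exp_mean p (\<lambda>t. \<integral>\<omega>. f (t, \<omega>) \<partial>M)"
    by (subst integral_real_density) (auto simp: exponential_density_nonneg[OF p])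
  finally show "(\<integral>z. f z \<partial>exp_time p) = exp_mean p (\<lambda>t. \<integral>\<omega>. f (t, \<omega>) \<partial>M)" .
qed

lemma exp_time_nn_integral:
  assumes p: "p > 0" and [measurable]: "f \<in> borel_measurable (borel \<Otimes>\<^sub>M M)"
  shows "(\<integral>\<^sup>+z. f z \<partial>exp_time p) = nn_exp_mean p (\<lambda>t. \<integral>\<^sup>+\<omega>. f (t, \<omega>) \<partial>M)"
proof -
  let ?E = "density lborel (\<lambda>t. ennreal (exponential_density p t))"
  have "(\<integral>\<^sup>+z. f z \<partial>exp_time p) = (\<integral>\<^sup>+t. (\<integral>\<^sup>+\<omega>. f (t, \<omega>) \<partial>M) \<partial>?E)"
    unfolding exp_time_def by (rule nn_integral_fst[symmetric]) measurable
  also have "\<dots> = nn_exp_mean p (\<lambda>t. \<integral>\<^sup>+\<omega>. f (t, \<omega>) \<partial>M)"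
    by (rule nn_integral_density) auto
  finally show ?thesis .
qed

lemma nn_exp_mean_nn_integral_swap:
  assumes [measurable]: "f \<in> borel_measurable (borel \<Otimes>\<^sub>M M)"
  shows "nn_exp_mean p (\<lambda>t. \<integral>\<^sup>+\<omega>. f (t, \<omega>) \<partial>M) = (\<integral>\<^sup>+\<omega>. nn_exp_mean p (\<lambda>t. f (t, \<omega>)) \<partial>M)"
proof -
  interpret LM: pair_sigma_finite lborel M ..
  have "nn_exp_mean p (\<lambda>t. \<integral>\<^sup>+\<omega>. f (t, \<omega>) \<partial>M) = (\<integral>\<^sup>+t. (\<integral>\<^sup>+\<omega>. ennreal (exponential_density p t) * f (t, \<omega>) \<partial>M) \<partial>lborel)"
    by (simp add: nn_integral_cmult)
  also have "\<dots> = (\<integral>\<^sup>+\<omega>. nn_exp_mean p (\<lambda>t. f (t, \<omega>)) \<partial>M)"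
    by (rule LM.Fubini'[symmetric]) measurable
  finally show ?thesis .
qed

end

lemma sum_if_first_index:
  fixes g :: "nat \<Rightarrow> real"
  assumes "\<exists>k. P k"
  shows "(\<Sum>k\<le>K. (if P k \<and> (\<forall>j<k. \<not> P j) then g k else 0)) = (if (LEAST k. P k) \<le> K then g (LEAST k. P k) else 0)"
proof -
  have "P k \<and> (\<forall>j<k. \<not> P j) \<longleftrightarrow> k = (LEAST k. P k)" for k
    using assms by (metis LeastI_ex Least_le not_less_Least linorder_neqE_nat not_less)
  then show ?thesis by simp
qed

lemma abs_sum_if_first_index_le:
  fixes g :: "nat \<Rightarrow> real"
  assumes "\<And>k. \<bar>g k\<bar> \<le> C"
  shows "\<bar>\<Sum>k\<le>K. (if P k \<and> (\<forall>j<k. \<not> P j) then g k else 0)\<bar> \<le> C"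
proof (cases "\<exists>k. P k")
  case True
  then show ?thesis using sum_if_first_index[OF True, of g K] assms order_trans[OF abs_ge_zero assms] by auto
next
  case False
  then show ?thesis using order_trans[OF abs_ge_zero assms] by simp
qed

text \<open>The strong Markov property at the first passage over the level y, killed at rate p: a functional
  \<open>\<theta>\<close> of the supremum above y and the drawdown is unaffected by the path before the passage.\<close>

locale strong_markov = sn_levy M X for M :: "'a measure" and X +
  fixes p y B :: real and \<theta> :: "real \<Rightarrow> real \<Rightarrow> real"
  assumes p: "p > 0" and y: "y \<ge> 0" and cont: "continuous_on UNIV (\<lambda>(s, d). \<theta> s d)"
    and bound: "\<And>s d. \<bar>\<theta> s d\<bar> \<le> B" and zero: "\<And>s d. s \<le> 0 \<Longrightarrow> \<theta> s d = 0"
begin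

lemma \<theta>_measurable [measurable (raw)]:
  assumes "g \<in> borel_measurable N" "h \<in> borel_measurable N"
  shows "(\<lambda>x. \<theta> (g x) (h x)) \<in> borel_measurable N"
proof -
  have "(\<lambda>(s, d). \<theta> s d) \<in> borel_measurable borel" using cont by (rule borel_measurable_continuous_onI)
  from measurable_compose[OF _ this, of "\<lambda>x. (g x, h x)" N] show ?thesis using assms by simp
qed

lemma \<theta>_tendsto: "f \<longlonglongrightarrow> a \<Longrightarrow> g \<longlonglongrightarrow> b \<Longrightarrow> (\<lambda>n. \<theta> (f n) (g n)) \<longlonglongrightarrow> \<theta> a b"
  using continuous_on_tendsto_compose[OF cont, of "\<lambda>n. (f n, g n)" "(a, b)"] by (auto intro: tendsto_Pair)

definition mean_from :: "real \<Rightarrow> real" where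
  "mean_from r = (\<integral>z. \<theta> (r + supremum z) (drawdown z) \<partial>exp_time p)"

lemma mean_from_eq: "mean_from r = (\<integral>\<omega>. exp_mean p (\<lambda>u. \<theta> (r + supremum (u, \<omega>)) (drawdown (u, \<omega>))) \<partial>M)"
  unfolding mean_from_def by (rule exp_time_integral_time_inner[OF p]) (use bound in auto)

lemma mean_from_tendsto: "f \<longlonglongrightarrow> r \<Longrightarrow> (\<lambda>n. mean_from (f n)) \<longlonglongrightarrow> mean_from r"
  unfolding mean_from_def
proof (rule integral_dominated_convergence[where w="\<lambda>_. B"])
  interpret N: prob_space "exp_time p" by (rule prob_space_exp_time[OF p])
  show "integrable (exp_time p) (\<lambda>_. B)" by simp
  assume "f \<longlonglongrightarrow> r"
  then show "AE z in exp_time p. (\<lambda>n. \<theta> (f n + supremum z) (drawdown z)) \<longlonglongrightarrow> \<theta> (r + supremum z) (drawdown z)"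
    by (intro AE_I2 \<theta>_tendsto tendsto_intros)
qed (use bound in auto)

lemma abs_mean_from_le: "\<bar>mean_from r\<bar> \<le> B"
proof -
  interpret N: prob_space "exp_time p" by (rule prob_space_exp_time[OF p])
  have int: "integrable (exp_time p) (\<lambda>z. \<theta> (r + supremum z) (drawdown z))"
    by (rule exp_time_integrable[OF p]) (use bound in auto)
  have "mean_from r \<le> B" unfolding mean_from_def
    by (rule N.integral_le_const[OF int]) (use bound in \<open>auto simp: abs_le_iff\<close>)
  moreover have "- B \<le> mean_from r" unfolding mean_from_def
    by (rule N.integral_ge_const[OF int]) (use bound in \<open>auto simp: abs_le_iff minus_le_iff\<close>)
  ultimately show ?thesis by simp
qed

lemma mean_from_measurable [measurable]: "mean_from \<in> borel_measurable borel"
  by (rule borel_measurable_continuous_onI) (simp add: continuous_on_sequentially mean_from_tendsto comp_def)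

definition first_above :: "(real \<Rightarrow> real) \<Rightarrow> nat \<Rightarrow> nat \<Rightarrow> bool" where
  "first_above f n k \<longleftrightarrow> f (real k / 2 ^ n) > y \<and> (\<forall>j<k. \<not> f (real j / 2 ^ n) > y)"

definition after :: "(real \<Rightarrow> real) \<Rightarrow> real \<Rightarrow> real" where
  "after w T = exp_mean p (\<lambda>u. \<theta> (path_sup w T (T + u) - y) (path_sup w T (T + u) - path_eval w (T + u)))"

definition grid_term :: "nat \<Rightarrow> nat \<Rightarrow> (real \<Rightarrow> real) \<Rightarrow> real" where
  "grid_term n k w = (if first_above (path_eval w) n k then exp (- p * (real k / 2 ^ n)) * after w (real k / 2 ^ n) else 0)"

definition restarted_grid_term :: "nat \<Rightarrow> nat \<Rightarrow> 'a \<Rightarrow> real" where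
  "restarted_grid_term n k \<omega> = (if first_above (\<lambda>s. position (s, \<omega>)) n k
     then exp (- p * (real k / 2 ^ n)) * mean_from (position (real k / 2 ^ n, \<omega>) - y) else 0)"

lemma first_above_measurable [measurable]: "Measurable.pred path_space (\<lambda>w. first_above (path_eval w) n k)"
  unfolding first_above_def by measurable

lemma grid_term_measurable [measurable]: "grid_term n k \<in> borel_measurable path_space"
  unfolding grid_term_def[abs_def] after_def by measurable

lemma restarted_grid_term_measurable [measurable]: "restarted_grid_term n k \<in> borel_measurable M"
  unfolding restarted_grid_term_def[abs_def] first_above_def by measurable

lemma abs_exp_mult_le:
  assumes "T \<ge> 0" "\<bar>r\<bar> \<le> B"
  shows "\<bar>exp (- p * T) * r\<bar> \<le> B"
proof -
  have "exp (- p * T) * \<bar>r\<bar> \<le> 1 * B" using p assms by (intro mult_mono) auto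
  then show ?thesis by (simp add: abs_mult)
qed

lemma abs_after_le:
  assumes "w \<in> space path_space"
  shows "\<bar>after w T\<bar> \<le> B"
proof -
  have [measurable]: "(\<lambda>_. w) \<in> measurable borel path_space" using assms by simp
  show ?thesis unfolding after_def by (rule abs_exp_mean_le[OF p]) (use bound in auto)
qed

lemma abs_sum_grid_term_le:
  assumes "w \<in> space path_space"
  shows "\<bar>\<Sum>k\<le>K. grid_term n k w\<bar> \<le> B"
  unfolding grid_term_def first_above_def
  by (intro abs_sum_if_first_index_le abs_exp_mult_le abs_after_le assms) simp

lemma abs_sum_restarted_grid_term_le: "\<bar>\<Sum>k\<le>K. restarted_grid_term n k \<omega>\<bar> \<le> B"
  unfolding restarted_grid_term_def first_above_def
  by (intro abs_sum_if_first_index_le abs_exp_mult_le abs_mean_from_le) simp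

lemma abs_grid_term_le: "w \<in> space path_space \<Longrightarrow> \<bar>grid_term n k w\<bar> \<le> B"
  using abs_exp_mult_le[OF _ abs_after_le, of "real k / 2 ^ n" w] order_trans[OF abs_ge_zero bound]
  by (simp add: grid_term_def)

lemma abs_restarted_grid_term_le: "\<bar>restarted_grid_term n k \<omega>\<bar> \<le> B"
  using abs_exp_mult_le[OF _ abs_mean_from_le, of "real k / 2 ^ n"] order_trans[OF abs_ge_zero bound]
  by (simp add: restarted_grid_term_def)

lemma grid_term_restarted:
  assumes \<omega>: "\<omega> \<in> space M" "\<omega>' \<in> space M"
  shows "grid_term n k (restarted (real k / 2 ^ n) (\<omega>, \<omega>')) = (if first_above (\<lambda>s. position (s, \<omega>)) n k
    then exp (- p * (real k / 2 ^ n)) * exp_mean p (\<lambda>u. \<theta> (position (real k / 2 ^ n, \<omega>) - y + supremum (u, \<omega>')) (drawdown (u, \<omega>'))) else 0)"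
proof -
  let ?T = "real k / 2 ^ n"
  have "real j / 2 ^ n \<le> ?T" if "j \<le> k" for j using that by (simp add: divide_right_mono)
  then have "first_above (path_eval (restarted ?T (\<omega>, \<omega>'))) n k \<longleftrightarrow> first_above (\<lambda>s. position (s, \<omega>)) n k"
    by (auto simp: first_above_def path_eval_restarted(1)[OF \<omega>])
  moreover have "after (restarted ?T (\<omega>, \<omega>')) ?T
      = exp_mean p (\<lambda>u. \<theta> (position (?T, \<omega>) - y + supremum (u, \<omega>')) (drawdown (u, \<omega>')))"
    unfolding after_def
    by (rule exp_mean_cong) (simp add: path_eval_restarted(2)[OF \<omega>] path_sup_restarted(2)[OF \<omega>] drawdown_def diff_add_eq)
  ultimately show ?thesis by (simp add: grid_term_def)
qed

lemma integral_grid_term: "(\<integral>\<omega>. grid_term n k (sample \<omega>) \<partial>M) = (\<integral>\<omega>. restarted_grid_term n k \<omega> \<partial>M)"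
proof -
  let ?T = "real k / 2 ^ n"
  have "(\<integral>\<omega>. grid_term n k (sample \<omega>) \<partial>M) = (\<integral>\<omega>. \<integral>\<omega>'. grid_term n k (restarted ?T (\<omega>, \<omega>')) \<partial>M \<partial>M)"
    by (rule markov_integral[where B=B]) (use abs_grid_term_le in auto)
  also have "\<dots> = (\<integral>\<omega>. restarted_grid_term n k \<omega> \<partial>M)"
  proof (rule Bochner_Integration.integral_cong[OF refl])
    fix \<omega> assume \<omega>: "\<omega> \<in> space M"
    have "(\<integral>\<omega>'. grid_term n k (restarted ?T (\<omega>, \<omega>')) \<partial>M) = (\<integral>\<omega>'. (if first_above (\<lambda>s. position (s, \<omega>)) n k
      then exp (- p * ?T) * exp_mean p (\<lambda>u. \<theta> (position (?T, \<omega>) - y + supremum (u, \<omega>')) (drawdown (u, \<omega>'))) else 0) \<partial>M)"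
      by (rule Bochner_Integration.integral_cong[OF refl grid_term_restarted[OF \<omega>]])
    then show "(\<integral>\<omega>'. grid_term n k (restarted ?T (\<omega>, \<omega>')) \<partial>M) = restarted_grid_term n k \<omega>"
      by (simp add: restarted_grid_term_def mean_from_eq)
  qed
  finally show ?thesis .
qed

lemma integral_sum_grid_term:
  "(\<integral>\<omega>. (\<Sum>k\<le>K. grid_term n k (sample \<omega>)) \<partial>M) = (\<integral>\<omega>. (\<Sum>k\<le>K. restarted_grid_term n k \<omega>) \<partial>M)"
proof -
  have "integrable M (\<lambda>\<omega>. grid_term n k (sample \<omega>))" "integrable M (restarted_grid_term n k)" for k
    by (rule integrable_const_bound[where B=B];
        use abs_grid_term_le abs_restarted_grid_term_le measurable_space[OF sample_measurable] in auto)+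
  then show ?thesis by (simp add: Bochner_Integration.integral_sum integral_grid_term)
qed

lemma exp_mult_after:
  assumes \<omega>: "\<omega> \<in> space M" and T: "T \<ge> 0"
  shows "exp (- p * T) * after (sample \<omega>) T =
    exp_mean p (\<lambda>t. if T \<le> t then \<theta> (run_sup (\<lambda>s. X s \<omega>) T t - y) (run_sup (\<lambda>s. X s \<omega>) T t - position (t, \<omega>)) else 0)"
  unfolding exp_mean_shift[OF T] after_def
  by (intro arg_cong2[where f="(*)"] refl exp_mean_cong) (simp add: path_sup_sample[OF \<omega> T] path_eval_sample[OF \<omega>])

end

locale strong_markov_crossing = strong_markov +
  fixes \<omega>
  assumes \<omega>: "\<omega> \<in> space M" and crosses: "\<exists>t\<ge>0. X t \<omega> > y"
begin

sublocale crossing_path "\<lambda>s. X s \<omega>" y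
  by unfold_locales (use sn_path_X[OF \<omega>] \<omega> y crosses in auto)

lemma supremum_gt_iff: "t \<ge> 0 \<Longrightarrow> supremum (t, \<omega>) > y \<longleftrightarrow> \<tau> < t"
  using run_sup_gt_iff[of t] by (simp add: supremum_def)

lemma eventually_sum_first_above:
  "\<forall>\<^sub>F n in sequentially. g (grid_time n) = (\<Sum>k\<le>n * 2 ^ n. (if first_above (\<lambda>s. position (s, \<omega>)) n k then g (real k / 2 ^ n) else 0))"
  for g :: "real \<Rightarrow> real"
  using grid_passage_crosses grid_passage_le
proof eventually_elim
  case (elim n)
  have "first_above (\<lambda>s. position (s, \<omega>)) n k \<longleftrightarrow> X (real k / 2 ^ n) \<omega> > y \<and> (\<forall>j<k. \<not> X (real j / 2 ^ n) \<omega> > y)" for k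
    by (simp add: first_above_def position_def)
  moreover have "\<exists>k. X (real k / 2 ^ n) \<omega> > y" using elim by blast
  ultimately show ?case using elim by (simp add: sum_if_first_index flip: grid_passage_def)
qed

lemma after_passage_integrand_tendsto:
  assumes t: "t \<ge> 0" "t \<noteq> \<tau>"
  shows "(\<lambda>n. if grid_time n \<le> t
      then \<theta> (run_sup (\<lambda>s. X s \<omega>) (grid_time n) t - y) (run_sup (\<lambda>s. X s \<omega>) (grid_time n) t - position (t, \<omega>)) else 0)
    \<longlonglongrightarrow> \<theta> (supremum (t, \<omega>) - y) (drawdown (t, \<omega>))" (is "?h \<longlonglongrightarrow> _")
proof (cases "\<tau> < t")
  case True
  have "(\<lambda>n. \<theta> (run_sup (\<lambda>s. X s \<omega>) (grid_time n) t - y) (run_sup (\<lambda>s. X s \<omega>) (grid_time n) t - position (t, \<omega>)))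
      \<longlonglongrightarrow> \<theta> (supremum (t, \<omega>) - y) (drawdown (t, \<omega>))"
    using run_sup_after_passage[OF True] t by (intro \<theta>_tendsto tendsto_diff) (auto simp: supremum_def drawdown_def intro!: tendsto_diff)
  moreover have "\<forall>\<^sub>F n in sequentially. \<theta> (run_sup (\<lambda>s. X s \<omega>) (grid_time n) t - y) (run_sup (\<lambda>s. X s \<omega>) (grid_time n) t - position (t, \<omega>)) = ?h n"
    using order_tendstoD(2)[OF grid_passage_tendsto True] by eventually_elim simp
  ultimately show ?thesis by (rule Lim_transform_eventually)
next
  case False
  then have "t < \<tau>" using t by simp
  have "\<forall>\<^sub>F n in sequentially. 0 = ?h n"
    using grid_passage_crosses by eventually_elim (use \<open>t < \<tau>\<close> in auto)
  then have "?h \<longlonglongrightarrow> 0" by (rule Lim_transform_eventually[OF tendsto_const])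
  moreover have "\<theta> (supremum (t, \<omega>) - y) (drawdown (t, \<omega>)) = 0"
    using supremum_gt_iff[OF t(1)] \<open>t < \<tau>\<close> by (simp add: zero)
  ultimately show ?thesis by (simp only:)
qed

lemma after_passage_tendsto:
  "(\<lambda>n. exp (- p * grid_time n) * after (sample \<omega>) (grid_time n)) \<longlonglongrightarrow> exp_mean p (\<lambda>t. \<theta> (supremum (t, \<omega>) - y) (drawdown (t, \<omega>)))"
proof -
  let ?\<theta> = "\<lambda>T t. if T \<le> t then \<theta> (run_sup (\<lambda>s. X s \<omega>) T t - y) (run_sup (\<lambda>s. X s \<omega>) T t - position (t, \<omega>)) else 0"
  have [measurable]: "(\<lambda>_. sample \<omega>) \<in> measurable borel path_space" "(\<lambda>_. \<omega>) \<in> measurable borel M"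
    using measurable_space[OF sample_measurable \<omega>] \<omega> by auto
  have "?\<theta> T = (\<lambda>t. if T \<le> t then \<theta> (path_sup (sample \<omega>) T t - y) (path_sup (sample \<omega>) T t - position (t, \<omega>)) else 0)" if "T \<ge> 0" for T
    using that by (auto simp: fun_eq_iff path_sup_sample[OF \<omega>])
  then have [measurable]: "?\<theta> (grid_time n) \<in> borel_measurable borel" for n by simp
  have "(\<lambda>n. exp_mean p (?\<theta> (grid_time n))) \<longlonglongrightarrow> exp_mean p (\<lambda>t. \<theta> (supremum (t, \<omega>) - y) (drawdown (t, \<omega>)))"
  proof (rule integral_dominated_convergence[where w="\<lambda>t. exponential_density p t * B"])
    show "integrable lborel (\<lambda>t. exponential_density p t * B)" by (simp add: integrable_exponential_density[OF p])
    show "AE t in lborel. norm (exponential_density p t * ?\<theta> (grid_time n) t) \<le> exponential_density p t * B" for n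
      using bound order_trans[OF abs_ge_zero bound] exponential_density_nonneg[OF p]
      by (intro AE_I2) (auto simp: abs_mult intro!: mult_left_mono)
    have "(\<lambda>n. exponential_density p t * ?\<theta> (grid_time n) t) \<longlonglongrightarrow> exponential_density p t * \<theta> (supremum (t, \<omega>) - y) (drawdown (t, \<omega>))"
      if "t \<noteq> \<tau>" for t
      using after_passage_integrand_tendsto[OF _ that]
      by (cases "t \<ge> 0") (auto simp: exponential_density_eq intro!: tendsto_mult_left)
    then show "AE t in lborel. (\<lambda>n. exponential_density p t * ?\<theta> (grid_time n) t) \<longlonglongrightarrow> exponential_density p t * \<theta> (supremum (t, \<omega>) - y) (drawdown (t, \<omega>))"
      using AE_lborel_singleton[of \<tau>] by (auto elim: eventually_mono)
  qed measurable
  moreover have "exp (- p * grid_time n) * after (sample \<omega>) (grid_time n) = exp_mean p (?\<theta> (grid_time n))" for n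
    by (rule exp_mult_after[OF \<omega>]) simp
  ultimately show ?thesis by (simp only:)
qed

lemma exp_mean_supremum_gt: "exp_mean p (\<lambda>t. indicator {y<..} (supremum (t, \<omega>))) = exp (- p * \<tau>)"
proof -
  have [measurable]: "(\<lambda>_. \<omega>) \<in> measurable borel M" using \<omega> by simp
  have "exp_mean p (\<lambda>t. indicator {y<..} (supremum (t, \<omega>))) = exp_mean p (\<lambda>t. if \<tau> \<le> t then 1 else 0)"
  proof (rule exp_mean_cong_AE)
    show "AE t in lborel. 0 \<le> t \<longrightarrow> indicator {y<..} (supremum (t, \<omega>)) = (if \<tau> \<le> t then 1 else 0 :: real)"
      using AE_lborel_singleton[of \<tau>] by eventually_elim (auto simp: supremum_gt_iff indicator_def)
  qed measurable
  then show ?thesis using exp_mean_atLeast[OF p tau_nonneg] by simp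
qed

end

context strong_markov
begin

lemma not_crossing:
  assumes \<omega>: "\<omega> \<in> space M" and "\<not> (\<exists>t\<ge>0. X t \<omega> > y)"
  shows "\<not> first_above (\<lambda>s. position (s, \<omega>)) n k" and "supremum (t, \<omega>) \<le> y"
proof -
  have below: "X t \<omega> \<le> y" if "t \<ge> 0" for t using assms(2) that by (auto simp: not_less)
  then show "\<not> first_above (\<lambda>s. position (s, \<omega>)) n k" by (simp add: first_above_def position_def not_less)
  show "supremum (t, \<omega>) \<le> y" unfolding supremum_def fst_conv snd_conv by (rule run_sup_least) (use below in auto)
qed

lemma sum_grid_term_tendsto:
  assumes \<omega>: "\<omega> \<in> space M"
  shows "(\<lambda>n. \<Sum>k\<le>n * 2 ^ n. grid_term n k (sample \<omega>)) \<longlonglongrightarrow> exp_mean p (\<lambda>t. \<theta> (supremum (t, \<omega>) - y) (drawdown (t, \<omega>)))"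
proof (cases "\<exists>t\<ge>0. X t \<omega> > y")
  case True
  then interpret strong_markov_crossing M X p y B \<theta> \<omega> by unfold_locales (use \<omega> in auto)
  show ?thesis
    using Lim_transform_eventually[OF after_passage_tendsto eventually_sum_first_above[of "\<lambda>T. exp (- p * T) * after (sample \<omega>) T"]]
    by (simp add: grid_term_def path_eval_sample[OF \<omega>])
next
  case False
  then show ?thesis
    using not_crossing[OF \<omega> False] by (simp add: grid_term_def path_eval_sample[OF \<omega>] zero)
qed

lemma sum_restarted_grid_term_tendsto:
  assumes \<omega>: "\<omega> \<in> space M"
  shows "(\<lambda>n. \<Sum>k\<le>n * 2 ^ n. restarted_grid_term n k \<omega>) \<longlonglongrightarrow> exp_mean p (\<lambda>t. indicator {y<..} (supremum (t, \<omega>))) * mean_from 0"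
proof (cases "\<exists>t\<ge>0. X t \<omega> > y")
  case True
  then interpret strong_markov_crossing M X p y B \<theta> \<omega> by unfold_locales (use \<omega> in auto)
  have "(\<lambda>n. exp (- p * grid_time n) * mean_from (position (grid_time n, \<omega>) - y)) \<longlonglongrightarrow> exp (- p * \<tau>) * mean_from (y - y)"
    using f_grid_passage_tendsto by (intro tendsto_intros grid_passage_tendsto mean_from_tendsto) (simp add: position_def)
  from Lim_transform_eventually[OF this eventually_sum_first_above[of "\<lambda>T. exp (- p * T) * mean_from (position (T, \<omega>) - y)"]]
  show ?thesis by (simp add: restarted_grid_term_def exp_mean_supremum_gt)
next
  case False
  then show ?thesis
    using not_crossing[OF \<omega> False] by (simp add: restarted_grid_term_def not_less)
qed

theorem strong_markov:
  "(\<integral>z. \<theta> (supremum z - y) (drawdown z) \<partial>exp_time p) =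
    (\<integral>z. indicator {y<..} (supremum z) \<partial>exp_time p) * (\<integral>z. \<theta> (supremum z) (drawdown z) \<partial>exp_time p)"
proof -
  let ?before = "\<lambda>n \<omega>. \<Sum>k\<le>n * 2 ^ n. grid_term n k (sample \<omega>)" and ?lim = "\<lambda>\<omega>. exp_mean p (\<lambda>t. \<theta> (supremum (t, \<omega>) - y) (drawdown (t, \<omega>)))"
  let ?after = "\<lambda>n \<omega>. \<Sum>k\<le>n * 2 ^ n. restarted_grid_term n k \<omega>" and ?lim' = "\<lambda>\<omega>. exp_mean p (\<lambda>t. indicator {y<..} (supremum (t, \<omega>))) * mean_from 0"
  have "(\<lambda>n. \<integral>\<omega>. ?before n \<omega> \<partial>M) \<longlonglongrightarrow> (\<integral>\<omega>. ?lim \<omega> \<partial>M)"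
  proof (rule integral_dominated_convergence[where w="\<lambda>_. B"])
    show "AE \<omega> in M. norm (?before n \<omega>) \<le> B" for n
      using abs_sum_grid_term_le measurable_space[OF sample_measurable] by (intro AE_I2) simp
    show "AE \<omega> in M. (\<lambda>n. ?before n \<omega>) \<longlonglongrightarrow> ?lim \<omega>" by (rule AE_I2) (rule sum_grid_term_tendsto)
  qed auto
  moreover have "(\<lambda>n. \<integral>\<omega>. ?after n \<omega> \<partial>M) \<longlonglongrightarrow> (\<integral>\<omega>. ?lim' \<omega> \<partial>M)"
  proof (rule integral_dominated_convergence[where w="\<lambda>_. B"])
    show "AE \<omega> in M. norm (?after n \<omega>) \<le> B" for n
      using abs_sum_restarted_grid_term_le by (intro AE_I2) simp
    show "AE \<omega> in M. (\<lambda>n. ?after n \<omega>) \<longlonglongrightarrow> ?lim' \<omega>" by (rule AE_I2) (rule sum_restarted_grid_term_tendsto)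
  qed auto
  ultimately have "(\<integral>\<omega>. ?lim \<omega> \<partial>M) = (\<integral>\<omega>. ?lim' \<omega> \<partial>M)"
    unfolding integral_sum_grid_term by (rule LIMSEQ_unique)
  also have "\<dots> = (\<integral>\<omega>. exp_mean p (\<lambda>t. indicator {y<..} (supremum (t, \<omega>))) \<partial>M) * mean_from 0" by simp
  also have "(\<integral>\<omega>. exp_mean p (\<lambda>t. indicator {y<..} (supremum (t, \<omega>))) \<partial>M) = (\<integral>z. indicator {y<..} (supremum z) \<partial>exp_time p)"
    by (rule exp_time_integral_time_inner[OF p, where B=1, symmetric]) auto
  also have "(\<integral>\<omega>. ?lim \<omega> \<partial>M) = (\<integral>z. \<theta> (supremum z - y) (drawdown z) \<partial>exp_time p)"
    by (rule exp_time_integral_time_inner[OF p, where B=B, symmetric]) (use bound in auto)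
  finally show ?thesis by (simp add: mean_from_def)
qed

end

definition ramp :: "real \<Rightarrow> nat \<Rightarrow> real \<Rightarrow> real" where
  "ramp b j s = min 1 (real j * max 0 (s - b))"

lemma ramp_bounds: "0 \<le> ramp b j s" "ramp b j s \<le> 1"
  by (auto simp: ramp_def)

lemma continuous_on_ramp [continuous_intros]: "continuous_on S f \<Longrightarrow> continuous_on S (\<lambda>x. ramp b j (f x))"
  unfolding ramp_def by (intro continuous_intros)

lemma ramp_measurable [measurable]: "ramp b j \<in> borel_measurable borel"
  unfolding ramp_def[abs_def] by measurable

lemma ramp_tendsto: "(\<lambda>j. ramp b j s) \<longlonglongrightarrow> indicator {b<..} s"
proof (cases "b < s")
  case True
  have "filterlim (\<lambda>j. real j * (s - b)) at_top sequentially"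
    by (rule filterlim_at_top_mult_tendsto_pos[OF tendsto_const]) (use True filterlim_real_sequentially in auto)
  then have "\<forall>\<^sub>F j in sequentially. 1 \<le> real j * (s - b)" by (simp add: filterlim_at_top)
  then have "\<forall>\<^sub>F j in sequentially. 1 = ramp b j s" by eventually_elim (use True in \<open>simp add: ramp_def\<close>)
  then have "(\<lambda>j. ramp b j s) \<longlonglongrightarrow> 1" by (rule Lim_transform_eventually[OF tendsto_const])
  then show ?thesis using True by simp
qed (simp add: ramp_def)

lemma AE_nonneg_antimono_imp_all:
  fixes t :: real
  assumes ae: "AE t in lborel. t \<ge> 0 \<longrightarrow> Q t" and mono: "\<And>s t. 0 \<le> s \<Longrightarrow> s \<le> t \<Longrightarrow> Q t \<Longrightarrow> Q s" and t: "0 \<le> t"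
  shows "Q t"
proof (rule ccontr)
  assume "\<not> Q t"
  then have "\<not> Q s" if "s \<ge> t" for s using mono[of t s] t that by blast
  with ae have "AE s in lborel. s \<notin> {t..t+1}"
  proof (elim eventually_mono)
    fix s assume "0 \<le> s \<longrightarrow> Q s" and not_Q: "\<And>s. t \<le> s \<Longrightarrow> \<not> Q s"
    then show "s \<notin> {t..t+1}" using t not_Q[of s] by auto
  qed
  then have "emeasure lborel {t..t+1} = 0" by (subst (asm) AE_iff_measurable[where N="{t..t+1}"]) auto
  then show False by simp
qed

context sn_levy
begin

definition sup_tail :: "real \<Rightarrow> real \<Rightarrow> real" where
  "sup_tail p y = (\<integral>z. indicator {y<..} (supremum z) \<partial>exp_time p)"

lemma strong_markov_supremum_drawdown:
  assumes p: "p > 0" and y: "y \<ge> 0" and z: "z \<ge> 0" and \<phi>: "continuous_on UNIV \<phi>" and B: "\<And>d. \<bar>\<phi> d\<bar> \<le> B"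
  shows "(\<integral>w. indicator {y + z<..} (supremum w) * \<phi> (drawdown w) \<partial>exp_time p) =
    sup_tail p y * (\<integral>w. indicator {z<..} (supremum w) * \<phi> (drawdown w) \<partial>exp_time p)"
proof -
  interpret N: prob_space "exp_time p" by (rule prob_space_exp_time[OF p])
  have [measurable]: "\<phi> \<in> borel_measurable borel" using \<phi> by (rule borel_measurable_continuous_onI)
  have bound: "\<bar>ramp z j s * \<phi> d\<bar> \<le> B" for j s d
    using mult_mono[OF ramp_bounds(2)[of z j s] B[of d]] ramp_bounds(1)[of z j s] by (simp add: abs_mult)
  have ramp_product: "(\<integral>w. ramp z j (supremum w - y) * \<phi> (drawdown w) \<partial>exp_time p) =
      sup_tail p y * (\<integral>w. ramp z j (supremum w) * \<phi> (drawdown w) \<partial>exp_time p)" for j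
  proof -
    interpret strong_markov M X p y B "\<lambda>s d. ramp z j s * \<phi> d"
    proof unfold_locales
      show "continuous_on UNIV (\<lambda>(s, d). ramp z j s * \<phi> d)"
        unfolding case_prod_beta by (intro continuous_intros continuous_on_compose2[OF \<phi>]) auto
    qed (use p y z bound in \<open>auto simp: ramp_def\<close>)
    show ?thesis using strong_markov by (simp add: sup_tail_def)
  qed
  have lim: "(\<lambda>j. \<integral>w. ramp z j (supremum w - r) * \<phi> (drawdown w) \<partial>exp_time p) \<longlonglongrightarrow>
      (\<integral>w. indicator {z<..} (supremum w - r) * \<phi> (drawdown w) \<partial>exp_time p)" for r
    by (rule integral_dominated_convergence[where w="\<lambda>_. B"]) (use bound in \<open>auto intro!: AE_I2 tendsto_intros ramp_tendsto\<close>)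
  have "(\<lambda>j. sup_tail p y * (\<integral>w. ramp z j (supremum w - 0) * \<phi> (drawdown w) \<partial>exp_time p)) \<longlonglongrightarrow>
      sup_tail p y * (\<integral>w. indicator {z<..} (supremum w - 0) * \<phi> (drawdown w) \<partial>exp_time p)"
    by (intro tendsto_intros lim)
  with lim[of y] have "(\<integral>w. indicator {z<..} (supremum w - y) * \<phi> (drawdown w) \<partial>exp_time p) =
    sup_tail p y * (\<integral>w. indicator {z<..} (supremum w) * \<phi> (drawdown w) \<partial>exp_time p)"
    using LIMSEQ_unique by (fastforce simp: ramp_product)
  moreover have "indicator {z<..} (s - y) = (indicator {y + z<..} s :: real)" for s by (auto simp: indicator_def)
  ultimately show ?thesis by simp
qed

lemma sup_tail_mult: "p > 0 \<Longrightarrow> y \<ge> 0 \<Longrightarrow> z \<ge> 0 \<Longrightarrow> sup_tail p (y + z) = sup_tail p y * sup_tail p z"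
  using strong_markov_supremum_drawdown[of p y z "\<lambda>_. 1" 1] by (simp add: sup_tail_def)

lemma real_distribution_supremum:
  assumes p: "p > 0"
  shows "real_distribution (distr (exp_time p) borel supremum)"
proof -
  interpret N: prob_space "exp_time p" by (rule prob_space_exp_time[OF p])
  show ?thesis by (rule N.real_distribution_distr) measurable
qed

lemma sup_tail_cdf:
  assumes p: "p > 0"
  shows "sup_tail p y = 1 - cdf (distr (exp_time p) borel supremum) y"
proof -
  interpret R: real_distribution "distr (exp_time p) borel supremum" by (rule real_distribution_supremum[OF p])
  have "sup_tail p y = (\<integral>x. indicator {y<..} x \<partial>distr (exp_time p) borel supremum)"
    unfolding sup_tail_def by (subst integral_distr) auto
  also have "\<dots> = R.prob {y<..}" by simp
  also have "{y<..} = space (distr (exp_time p) borel supremum) - {..y}" by auto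
  also have "R.prob \<dots> = 1 - R.prob {..y}" by (rule R.prob_compl) simp
  finally show ?thesis by (simp add: cdf_def)
qed

lemma sup_tail_nonneg: "0 \<le> sup_tail p y"
  by (simp add: sup_tail_def)

lemma not_AE_nonpos: "\<not> (\<forall>t\<ge>0. AE \<omega> in M. X t \<omega> \<le> 0)"
proof
  assume nonpos: "\<forall>t\<ge>0. AE \<omega> in M. X t \<omega> \<le> 0"
  have "AE \<omega> in M. X t \<omega> \<le> X s \<omega>" if "0 \<le> s" "s \<le> t" for s t
  proof -
    have "AE x in distr M borel (X (t - s)). x \<le> 0"
      by (subst AE_distr_iff) (use nonpos that in auto)
    then have "AE x in distr M borel (\<lambda>\<omega>. X t \<omega> - X s \<omega>). x \<le> 0" unfolding distr_increment[OF that] .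
    then have "AE \<omega> in M. X t \<omega> - X s \<omega> \<le> 0" by (subst (asm) AE_distr_iff) auto
    then show ?thesis by simp
  qed
  then have "AE \<omega> in M. \<forall>s\<in>\<rat>. \<forall>t\<in>\<rat>. 0 \<le> s \<longrightarrow> s \<le> t \<longrightarrow> X t \<omega> \<le> X s \<omega>"
    by (intro AE_ball_countable'[OF _ countable_rat]) auto
  then have "AE \<omega> in M. antimono_on {0..} (\<lambda>t. X t \<omega>)"
    using AE_space by eventually_elim (rule sn_path_antimono_on[OF sn_path_X], auto)
  then show False using sn by (simp add: spectrally_negative_levy_def)
qed

lemma supremum_pos_null_if_sup_tail_0:
  assumes p: "p > 0" and tail: "sup_tail p 0 = 0" and t: "0 \<le> t"
  shows "(\<integral>\<omega>. indicator {0<..} (supremum (t, \<omega>)) \<partial>M) = (0::real)"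
proof -
  define P where "P t = (\<integral>\<omega>. indicator {0<..} (supremum (t, \<omega>)) \<partial>M :: real)" for t
  have [measurable]: "P \<in> borel_measurable borel" unfolding P_def by measurable
  have int: "integrable M (\<lambda>\<omega>. indicator {0<..} (supremum (t, \<omega>)) :: real)" for t
    by (rule integrable_const_bound[where B=1]) auto
  have P: "0 \<le> P t" "P t \<le> 1" for t
    unfolding P_def by (auto intro!: integral_le_const int)
  have "exp_mean p P = 0"
    using tail unfolding sup_tail_def P_def by (subst (asm) exp_time_integral_time_outer[OF p, where B=1]) auto
  moreover have "integrable lborel (\<lambda>t. exponential_density p t * P t)"
    by (rule exp_mean_integrable[OF p, where B=1]) (use P in \<open>auto simp: abs_le_iff intro: order_trans\<close>)
  ultimately have "AE t in lborel. exponential_density p t * P t = 0"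
    by (subst (asm) integral_nonneg_eq_0_iff_AE) (use P exponential_density_nonneg[OF p] in auto)
  then have AE_P_zero: "AE t in lborel. 0 \<le> t \<longrightarrow> P t = 0"
    by eventually_elim (use p in \<open>auto simp: exponential_density_eq split: if_splits\<close>)
  have "P t = 0"
  proof (rule AE_nonneg_antimono_imp_all[OF AE_P_zero _ t])
    fix s t :: real assume "0 \<le> s" "s \<le> t" "P t = 0"
    have "P s \<le> P t" unfolding P_def
      by (rule Bochner_Integration.integral_mono[OF int int])
         (use supremum_mono \<open>s \<le> t\<close> in \<open>force simp: indicator_def\<close>)
    then show "P s = 0" using P(1)[of s] \<open>P t = 0\<close> by simp
  qed
  then show ?thesis by (simp add: P_def)
qed

text \<open>The tail at 0 is 0 or 1, being its own square; it is not 0 because the paths are not decreasing.\<close>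

lemma sup_tail_0: assumes p: "p > 0" shows "sup_tail p 0 = 1"
proof (rule ccontr)
  assume "sup_tail p 0 \<noteq> 1"
  then have tail: "sup_tail p 0 = 0" using sup_tail_mult[OF p, of 0 0] by simp
  have "AE \<omega> in M. X t \<omega> \<le> 0" if t: "0 \<le> t" for t
  proof -
    have "AE \<omega> in M. indicator {0<..} (supremum (t, \<omega>)) = (0::real)"
      using supremum_pos_null_if_sup_tail_0[OF p tail t]
      by (subst (asm) integral_nonneg_eq_0_iff_AE) (auto intro!: integrable_const_bound[where B=1])
    then show ?thesis using AE_space
      by eventually_elim (use position_le_supremum[of _ t] t in \<open>force simp: position_def indicator_def split: if_splits\<close>)
  qed
  then show False using not_AE_nonpos by blast
qed

lemma sup_tail_right_cont:
  assumes p: "p > 0"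
  shows "(sup_tail p \<longlongrightarrow> sup_tail p y) (at_right y)"
proof -
  interpret R: real_distribution "distr (exp_time p) borel supremum" by (rule real_distribution_supremum[OF p])
  show ?thesis using R.cdf_is_right_cont[of y] unfolding continuous_within
    by (simp add: sup_tail_cdf[OF p, abs_def] tendsto_intros)
qed

lemma sup_tail_pos: assumes p: "p > 0" and y: "y \<ge> 0" shows "sup_tail p y > 0"
proof -
  have "\<forall>\<^sub>F y in at_right 0. sup_tail p y > 0"
    using order_tendstoD(1)[OF sup_tail_right_cont[OF p, of 0], of 0] sup_tail_0[OF p] by simp
  then obtain b where b: "b > 0" "\<And>y. 0 < y \<Longrightarrow> y < b \<Longrightarrow> sup_tail p y > 0" unfolding eventually_at_right_field by auto
  have multiples: "sup_tail p (real n * (b / 2)) > 0" for n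
  proof (induction n)
    case (Suc n)
    have "sup_tail p (real (Suc n) * (b / 2))
        = sup_tail p (real n * (b / 2) + b / 2)" by (simp add: algebra_simps add_divide_distrib)
    also have "\<dots> = sup_tail p (real n * (b / 2)) * sup_tail p (b / 2)" by (rule sup_tail_mult[OF p]) (use b in auto)
    finally show ?case using Suc b(2)[of "b / 2"] b(1) by simp
  qed (simp add: sup_tail_0[OF p])
  obtain n where "y < real n * (b / 2)" using reals_Archimedean3[of "b / 2"] b(1) by auto
  then have "sup_tail p (real n * (b / 2)) = sup_tail p y * sup_tail p (real n * (b / 2) - y)"
    using sup_tail_mult[OF p y, of "real n * (b / 2) - y"] by simp
  then show ?thesis using multiples[of n] sup_tail_nonneg[of p y] by (metis less_irrefl mult_zero_left order_le_less)
qed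

definition sup_rate :: "real \<Rightarrow> real" where "sup_rate p = - ln (sup_tail p 1)"

lemma sup_tail_eq: "p > 0 \<Longrightarrow> y \<ge> 0 \<Longrightarrow> sup_tail p y = exp (- sup_rate p * y)"
  using multiplicative_right_continuous_exp[of "sup_tail p" y] sup_tail_pos sup_tail_mult sup_tail_right_cont
  by (simp add: sup_rate_def mult.commute)

lemma sup_rate_pos: assumes p: "p > 0" shows "sup_rate p > 0"
proof (rule ccontr)
  assume "\<not> sup_rate p > 0"
  then have sup_tail_ge: "sup_tail p y \<ge> 1" if "y \<ge> 0" for y
    using sup_tail_eq[OF p that] that by (simp add: mult_nonpos_nonneg)
  interpret R: real_distribution "distr (exp_time p) borel supremum" by (rule real_distribution_supremum[OF p])
  have "((\<lambda>y. 1 - cdf (distr (exp_time p) borel supremum) y) \<longlongrightarrow> 1 - 1) at_top"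
    by (intro tendsto_intros R.cdf_lim_at_top_prob)
  then have "(sup_tail p \<longlongrightarrow> 0) at_top" by (simp add: sup_tail_cdf[OF p, abs_def])
  then have "\<forall>\<^sub>F y in at_top. sup_tail p y < 1" by (rule order_tendstoD) simp
  then have "\<forall>\<^sub>F y in at_top. sup_tail p y < 1 \<and> 0 \<le> y" using eventually_ge_at_top[of 0] by eventually_elim simp
  then obtain y where "sup_tail p y < 1" "0 \<le> y" using eventually_happens[of _ "at_top :: real filter"] by auto
  then show False using sup_tail_ge by force
qed

lemma exp_mean_supremum_gt_le:
  assumes p: "p > 0" and \<omega>: "\<omega> \<in> space M" and e: "e \<ge> 0" "\<And>t. 0 \<le> t \<Longrightarrow> t < e \<Longrightarrow> supremum (t, \<omega>) \<le> y"
  shows "\<bar>exp_mean p (\<lambda>t. indicator {y<..} (supremum (t, \<omega>)))\<bar> \<le> exp (- p * e)"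
proof -
  have [measurable]: "(\<lambda>_. \<omega>) \<in> measurable borel M" using \<omega> by simp
  have "exp_mean p (\<lambda>t. indicator {y<..} (supremum (t, \<omega>))) \<le> exp_mean p (\<lambda>t. if e \<le> t then 1 else 0)"
    by (rule exp_mean_mono[OF p, where B=1 and C=1]) (use e(2) in \<open>force simp: indicator_def\<close>)+
  moreover have "0 \<le> exp_mean p (\<lambda>t. indicator {y<..} (supremum (t, \<omega>)))"
    by (rule Bochner_Integration.integral_nonneg) (simp add: exponential_density_nonneg[OF p])
  ultimately show ?thesis using exp_mean_atLeast[OF p e(1)] by simp
qed

lemma exp_mean_supremum_gt_tendsto_0:
  assumes \<omega>: "\<omega> \<in> space M" and y: "y > 0"
  shows "(\<lambda>n. exp_mean (real n + 1) (\<lambda>t. indicator {y<..} (supremum (t, \<omega>)))) \<longlonglongrightarrow> 0"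
proof -
  obtain e where e: "e > 0" "\<And>t. 0 \<le> t \<Longrightarrow> t < 0 + e \<Longrightarrow> X t \<omega> < y"
    using sn_path_right_less[OF sn_path_X[OF \<omega>], of 0 y] \<omega> y by auto
  have "supremum (t, \<omega>) \<le> y" if "0 \<le> t" "t < e" for t
    unfolding supremum_def fst_conv snd_conv by (rule run_sup_least) (use e that in \<open>auto intro!: less_imp_le\<close>)
  then have bound: "\<bar>exp_mean (real n + 1) (\<lambda>t. indicator {y<..} (supremum (t, \<omega>)))\<bar> \<le> exp (- (real n + 1) * e)" for n
    using exp_mean_supremum_gt_le[OF _ \<omega>, of "real n + 1" e y] e(1) by simp
  have "filterlim (\<lambda>n. real n + 1) at_top sequentially"
    using filterlim_compose[OF filterlim_real_sequentially filterlim_Suc] by (simp add: add.commute)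
  then have "filterlim (\<lambda>n. (real n + 1) * e) at_top sequentially"
    by (rule filterlim_at_top_mult_tendsto_pos[OF tendsto_const, rotated]) (use e in auto)
  then have "filterlim (\<lambda>n. - ((real n + 1) * e)) at_bot sequentially"
    by (simp add: filterlim_uminus_at_bot)
  then have "(\<lambda>n. exp (- (real n + 1) * e)) \<longlonglongrightarrow> 0"
    by (simp only: mult_minus_left) (rule filterlim_compose[OF exp_at_bot])
  then show ?thesis by (rule Lim_null_comparison[rotated]) (use bound in auto)
qed

lemma sup_rate_unbounded: "\<exists>p>0. L < sup_rate p"
proof -
  have tail: "sup_tail (real n + 1) 1 = (\<integral>\<omega>. exp_mean (real n + 1) (\<lambda>t. indicator {1<..} (supremum (t, \<omega>))) \<partial>M)" for n
    unfolding sup_tail_def by (rule exp_time_integral_time_inner[where B=1]) auto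
  have "(\<lambda>n. sup_tail (real n + 1) 1) \<longlonglongrightarrow> (\<integral>\<omega>. 0 \<partial>M)"
    unfolding tail
  proof (rule integral_dominated_convergence[where w="\<lambda>_. 1"])
    show "AE \<omega> in M. norm (exp_mean (real n + 1) (\<lambda>t. indicator {1<..} (supremum (t, \<omega>)))) \<le> 1" for n
      using exp_mean_supremum_gt_le[of "real n + 1" _ 0] by (intro AE_I2) fastforce
    show "AE \<omega> in M. (\<lambda>n. exp_mean (real n + 1) (\<lambda>t. indicator {1<..} (supremum (t, \<omega>)))) \<longlonglongrightarrow> 0"
      by (intro AE_I2 exp_mean_supremum_gt_tendsto_0) auto
  qed auto
  then have "\<forall>\<^sub>F n in sequentially. sup_tail (real n + 1) 1 < exp (- L)" by (rule order_tendstoD) simp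
  then obtain n where "sup_tail (real n + 1) 1 < exp (- L)" using eventually_happens[of _ sequentially] by auto
  then have "exp (- sup_rate (real n + 1)) < exp (- L)" using sup_tail_eq[of "real n + 1" 1] by simp
  then show ?thesis by (intro exI[of _ "real n + 1"]) auto
qed

lemma supremum_exponential:
  assumes p: "p > 0"
  shows "distributed (exp_time p) lborel supremum (exponential_density (sup_rate p))"
proof -
  interpret N: prob_space "exp_time p" by (rule prob_space_exp_time[OF p])
  show ?thesis
  proof (rule exponential_distributedI[OF _ sup_rate_pos[OF p]])
    fix a :: real assume a: "0 \<le> a"
    have "N.prob {z\<in>space (exp_time p). supremum z \<le> a} = cdf (distr (exp_time p) borel supremum) a"
      by (simp add: cdf_def measure_distr vimage_def Int_def conj_commute)
    also have "\<dots> = 1 - exp (- a * sup_rate p)" using sup_tail_eq[OF p a] sup_tail_cdf[OF p, of a] by (simp add: mult.commute)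
    finally show "emeasure (exp_time p) {z\<in>space (exp_time p). supremum z \<le> a} = 1 - ennreal (exp (- a * sup_rate p))"
      by (simp add: N.emeasure_eq_measure ennreal_minus flip: ennreal_1)
  qed measurable
qed

end

section \<open>Independence of the supremum and the drawdown\<close>

lemma (in prob_space) indep_var_greaterThan_atMostI:
  fixes Y Z :: "'a \<Rightarrow> real"
  assumes [measurable]: "random_variable borel Y" "random_variable borel Z"
    and product: "\<And>y z. prob ((Y -` {y<..} \<inter> space M) \<inter> (Z -` {..z} \<inter> space M))
        = prob (Y -` {y<..} \<inter> space M) * prob (Z -` {..z} \<inter> space M)"
  shows "indep_var borel Y borel Z"
proof -
  let ?\<Omega> = "space M"
  have Y: "sigma_sets ?\<Omega> {Y -` A \<inter> ?\<Omega> |A. A \<in> sets borel} = sigma_sets ?\<Omega> {Y -` A \<inter> ?\<Omega> |A. A \<in> range greaterThan}"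
    unfolding borel_Ioi by (simp add: sigma_sets_vimage_commute) (rule sigma_sets_sigma_sets_eq, auto)
  have Z: "sigma_sets ?\<Omega> {Z -` A \<inter> ?\<Omega> |A. A \<in> sets borel} = sigma_sets ?\<Omega> {Z -` A \<inter> ?\<Omega> |A. A \<in> range atMost}"
    unfolding borel_eq_atMost by (simp add: sigma_sets_vimage_commute) (rule sigma_sets_sigma_sets_eq, auto)
  have "indep_set (sigma_sets ?\<Omega> {Y -` A \<inter> ?\<Omega> |A. A \<in> range greaterThan}) (sigma_sets ?\<Omega> {Z -` A \<inter> ?\<Omega> |A. A \<in> range atMost})"
  proof (rule indep_set_sigma_sets)
    show "indep_set {Y -` A \<inter> ?\<Omega> |A. A \<in> range greaterThan} {Z -` A \<inter> ?\<Omega> |A. A \<in> range atMost}"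
      by (rule indep_setI) (auto simp: product)
    show "Int_stable {Y -` A \<inter> ?\<Omega> |A. A \<in> range greaterThan}"
      unfolding Int_stable_def
    proof safe
      fix a b
      show "\<exists>A. (Y -` {a<..} \<inter> ?\<Omega>) \<inter> (Y -` {b<..} \<inter> ?\<Omega>) = Y -` A \<inter> ?\<Omega> \<and> A \<in> range greaterThan"
        by (intro exI[of _ "{max a b<..}"]) auto
    qed
    show "Int_stable {Z -` A \<inter> ?\<Omega> |A. A \<in> range atMost}"
      unfolding Int_stable_def
    proof safe
      fix a b
      show "\<exists>A. (Z -` {..a} \<inter> ?\<Omega>) \<inter> (Z -` {..b} \<inter> ?\<Omega>) = Z -` A \<inter> ?\<Omega> \<and> A \<in> range atMost"
        by (intro exI[of _ "{..min a b}"]) auto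
    qed
  qed
  then show ?thesis unfolding indep_var_eq Y Z by simp
qed

lemma (in prob_space) expectation_indicator_comp:
  fixes Y :: "'a \<Rightarrow> 'b"
  assumes [measurable]: "Y \<in> measurable M N" "A \<in> sets N"
  shows "expectation (\<lambda>\<omega>. indicator A (Y \<omega>) :: real) = prob (Y -` A \<inter> space M)"
proof -
  have "expectation (\<lambda>\<omega>. indicator A (Y \<omega>) :: real) = expectation (indicator (Y -` A \<inter> space M) :: 'a \<Rightarrow> real)"
    by (rule Bochner_Integration.integral_cong) (auto simp: indicator_def)
  then show ?thesis by simp
qed

context sn_levy
begin

lemma AE_supremum_pos: assumes p: "p > 0" shows "AE z in exp_time p. 0 < supremum z"
proof -
  interpret N: prob_space "exp_time p" by (rule prob_space_exp_time[OF p])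
  have "(\<integral>z. 1 - indicator {0<..} (supremum z) \<partial>exp_time p) = (0::real)"
    using sup_tail_0[OF p] unfolding sup_tail_def
    by (subst Bochner_Integration.integral_diff) (auto intro!: N.integrable_const_bound[where B=1] simp: N.prob_space)
  then have "AE z in exp_time p. 1 - indicator {0<..} (supremum z) = (0::real)"
    by (subst (asm) integral_nonneg_eq_0_iff_AE) (auto intro!: N.integrable_const_bound[where B=1] simp: indicator_def)
  then show ?thesis by eventually_elim (simp add: indicator_eq_1_iff)
qed

lemma supremum_drawdown_product:
  assumes p: "p > 0" and y: "y \<ge> 0" and \<phi>: "continuous_on UNIV \<phi>" and B: "\<And>d. \<bar>\<phi> d\<bar> \<le> B"
  shows "(\<integral>z. indicator {y<..} (supremum z) * \<phi> (drawdown z) \<partial>exp_time p) = sup_tail p y * (\<integral>z. \<phi> (drawdown z) \<partial>exp_time p)"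
proof -
  have [measurable]: "\<phi> \<in> borel_measurable borel" using \<phi> by (rule borel_measurable_continuous_onI)
  have "(\<integral>z. indicator {0<..} (supremum z) * \<phi> (drawdown z) \<partial>exp_time p) = (\<integral>z. \<phi> (drawdown z) \<partial>exp_time p)"
    by (rule integral_cong_AE) (use AE_supremum_pos[OF p] in auto)
  then show ?thesis using strong_markov_supremum_drawdown[OF p y _ \<phi> B, of 0] by simp
qed

lemma supremum_drawdown_product_atMost:
  assumes p: "p > 0" and y: "y \<ge> 0"
  shows "(\<integral>z. indicator {y<..} (supremum z) * indicator {..b} (drawdown z) \<partial>exp_time p)
      = sup_tail p y * (\<integral>z. indicator {..b} (drawdown z) \<partial>exp_time p)"
proof -
  interpret N: prob_space "exp_time p" by (rule prob_space_exp_time[OF p])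
  have bound: "\<bar>1 - ramp b j d\<bar> \<le> 1" for j d using ramp_bounds[of b j d] by simp
  then have product_bound: "\<bar>indicator {y<..} s * (1 - ramp b j d)\<bar> \<le> (1::real)" for s j d by (simp add: indicator_def)
  have lim: "(\<lambda>j. 1 - ramp b j d) \<longlonglongrightarrow> indicator {..b} d" for d
  proof -
    have "(\<lambda>j. 1 - ramp b j d) \<longlonglongrightarrow> 1 - indicator {b<..} d" by (intro tendsto_intros ramp_tendsto)
    moreover have "1 - indicator {b<..} d = (indicator {..b} d :: real)" by (simp add: indicator_def)
    ultimately show ?thesis by simp
  qed
  have "(\<lambda>j. \<integral>z. indicator {y<..} (supremum z) * (1 - ramp b j (drawdown z)) \<partial>exp_time p)
      \<longlonglongrightarrow> (\<integral>z. indicator {y<..} (supremum z) * indicator {..b} (drawdown z) \<partial>exp_time p)"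
    by (rule integral_dominated_convergence[where w="\<lambda>_. 1"])
       (use product_bound in \<open>auto intro!: AE_I2 tendsto_mult_left lim\<close>)
  moreover have "(\<lambda>j. sup_tail p y * (\<integral>z. 1 - ramp b j (drawdown z) \<partial>exp_time p)) \<longlonglongrightarrow> sup_tail p y * (\<integral>z. indicator {..b} (drawdown z) \<partial>exp_time p)"
    by (intro tendsto_mult_left integral_dominated_convergence[where w="\<lambda>_. 1"])
       (use bound in \<open>auto intro!: AE_I2 lim\<close>)
  moreover have "(\<integral>z. indicator {y<..} (supremum z) * (1 - ramp b j (drawdown z)) \<partial>exp_time p)
      = sup_tail p y * (\<integral>z. 1 - ramp b j (drawdown z) \<partial>exp_time p)" for j
    by (rule supremum_drawdown_product[OF p y _ bound]) (intro continuous_intros)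
  ultimately show ?thesis by (simp only: LIMSEQ_unique)
qed

lemma supremum_drawdown_indep:
  assumes p: "p > 0"
  shows "prob_space.indep_var (exp_time p) borel supremum borel drawdown"
proof -
  interpret N: prob_space "exp_time p" by (rule prob_space_exp_time[OF p])
  let ?\<Omega> = "space (exp_time p)"
  show ?thesis
  proof (rule N.indep_var_greaterThan_atMostI)
    fix y b
    show "N.prob ((supremum -` {y<..} \<inter> ?\<Omega>) \<inter> (drawdown -` {..b} \<inter> ?\<Omega>))
        = N.prob (supremum -` {y<..} \<inter> ?\<Omega>) * N.prob (drawdown -` {..b} \<inter> ?\<Omega>)"
    proof (cases "y \<ge> 0")
      case True
      have "N.prob ((supremum -` {y<..} \<inter> ?\<Omega>) \<inter> (drawdown -` {..b} \<inter> ?\<Omega>))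
          = N.expectation (indicator ((supremum -` {y<..} \<inter> ?\<Omega>) \<inter> (drawdown -` {..b} \<inter> ?\<Omega>)))"
        by simp
      also have "\<dots> = (\<integral>z. indicator {y<..} (supremum z) * indicator {..b} (drawdown z) \<partial>exp_time p)"
        by (rule Bochner_Integration.integral_cong) (auto simp: indicator_def)
      finally show ?thesis
        using supremum_drawdown_product_atMost[OF p True, of b] by (simp add: sup_tail_def N.expectation_indicator_comp[where N=borel])
    next
      case False
      have "y < supremum (t, \<omega>)" if "\<omega> \<in> space M" for t \<omega> using supremum_nonneg[OF that, of t] False by linarith
      then have "supremum -` {y<..} \<inter> ?\<Omega> = ?\<Omega>" by (auto simp: space_exp_time)
      then show ?thesis by (simp add: N.prob_space)
    qed
  qed measurable
qed

lemma supremum_drawdown_nn_integral: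
  assumes p: "p > 0" and [measurable]: "f \<in> borel_measurable (borel \<Otimes>\<^sub>M borel)"
  shows "(\<integral>\<^sup>+z. f (supremum z, drawdown z) \<partial>exp_time p)
      = (\<integral>\<^sup>+z. nn_exp_mean (sup_rate p) (\<lambda>s. f (s, drawdown z)) \<partial>exp_time p)"
proof -
  interpret N: prob_space "exp_time p" by (rule prob_space_exp_time[OF p])
  let ?S = "distr (exp_time p) borel supremum" and ?D = "distr (exp_time p) borel drawdown"
  interpret S: prob_space ?S by (rule N.prob_space_distr) measurable
  interpret D: prob_space ?D by (rule N.prob_space_distr) measurable
  interpret P: pair_sigma_finite ?S ?D ..
  have density: "?S = density lborel (\<lambda>t. ennreal (exponential_density (sup_rate p) t))"
    using supremum_exponential[OF p] unfolding distributed_def by (simp cong: distr_cong)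
  have "(\<integral>\<^sup>+z. f (supremum z, drawdown z) \<partial>exp_time p)
      = (\<integral>\<^sup>+w. f w \<partial>distr (exp_time p) (borel \<Otimes>\<^sub>M borel) (\<lambda>z. (supremum z, drawdown z)))"
    by (subst nn_integral_distr) auto
  also have "distr (exp_time p) (borel \<Otimes>\<^sub>M borel) (\<lambda>z. (supremum z, drawdown z)) = ?S \<Otimes>\<^sub>M ?D"
    using supremum_drawdown_indep[OF p] unfolding N.indep_var_distribution_eq by simp
  also have "(\<integral>\<^sup>+w. f w \<partial>(?S \<Otimes>\<^sub>M ?D)) = (\<integral>\<^sup>+d. (\<integral>\<^sup>+s. f (s, d) \<partial>?S) \<partial>?D)"
    by (rule P.nn_integral_snd[symmetric]) measurable
  also have "\<dots> = (\<integral>\<^sup>+z. (\<integral>\<^sup>+s. f (s, drawdown z) \<partial>?S) \<partial>exp_time p)"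
    by (subst nn_integral_distr) auto
  also have "\<dots> = (\<integral>\<^sup>+z. nn_exp_mean (sup_rate p) (\<lambda>s. f (s, drawdown z)) \<partial>exp_time p)"
    unfolding density by (intro nn_integral_cong nn_integral_density) auto
  finally show ?thesis .
qed

end

section \<open>Exponential moments and the Laplace exponent\<close>

lemma nn_exp_mean_exp:
  fixes c l :: real
  assumes "c > 0" "l < c"
  shows "nn_exp_mean c (\<lambda>s. ennreal (exp (l * s))) = ennreal (c / (c - l))"
proof -
  have "nn_exp_mean c (\<lambda>s. ennreal (exp (l * s))) = (\<integral>\<^sup>+s. ennreal (c / (c - l)) * ennreal (exponential_density (c - l) s) \<partial>lborel)"
  proof (rule nn_integral_cong)
    fix s
    have "exponential_density c s * exp (l * s) = c / (c - l) * exponential_density (c - l) s"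
    proof (cases "s < 0")
      case False
      have "exp (- c * s) * exp (l * s) = exp (- (c - l) * s)" unfolding exp_add[symmetric] by (simp add: algebra_simps)
      then show ?thesis using assms False by (simp add: exponential_density_eq)
    qed (simp add: exponential_density_eq)
    then show "ennreal (exponential_density c s) * ennreal (exp (l * s))
        = ennreal (c / (c - l)) * ennreal (exponential_density (c - l) s)"
      using assms by (simp add: ennreal_mult'[symmetric] exponential_density_nonneg)
  qed
  also have "\<dots> = ennreal (c / (c - l)) * nn_exp_mean (c - l) (\<lambda>_. 1)"
    by (simp add: nn_integral_cmult)
  finally show ?thesis using assms nn_exp_mean_one[of "c - l"] by simp
qed

lemma emeasure_lborel_atLeast: "emeasure lborel {a::real..} = \<infinity>"
proof (rule ccontr)
  assume "emeasure lborel {a..} \<noteq> \<infinity>"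
  then obtain r where r: "emeasure lborel {a..} = ennreal r" "r \<ge> 0" by (cases "emeasure lborel {a..}") auto
  have "emeasure lborel {a..a + r + 1} \<le> emeasure lborel {a..}" by (rule emeasure_mono) auto
  then show False using r by simp
qed

lemma nn_exp_mean_exp_infinite:
  fixes c l :: real
  assumes "c > 0" "l \<ge> c"
  shows "nn_exp_mean c (\<lambda>s. ennreal (exp (l * s))) = \<infinity>"
proof -
  have "(\<integral>\<^sup>+s. ennreal c * indicator {0..} (s::real) \<partial>lborel) \<le> nn_exp_mean c (\<lambda>s. ennreal (exp (l * s)))"
  proof (rule nn_integral_mono)
    fix s :: real
    show "ennreal c * indicator {0..} s \<le> ennreal (exponential_density c s) * ennreal (exp (l * s))"
    proof (cases "s \<ge> 0")
      case True
      have "c * 1 \<le> c * (exp (- c * s) * exp (l * s))"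
        using assms True by (intro mult_left_mono) (auto simp: exp_add[symmetric] algebra_simps mult_right_mono)
      then show ?thesis using True assms by (simp add: exponential_density_eq ennreal_mult'[symmetric] mult.assoc)
    qed simp
  qed
  moreover have "(\<integral>\<^sup>+s. ennreal c * indicator {0..} (s::real) \<partial>lborel) = \<infinity>"
    using assms emeasure_lborel_atLeast[of 0] by (subst nn_integral_cmult_indicator) (auto simp: ennreal_mult_eq_top_iff)
  ultimately show ?thesis by (simp add: top_unique)
qed

lemma (in prob_space) expectation_exp_pos:
  assumes "integrable M (\<lambda>\<omega>. exp (Y \<omega>))"
  shows "0 < expectation (\<lambda>\<omega>. exp (Y \<omega> :: real))"
proof -
  have "expectation (\<lambda>\<omega>. exp (Y \<omega>)) \<noteq> 0"
  proof
    assume "expectation (\<lambda>\<omega>. exp (Y \<omega>)) = 0"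
    then have "AE \<omega> in M. exp (Y \<omega>) = 0"
      by (subst (asm) integral_nonneg_eq_0_iff_AE[OF assms]) auto
    then show False by simp
  qed
  then show ?thesis by (simp add: order_less_le)
qed

context sn_levy
begin

definition drawdown_laplace :: "real \<Rightarrow> real \<Rightarrow> real" where
  "drawdown_laplace p l = (\<integral>z. exp (- l * drawdown z) \<partial>exp_time p)"

lemma exp_drawdown_le: "l \<ge> 0 \<Longrightarrow> z \<in> space (exp_time p) \<Longrightarrow> exp (- l * drawdown z) \<le> 1"
  using drawdown_nonneg by (auto simp: space_exp_time)

lemma exp_drawdown_integrable:
  assumes p: "p > 0" and l: "l \<ge> 0"
  shows "integrable (exp_time p) (\<lambda>z. exp (- l * drawdown z))"
  by (rule exp_time_integrable[OF p, where B=1]) (use exp_drawdown_le[OF l] in auto)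

lemma nn_integral_exp_drawdown:
  "p > 0 \<Longrightarrow> l \<ge> 0 \<Longrightarrow> (\<integral>\<^sup>+z. ennreal (exp (- l * drawdown z)) \<partial>exp_time p) = ennreal (drawdown_laplace p l)"
  unfolding drawdown_laplace_def by (rule nn_integral_eq_integral[OF exp_drawdown_integrable]) auto

lemma drawdown_laplace_pos: "p > 0 \<Longrightarrow> l \<ge> 0 \<Longrightarrow> 0 < drawdown_laplace p l"
  unfolding drawdown_laplace_def
  by (intro prob_space.expectation_exp_pos prob_space_exp_time exp_drawdown_integrable)

lemma drawdown_laplace_continuous:
  assumes p: "p > 0"
  shows "continuous_on {0..} (drawdown_laplace p)"
  unfolding continuous_on_sequentially comp_def
proof (intro ballI allI impI, elim conjE)
  interpret N: prob_space "exp_time p" by (rule prob_space_exp_time[OF p])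
  fix l :: real and x assume x: "\<forall>n. x n \<in> {0..}" "x \<longlonglongrightarrow> l"
  show "(\<lambda>n. drawdown_laplace p (x n)) \<longlonglongrightarrow> drawdown_laplace p l"
    unfolding drawdown_laplace_def
  proof (rule integral_dominated_convergence[where w="\<lambda>_. 1"])
    show "AE z in exp_time p. norm (exp (- x n * drawdown z)) \<le> 1" for n
      using exp_drawdown_le[of "x n"] x by (intro AE_I2) auto
    show "AE z in exp_time p. (\<lambda>n. exp (- x n * drawdown z)) \<longlonglongrightarrow> exp (- l * drawdown z)"
      by (intro AE_I2 tendsto_intros x)
  qed auto
qed

lemma drawdown_laplace_tendsto:
  assumes p: "p > 0" and l: "l > 0"
  shows "(drawdown_laplace p \<longlongrightarrow> drawdown_laplace p l) (at l)"
proof -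
  have "(drawdown_laplace p \<longlongrightarrow> drawdown_laplace p l) (at l within {0..})"
    using drawdown_laplace_continuous[OF p] l by (auto simp: continuous_on_def)
  moreover have "at l within {0..} = at l" by (rule at_within_interior) (use l in auto)
  ultimately show ?thesis by simp
qed

lemma exp_supremum_integrable:
  assumes l: "l \<ge> 0" and t: "t \<ge> 0"
  shows "integrable M (\<lambda>\<omega>. exp (l * supremum (t, \<omega>)))"
proof -
  obtain p where p: "p > 0" "l < sup_rate p" using sup_rate_unbounded by blast
  define P where "P t = (\<integral>\<^sup>+\<omega>. ennreal (exp (l * supremum (t, \<omega>))) \<partial>M)" for t
  have [measurable]: "P \<in> borel_measurable borel" unfolding P_def by measurable
  have "nn_exp_mean p P = (\<integral>\<^sup>+z. ennreal (exp (l * supremum z)) \<partial>exp_time p)"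
    unfolding P_def by (subst exp_time_nn_integral[OF p(1)]) auto
  also have "\<dots> = (\<integral>\<^sup>+z. nn_exp_mean (sup_rate p) (\<lambda>s. ennreal (exp (l * s))) \<partial>exp_time p)"
    using supremum_drawdown_nn_integral[OF p(1), of "\<lambda>(s, d). ennreal (exp (l * s))"] by simp
  also have "\<dots> = ennreal (sup_rate p / (sup_rate p - l))"
    using prob_space.emeasure_space_1[OF prob_space_exp_time[OF p(1)]]
    by (simp add: nn_exp_mean_exp[OF sup_rate_pos[OF p(1)] p(2)])
  finally have "AE t in lborel. ennreal (exponential_density p t) * P t \<noteq> \<infinity>"
    by (intro nn_integral_PInf_AE) auto
  then have AE_P_finite: "AE t in lborel. 0 \<le> t \<longrightarrow> P t \<noteq> \<infinity>"
    by eventually_elim (use p in \<open>auto simp: exponential_density_eq ennreal_mult_eq_top_iff\<close>)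
  have "P t \<noteq> \<infinity>"
  proof (rule AE_nonneg_antimono_imp_all[OF AE_P_finite _ t])
    fix s t :: real assume "s \<le> t" "P t \<noteq> \<infinity>"
    moreover have "P s \<le> P t" unfolding P_def
      by (rule nn_integral_mono) (use supremum_mono \<open>s \<le> t\<close> l in \<open>auto intro!: ennreal_leI mult_left_mono\<close>)
    ultimately show "P s \<noteq> \<infinity>" by (auto simp: top_unique)
  qed
  then show ?thesis unfolding P_def by (intro integrableI_nonneg) (auto simp: less_top)
qed

lemma exp_X_integrable:
  assumes "l \<ge> 0" "t \<ge> 0"
  shows "integrable M (\<lambda>\<omega>. exp (l * X t \<omega>))"
proof (rule Bochner_Integration.integrable_bound[OF exp_supremum_integrable[OF assms]])
  show "AE \<omega> in M. norm (exp (l * X t \<omega>)) \<le> norm (exp (l * supremum (t, \<omega>)))"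
    using position_le_supremum[of _ t] assms by (intro AE_I2) (auto simp: position_def intro!: mult_left_mono)
qed measurable

definition exp_moment :: "real \<Rightarrow> real \<Rightarrow> real" where
  "exp_moment l t = (\<integral>\<omega>. exp (l * X t \<omega>) \<partial>M)"

lemma nn_integral_exp_X: "l \<ge> 0 \<Longrightarrow> t \<ge> 0 \<Longrightarrow> (\<integral>\<^sup>+\<omega>. ennreal (exp (l * X t \<omega>)) \<partial>M) = ennreal (exp_moment l t)"
  unfolding exp_moment_def by (rule nn_integral_eq_integral[OF exp_X_integrable]) auto

lemma exp_moment_pos: "l \<ge> 0 \<Longrightarrow> t \<ge> 0 \<Longrightarrow> exp_moment l t > 0"
  unfolding exp_moment_def by (intro expectation_exp_pos exp_X_integrable)

lemma exp_moment_add: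
  assumes l: "l \<ge> 0" and s: "s \<ge> 0" and t: "t \<ge> 0"
  shows "exp_moment l (s + t) = exp_moment l s * exp_moment l t"
proof -
  let ?F = "\<lambda>w. ennreal (exp (l * path_eval w (s + t)))"
  have "(\<integral>\<^sup>+\<omega>. ennreal (exp (l * X (s + t) \<omega>)) \<partial>M) = (\<integral>\<^sup>+\<omega>. ?F (sample \<omega>) \<partial>M)"
    by (rule nn_integral_cong) (use s t in \<open>simp add: path_eval_sample position_def\<close>)
  also have "\<dots> = (\<integral>\<^sup>+\<omega>. \<integral>\<^sup>+\<omega>'. ?F (restarted s (\<omega>, \<omega>')) \<partial>M \<partial>M)"
    by (rule markov_nn_integral[OF _ s]) measurable
  also have "\<dots> = (\<integral>\<^sup>+\<omega>. \<integral>\<^sup>+\<omega>'. ennreal (exp (l * X s \<omega>)) * ennreal (exp (l * X t \<omega>')) \<partial>M \<partial>M)"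
    by (intro nn_integral_cong)
       (use s t in \<open>simp add: path_eval_restarted(2) position_def distrib_left exp_add ennreal_mult\<close>)
  also have "\<dots> = (\<integral>\<^sup>+\<omega>. ennreal (exp (l * X s \<omega>)) * ennreal (exp_moment l t) \<partial>M)"
    by (intro nn_integral_cong) (simp add: nn_integral_cmult nn_integral_exp_X[OF l t])
  also have "\<dots> = ennreal (exp_moment l s) * ennreal (exp_moment l t)"
    by (simp add: nn_integral_multc nn_integral_exp_X[OF l s])
  finally have "ennreal (exp_moment l (s + t)) = ennreal (exp_moment l s * exp_moment l t)"
    using nn_integral_exp_X[OF l, of "s + t"] s t exp_moment_pos[OF l] by (simp add: ennreal_mult less_imp_le)
  then show ?thesis using exp_moment_pos[OF l] s t by (simp add: less_imp_le mult_nonneg_nonneg)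
qed

lemma exp_moment_right_cont:
  assumes l: "l \<ge> 0" and t: "t \<ge> 0"
  shows "(exp_moment l \<longlongrightarrow> exp_moment l t) (at_right t)"
proof (rule tendsto_at_right_sequentially[of t "t + 1"])
  fix T :: "nat \<Rightarrow> real" assume T: "\<And>n. t < T n" "\<And>n. T n < t + 1" "T \<longlonglongrightarrow> t"
  have "T n \<noteq> t \<and> T n \<in> {t<..}" for n using T(1)[of n] by auto
  then have T_right: "filterlim T (at_right t) sequentially" unfolding filterlim_at using T(3) by simp
  show "(\<lambda>n. exp_moment l (T n)) \<longlonglongrightarrow> exp_moment l t"
    unfolding exp_moment_def
  proof (rule integral_dominated_convergence[where w="\<lambda>\<omega>. exp (l * supremum (t + 1, \<omega>))"])
    show "integrable M (\<lambda>\<omega>. exp (l * supremum (t + 1, \<omega>)))" using exp_supremum_integrable[OF l] t by simp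
    show "AE \<omega> in M. (\<lambda>n. exp (l * X (T n) \<omega>)) \<longlonglongrightarrow> exp (l * X t \<omega>)"
      by (intro AE_I2 tendsto_intros filterlim_compose[OF sn_path_right_cont[OF sn_path_X t] T_right])
    show "AE \<omega> in M. norm (exp (l * X (T n) \<omega>)) \<le> exp (l * supremum (t + 1, \<omega>))" for n
    proof (rule AE_I2)
      fix \<omega> assume \<omega>: "\<omega> \<in> space M"
      have "X (T n) \<omega> \<le> supremum (t + 1, \<omega>)"
        using run_sup_upper[OF sn_path_X[OF \<omega>], of 0 "T n" "t + 1"] T(1,2)[of n] t by (simp add: supremum_def)
      then show "norm (exp (l * X (T n) \<omega>)) \<le> exp (l * supremum (t + 1, \<omega>))" using l by (simp add: mult_left_mono)
    qed
  qed auto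
qed simp

abbreviation \<psi> :: "real \<Rightarrow> real" where "\<psi> \<equiv> levy_psi M X"

lemma exp_moment_eq: "l \<ge> 0 \<Longrightarrow> t \<ge> 0 \<Longrightarrow> exp_moment l t = exp (t * \<psi> l)"
  using multiplicative_right_continuous_exp[of "exp_moment l" t] exp_moment_pos exp_moment_add exp_moment_right_cont
  by (simp add: levy_psi_def exp_moment_def)

lemma nn_exp_mean_exp_psi:
  assumes p: "p > 0" and l: "l \<ge> 0"
  shows "nn_exp_mean p (\<lambda>t. ennreal (exp (\<psi> l * t))) = (\<integral>\<^sup>+z. ennreal (exp (l * position z)) \<partial>exp_time p)"
proof -
  have "(\<integral>\<^sup>+\<omega>. ennreal (exp (l * position (t, \<omega>))) \<partial>M) = ennreal (exp (\<psi> l * t))" if "t \<ge> 0" for t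
    using nn_integral_exp_X[OF l that] exp_moment_eq[OF l that] that by (simp add: position_def mult.commute)
  then have "nn_exp_mean p (\<lambda>t. ennreal (exp (\<psi> l * t))) = nn_exp_mean p (\<lambda>t. \<integral>\<^sup>+\<omega>. ennreal (exp (l * position (t, \<omega>))) \<partial>M)"
    by (intro nn_exp_mean_cong) simp
  also have "\<dots> = (\<integral>\<^sup>+z. ennreal (exp (l * position z)) \<partial>exp_time p)"
    by (rule exp_time_nn_integral[OF p, symmetric]) measurable
  finally show ?thesis .
qed

lemma nn_integral_exp_position:
  assumes p: "p > 0" and l: "l \<ge> 0" "l < sup_rate p"
  shows "(\<integral>\<^sup>+z. ennreal (exp (l * position z)) \<partial>exp_time p) = ennreal (sup_rate p / (sup_rate p - l) * drawdown_laplace p l)"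
proof -
  let ?c = "sup_rate p"
  have "(\<integral>\<^sup>+z. ennreal (exp (l * position z)) \<partial>exp_time p)
      = (\<integral>\<^sup>+z. nn_exp_mean ?c (\<lambda>s. ennreal (exp (l * (s - drawdown z)))) \<partial>exp_time p)"
    using supremum_drawdown_nn_integral[OF p, of "\<lambda>(s, d). ennreal (exp (l * (s - d)))"] by (simp add: position_eq)
  also have "\<dots> = (\<integral>\<^sup>+z. ennreal (exp (- l * drawdown z)) * ennreal (?c / (?c - l)) \<partial>exp_time p)"
  proof (rule nn_integral_cong)
    fix z
    have "exp (l * (s - drawdown z)) = exp (- l * drawdown z) * exp (l * s)" for s
      unfolding exp_add[symmetric] by (simp add: algebra_simps)
    then have "nn_exp_mean ?c (\<lambda>s. ennreal (exp (l * (s - drawdown z)))) =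
        (\<integral>\<^sup>+s. ennreal (exp (- l * drawdown z)) * (ennreal (exponential_density ?c s) * ennreal (exp (l * s))) \<partial>lborel)"
      by (simp only: ennreal_mult exp_ge_zero mult.left_commute)
    then show "nn_exp_mean ?c (\<lambda>s. ennreal (exp (l * (s - drawdown z)))) = ennreal (exp (- l * drawdown z)) * ennreal (?c / (?c - l))"
      by (simp add: nn_integral_cmult nn_exp_mean_exp[OF sup_rate_pos[OF p] l(2)])
  qed
  also have "\<dots> = ennreal (drawdown_laplace p l) * ennreal (?c / (?c - l))"
    using nn_integral_exp_drawdown[OF p l(1)] by (simp add: nn_integral_multc)
  finally show ?thesis using l sup_rate_pos[OF p] drawdown_laplace_pos[OF p l(1)]
    by (simp add: ennreal_mult[symmetric] less_imp_le mult.commute)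
qed

lemma psi_less:
  assumes p: "p > 0" and l: "l \<ge> 0" "l < sup_rate p"
  shows "\<psi> l < p"
proof (rule ccontr)
  assume "\<not> \<psi> l < p"
  then show False
    using nn_exp_mean_exp_infinite[OF p, of "\<psi> l"] nn_exp_mean_exp_psi[OF p l(1)] nn_integral_exp_position[OF assms] by simp
qed

lemma psi_eq_below:
  assumes p: "p > 0" and l: "l \<ge> 0" "l < sup_rate p"
  shows "\<psi> l = p - p * (sup_rate p - l) / (sup_rate p * drawdown_laplace p l)"
proof -
  have pos: "p - \<psi> l > 0" "sup_rate p - l > 0" "sup_rate p > 0" "drawdown_laplace p l > 0"
    using psi_less[OF assms] l sup_rate_pos[OF p] drawdown_laplace_pos[OF p l(1)] by auto
  have "ennreal (p / (p - \<psi> l)) = ennreal (sup_rate p / (sup_rate p - l) * drawdown_laplace p l)"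
    using nn_exp_mean_exp[OF p psi_less[OF assms]] nn_exp_mean_exp_psi[OF p l(1)] nn_integral_exp_position[OF assms] by simp
  then have "p / (p - \<psi> l) = sup_rate p / (sup_rate p - l) * drawdown_laplace p l"
    using pos p by (simp add: ennreal_inj)
  then have "p - \<psi> l = p * (sup_rate p - l) / (sup_rate p * drawdown_laplace p l)"
    using pos by (simp add: field_simps)
  then show ?thesis by simp
qed

lemma psi_tendsto_at_left:
  assumes p: "p > 0" and l: "0 < l" "l \<le> sup_rate p"
  shows "(\<psi> \<longlongrightarrow> p - p * (sup_rate p - l) / (sup_rate p * drawdown_laplace p l)) (at_left l)"
proof -
  have "(drawdown_laplace p \<longlongrightarrow> drawdown_laplace p l) (at_left l)"
    using drawdown_laplace_tendsto[OF p l(1)] by (metis filterlim_at_split)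
  then have "((\<lambda>l. p - p * (sup_rate p - l) / (sup_rate p * drawdown_laplace p l)) \<longlongrightarrow> p - p * (sup_rate p - l) / (sup_rate p * drawdown_laplace p l)) (at_left l)"
    using drawdown_laplace_pos[OF p, of l] l sup_rate_pos[OF p] by (intro tendsto_intros) auto
  moreover have "\<forall>\<^sub>F l' in at_left l. 0 \<le> l' \<and> l' < l"
    using l by (auto simp: eventually_at_left_field intro!: exI[of _ 0])
  then have "\<forall>\<^sub>F l' in at_left l. p - p * (sup_rate p - l') / (sup_rate p * drawdown_laplace p l') = \<psi> l'"
    by eventually_elim (use psi_eq_below[OF p] l in auto)
  ultimately show ?thesis by (rule Lim_transform_eventually)
qed

text \<open>The formula below the rate of a larger killing rate identifies \<open>\<psi>\<close> at the rate of p as its limit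
  from the left, which is p.\<close>

lemma psi_sup_rate: assumes p: "p > 0" shows "\<psi> (sup_rate p) = p"
proof -
  obtain p' where p': "p' > 0" "sup_rate p < sup_rate p'" using sup_rate_unbounded by blast
  have c: "sup_rate p > 0" by (rule sup_rate_pos[OF p])
  have "(\<psi> \<longlongrightarrow> p) (at_left (sup_rate p))" using psi_tendsto_at_left[OF p c order_refl] by simp
  moreover have "(\<psi> \<longlongrightarrow> \<psi> (sup_rate p)) (at_left (sup_rate p))"
    using psi_tendsto_at_left[OF p'(1) c less_imp_le[OF p'(2)]] psi_eq_below[OF p'(1) less_imp_le[OF c] p'(2)] by simp
  ultimately show ?thesis using tendsto_unique[of "at_left (sup_rate p)"] by force
qed

lemma psi_mult_le:
  assumes l: "l \<ge> 0" and r: "0 \<le> r" "r \<le> 1"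
  shows "\<psi> (r * l) \<le> r * \<psi> l"
proof -
  have moments: "expectation (\<lambda>\<omega>. exp (r * l * X 1 \<omega>)) = exp (\<psi> (r * l))" "expectation (\<lambda>\<omega>. exp (l * X 1 \<omega>)) = exp (\<psi> l)"
    using exp_moment_eq[of "r * l" 1] exp_moment_eq[of l 1] assms by (auto simp: exp_moment_def)
  have int: "integrable M (\<lambda>\<omega>. exp (r * l * X 1 \<omega>))" "integrable M (\<lambda>\<omega>. exp (l * X 1 \<omega>))"
    using exp_X_integrable assms by auto
  have "expectation (\<lambda>\<omega>. exp (- r * \<psi> l) * exp (r * l * X 1 \<omega>)) \<le> expectation (\<lambda>\<omega>. r * (exp (- \<psi> l) * exp (l * X 1 \<omega>)) + (1 - r))"
  proof (rule Bochner_Integration.integral_mono)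
    fix \<omega>
    have "exp ((1 - (1 - r)) *\<^sub>R (l * X 1 \<omega> - \<psi> l) + (1 - r) *\<^sub>R 0)
        \<le> (1 - (1 - r)) * exp (l * X 1 \<omega> - \<psi> l) + (1 - r) * exp 0"
      using convex_onD[OF exp_convex, of "1 - r" "l * X 1 \<omega> - \<psi> l" 0] r by auto
    then have "exp (r * (l * X 1 \<omega> - \<psi> l)) \<le> r * exp (l * X 1 \<omega> - \<psi> l) + (1 - r)" by simp
    moreover have "exp (r * (l * X 1 \<omega> - \<psi> l)) = exp (- r * \<psi> l) * exp (r * l * X 1 \<omega>)"
      unfolding exp_add[symmetric] by (simp add: algebra_simps)
    moreover have "exp (l * X 1 \<omega> - \<psi> l) = exp (- \<psi> l) * exp (l * X 1 \<omega>)"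
      unfolding exp_add[symmetric] by (simp add: algebra_simps)
    ultimately show "exp (- r * \<psi> l) * exp (r * l * X 1 \<omega>) \<le> r * (exp (- \<psi> l) * exp (l * X 1 \<omega>)) + (1 - r)" by simp
  qed (use int in auto)
  then have "exp (- r * \<psi> l) * exp (\<psi> (r * l))
      \<le> r * (exp (- \<psi> l) * exp (\<psi> l)) + (1 - r)" using int by (simp add: moments prob_space)
  then have "exp (\<psi> (r * l) - r * \<psi> l) \<le> 1" by (simp add: exp_add[symmetric] algebra_simps)
  then show ?thesis by simp
qed

lemma psi_greater: assumes p: "p > 0" and l: "l > sup_rate p" shows "\<psi> l > p"
proof -
  define r where "r = sup_rate p / l"
  have r: "0 < r" "r < 1" "r * l = sup_rate p" using sup_rate_pos[OF p] l by (auto simp: r_def)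
  have "p \<le> r * \<psi> l" using psi_mult_le[of l r] psi_sup_rate[OF p] sup_rate_pos[OF p] r l by simp
  then have "0 < \<psi> l" using p r(1) by (metis less_le_trans zero_less_mult_pos)
  then have "r * \<psi> l < 1 * \<psi> l" using r by (intro mult_strict_right_mono) auto
  then show ?thesis using \<open>p \<le> r * \<psi> l\<close> by simp
qed

lemma Phi_eq_sup_rate: assumes p: "p > 0" shows "levy_Phi M X p = sup_rate p"
proof -
  have "{l. l \<ge> 0 \<and> \<psi> l = p} = {sup_rate p}"
  proof (intro equalityI subsetI)
    fix l assume "l \<in> {l. l \<ge> 0 \<and> \<psi> l = p}"
    then have "l \<ge> 0" "\<psi> l = p" by auto
    then show "l \<in> {sup_rate p}" using psi_less[OF p, of l] psi_greater[OF p, of l] by force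
  qed (use psi_sup_rate[OF p] sup_rate_pos[OF p] in auto)
  then show ?thesis unfolding levy_Phi_def by simp
qed

lemma sup_rate_psi: assumes "p > 0" "l > sup_rate p" shows "sup_rate (\<psi> l) = l"
proof -
  have pos: "\<psi> l > 0" "l \<ge> 0" using psi_greater[OF assms] assms sup_rate_pos[OF assms(1)] by auto
  show ?thesis using psi_less[OF pos(1), of l] psi_greater[OF pos(1), of l] pos by force
qed

lemma sup_rate_less: assumes "p > 0" "p < q" shows "sup_rate p < sup_rate q"
proof (rule ccontr)
  assume "\<not> sup_rate p < sup_rate q"
  then have "sup_rate q < sup_rate p \<or> sup_rate q = sup_rate p" by auto
  then show False
    using psi_less[of p "sup_rate q"] psi_sup_rate[of p] psi_sup_rate[of q] sup_rate_pos[of q] assms by auto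
qed

end

lemma nn_exp_mean_conv_exp:
  fixes c d v :: real
  assumes c: "c > 0" and cd: "c \<noteq> d" and v: "v \<ge> 0"
  shows "nn_exp_mean c (\<lambda>r. indicator {..v} r * ennreal (exp (- d * (v - r)))) = ennreal (c * (exp (- c * v) - exp (- d * v)) / (d - c))"
proof -
  let ?F = "\<lambda>r. c * exp (- d * v) * exp ((d - c) * r) / (d - c)"
  have "nn_exp_mean c (\<lambda>r. indicator {..v} r * ennreal (exp (- d * (v - r))))
      = (\<integral>\<^sup>+r. ennreal (c * exp (- d * v) * exp ((d - c) * r)) * indicator {0..v} r \<partial>lborel)"
  proof (rule nn_integral_cong)
    fix r
    have "exp (- c * r) * exp (- d * (v - r)) = exp (- d * v) * exp ((d - c) * r)"
      unfolding exp_add[symmetric] by (simp add: algebra_simps)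
    then show "ennreal (exponential_density c r) * (indicator {..v} r * ennreal (exp (- d * (v - r)))) =
        ennreal (c * exp (- d * v) * exp ((d - c) * r)) * indicator {0..v} r"
      using c by (auto simp: exponential_density_eq indicator_def ennreal_mult[symmetric] mult.assoc)
  qed
  also have "\<dots> = ennreal (?F v - ?F 0)"
  proof (rule nn_integral_FTC_Icc[OF _ _ _ v])
    fix r
    have "((\<lambda>r. (c * exp (- d * v) / (d - c)) * exp ((d - c) * r)) has_real_derivative
        (c * exp (- d * v) / (d - c)) * (exp ((d - c) * r) * (d - c))) (at r)"
      by (auto intro!: derivative_eq_intros)
    then show "(?F has_real_derivative c * exp (- d * v) * exp ((d - c) * r)) (at r)"
      using cd by (simp add: mult.assoc)
  qed (use c in auto)
  also have "?F v - ?F 0 = c * (exp (- c * v) - exp (- d * v)) / (d - c)"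
  proof -
    have "exp (- d * v) * exp ((d - c) * v) = exp (- c * v)"
      unfolding exp_add[symmetric] by (simp add: algebra_simps)
    then show ?thesis by (simp add: diff_divide_distrib[symmetric] right_diff_distrib mult.assoc)
  qed
  finally show ?thesis .
qed

text \<open>An exponential time with rate p has the law of one with rate q to which, with probability
  \<open>(q - p) / q\<close>, an independent exponential time with rate p is added.\<close>

lemma exponential_density_mixture:
  assumes p: "p > 0" and pq: "p < q"
  shows "ennreal (q - p) * nn_exp_mean p (\<lambda>r. ennreal (exponential_density q (v - r))) + ennreal p * ennreal (exponential_density q v)
    = ennreal q * ennreal (exponential_density p v)"
proof (cases "v < 0")
  case True
  have "nn_exp_mean p (\<lambda>r. ennreal (exponential_density q (v - r))) = nn_exp_mean p (\<lambda>r. 0)"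
    by (rule nn_exp_mean_cong) (use True in \<open>simp add: exponential_density_eq\<close>)
  then show ?thesis using True by (simp add: exponential_density_eq)
next
  case False
  have q: "q > 0" using p pq by simp
  let ?e = "exp (- p * v) - exp (- q * v)"
  have e: "0 \<le> ?e" using pq False by (auto intro: mult_right_mono)
  have "nn_exp_mean p (\<lambda>r. ennreal (exponential_density q (v - r))) =
      (\<integral>\<^sup>+r. ennreal q * (ennreal (exponential_density p r) * (indicator {..v} r * ennreal (exp (- q * (v - r))))) \<partial>lborel)"
    using q by (intro nn_integral_cong) (auto simp: exponential_density_eq[of q] indicator_def ennreal_mult mult_ac)
  also have "\<dots> = ennreal q * ennreal (p * ?e / (q - p))"
    using nn_exp_mean_conv_exp[OF p, of q v] pq False by (simp add: nn_integral_cmult)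
  finally have "ennreal (q - p) * nn_exp_mean p (\<lambda>r. ennreal (exponential_density q (v - r))) + ennreal p * ennreal (exponential_density q v)
      = ennreal ((q - p) * (q * (p * ?e / (q - p))) + p * (q * exp (- q * v)))"
    using p q pq e False by (simp add: exponential_density_eq ennreal_mult'[symmetric] ennreal_plus[symmetric] del: ennreal_plus)
  also have "(q - p) * (q * (p * ?e / (q - p))) + p * (q * exp (- q * v)) = q * (p * exp (- p * v))"
    using pq by (simp add: field_simps)
  finally show ?thesis using False p q by (simp add: exponential_density_eq ennreal_mult)
qed

lemma nn_exp_mean_mixture:
  assumes p: "p > 0" and pq: "p < q" and [measurable]: "h \<in> borel_measurable borel"
  shows "ennreal (q - p) * nn_exp_mean p (\<lambda>r. nn_exp_mean q (\<lambda>t. h (r + t))) + ennreal p * nn_exp_mean q h = ennreal q * nn_exp_mean p h"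
proof -
  have "nn_exp_mean q (\<lambda>t. h (r + t)) = (\<integral>\<^sup>+v. ennreal (exponential_density q (v - r)) * h v \<partial>lborel)" for r
    by (subst nn_integral_real_affine[where c=1 and t="-r"]) auto
  then have "nn_exp_mean p (\<lambda>r. nn_exp_mean q (\<lambda>t. h (r + t))) =
      (\<integral>\<^sup>+r. (\<integral>\<^sup>+v. ennreal (exponential_density p r) * ennreal (exponential_density q (v - r)) * h v \<partial>lborel) \<partial>lborel)"
    by (simp add: nn_integral_cmult mult.assoc)
  also have "\<dots> = (\<integral>\<^sup>+v. (\<integral>\<^sup>+r. ennreal (exponential_density p r) * ennreal (exponential_density q (v - r)) * h v \<partial>lborel) \<partial>lborel)"
    by (rule lborel_pair.Fubini') measurable
  also have "\<dots> = (\<integral>\<^sup>+v. nn_exp_mean p (\<lambda>r. ennreal (exponential_density q (v - r))) * h v \<partial>lborel)"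
    by (simp add: nn_integral_multc)
  finally have "ennreal (q - p) * nn_exp_mean p (\<lambda>r. nn_exp_mean q (\<lambda>t. h (r + t))) + ennreal p * nn_exp_mean q h =
      (\<integral>\<^sup>+v. (ennreal (q - p) * nn_exp_mean p (\<lambda>r. ennreal (exponential_density q (v - r))) + ennreal p * ennreal (exponential_density q v)) * h v \<partial>lborel)"
    by (simp add: nn_integral_add nn_integral_cmult distrib_right mult.assoc)
  also have "\<dots> = (\<integral>\<^sup>+v. ennreal q * ennreal (exponential_density p v) * h v \<partial>lborel)"
    by (simp only: exponential_density_mixture[OF p pq])
  finally show ?thesis by (simp add: nn_integral_cmult mult.assoc)
qed

context sn_levy
begin

lemma nn_integral_supremum_greater:
  assumes p: "p > 0" and v: "v \<ge> 0"
  shows "(\<integral>\<^sup>+z. indicator {v<..} (supremum z) \<partial>exp_time p) = ennreal (exp (- sup_rate p * v))"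
proof -
  interpret N: prob_space "exp_time p" by (rule prob_space_exp_time[OF p])
  have "(\<integral>\<^sup>+z. ennreal (indicator {v<..} (supremum z)) \<partial>exp_time p) = ennreal (sup_tail p v)"
    unfolding sup_tail_def by (rule nn_integral_eq_integral) (auto intro!: N.integrable_const_bound[where B=1])
  then show ?thesis using sup_tail_eq[OF p v] by (simp add: ennreal_indicator)
qed

lemma supremum_greater_restart:
  assumes "r \<ge> 0" "t \<ge> 0"
  shows "(\<integral>\<^sup>+\<omega>. indicator {y<..} (supremum (r + t, \<omega>)) \<partial>M) =
    (\<integral>\<^sup>+\<omega>. (\<integral>\<^sup>+\<omega>'. indicator {y<..} (max (supremum (r, \<omega>)) (position (r, \<omega>) + supremum (t, \<omega>'))) \<partial>M) \<partial>M)"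
proof -
  let ?F = "\<lambda>w. indicator {y<..} (path_sup w 0 (r + t)) :: ennreal"
  have "(\<integral>\<^sup>+\<omega>. indicator {y<..} (supremum (r + t, \<omega>)) \<partial>M) = (\<integral>\<^sup>+\<omega>. ?F (sample \<omega>) \<partial>M)"
    by (rule nn_integral_cong) (use assms in \<open>simp add: path_sup_sample supremum_def\<close>)
  also have "\<dots> = (\<integral>\<^sup>+\<omega>. \<integral>\<^sup>+\<omega>'. ?F (restarted r (\<omega>, \<omega>')) \<partial>M \<partial>M)"
    by (rule markov_nn_integral) (use assms in auto)
  also have "\<dots> = (\<integral>\<^sup>+\<omega>. (\<integral>\<^sup>+\<omega>'. indicator {y<..} (max (supremum (r, \<omega>)) (position (r, \<omega>) + supremum (t, \<omega>'))) \<partial>M) \<partial>M)"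
    by (intro nn_integral_cong) (use assms in \<open>simp add: path_sup_restarted(3)\<close>)
  finally show ?thesis .
qed

lemma nn_exp_mean_supremum_greater_restart:
  assumes q: "q > 0" and \<omega>: "\<omega> \<in> space M"
  shows "nn_exp_mean q (\<lambda>t. \<integral>\<^sup>+\<omega>'. indicator {y<..} (max (supremum (r, \<omega>)) (position (r, \<omega>) + supremum (t, \<omega>'))) \<partial>M) =
    indicator {y<..} (supremum (r, \<omega>)) + indicator {..y} (supremum (r, \<omega>)) * ennreal (exp (- sup_rate q * (y - position (r, \<omega>))))"
proof -
  interpret N: prob_space "exp_time q" by (rule prob_space_exp_time[OF q])
  have "nn_exp_mean q (\<lambda>t. \<integral>\<^sup>+\<omega>'. indicator {y<..} (max (supremum (r, \<omega>)) (position (r, \<omega>) + supremum (t, \<omega>'))) \<partial>M)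
      = (\<integral>\<^sup>+z. indicator {y<..} (max (supremum (r, \<omega>)) (position (r, \<omega>) + supremum z)) \<partial>exp_time q)"
    by (subst exp_time_nn_integral[OF q]) auto
  also have "\<dots> = indicator {y<..} (supremum (r, \<omega>)) + indicator {..y} (supremum (r, \<omega>)) * ennreal (exp (- sup_rate q * (y - position (r, \<omega>))))"
  proof (cases "supremum (r, \<omega>) > y")
    case True
    then show ?thesis by (simp add: less_max_iff_disj N.emeasure_space_1)
  next
    case False
    have "0 \<le> y - position (r, \<omega>)" using False position_le_supremum[OF \<omega>, of r] by simp
    from nn_integral_supremum_greater[OF q this]
    have "(\<integral>\<^sup>+z. indicator {y - position (r, \<omega>)<..} (supremum z) \<partial>exp_time q)
        = ennreal (exp (- sup_rate q * (y - position (r, \<omega>))))" .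
    moreover have "indicator {y<..} (max (supremum (r, \<omega>)) (position (r, \<omega>) + s))
        = (indicator {y - position (r, \<omega>)<..} s :: ennreal)" for s
      using False by (auto simp: indicator_def)
    ultimately show ?thesis using False by simp
  qed
  finally show ?thesis .
qed

lemma nn_integral_crossing_after_restart:
  assumes p: "p > 0" and d: "d > sup_rate p"
  shows "(\<integral>\<^sup>+z. indicator {1<..} (supremum z) + indicator {..1} (supremum z) * ennreal (exp (- d * (1 - position z))) \<partial>exp_time p) =
    ennreal (exp (- sup_rate p) + sup_rate p * (exp (- sup_rate p) - exp (- d)) / (d - sup_rate p) * drawdown_laplace p d)"
proof -
  let ?c = "sup_rate p"
  have c: "?c > 0" by (rule sup_rate_pos[OF p])
  let ?K = "?c * (exp (- ?c) - exp (- d)) / (d - ?c)"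
  have K: "?K \<ge> 0" using c d by simp
  have inner: "nn_exp_mean ?c (\<lambda>s. indicator {..1} s * ennreal (exp (- d * (1 - (s - \<delta>))))) = ennreal (exp (- d * \<delta>)) * ennreal ?K" for \<delta>
  proof -
    have "exp (- d * (1 - (s - \<delta>))) = exp (- d * \<delta>) * exp (- d * (1 - s))" for s
      unfolding exp_add[symmetric] by (simp add: algebra_simps)
    then have "nn_exp_mean ?c (\<lambda>s. indicator {..1} s * ennreal (exp (- d * (1 - (s - \<delta>))))) =
        (\<integral>\<^sup>+s. ennreal (exp (- d * \<delta>)) * (ennreal (exponential_density ?c s) * (indicator {..1} s * ennreal (exp (- d * (1 - s))))) \<partial>lborel)"
      by (simp only: ennreal_mult exp_ge_zero mult.left_commute)
    then show ?thesis using nn_exp_mean_conv_exp[OF c, of d 1] d by (simp add: nn_integral_cmult)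
  qed
  have "(\<integral>\<^sup>+z. indicator {..1} (supremum z) * ennreal (exp (- d * (1 - position z))) \<partial>exp_time p) =
      (\<integral>\<^sup>+z. nn_exp_mean ?c (\<lambda>s. indicator {..1} s * ennreal (exp (- d * (1 - (s - drawdown z))))) \<partial>exp_time p)"
    using supremum_drawdown_nn_integral[OF p, of "\<lambda>(s, \<delta>). indicator {..1} s * ennreal (exp (- d * (1 - (s - \<delta>))))"]
    by (simp add: position_eq)
  also have "\<dots> = (\<integral>\<^sup>+z. ennreal (exp (- d * drawdown z)) * ennreal ?K \<partial>exp_time p)" by (simp only: inner)
  also have "\<dots> = ennreal (drawdown_laplace p d) * ennreal ?K"
    using nn_integral_exp_drawdown[OF p, of d] c d by (simp add: nn_integral_multc)
  finally have "(\<integral>\<^sup>+z. indicator {..1} (supremum z) * ennreal (exp (- d * (1 - position z))) \<partial>exp_time p)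
      = ennreal (?K * drawdown_laplace p d)"
    by (simp only: ennreal_mult'[OF K] mult.commute[of "ennreal ?K"])
  moreover have "0 \<le> ?K * drawdown_laplace p d"
    using K drawdown_laplace_pos[OF p, of d] c d by (intro mult_nonneg_nonneg) auto
  ultimately show ?thesis
    using nn_integral_supremum_greater[OF p, of 1] by (simp add: nn_integral_add ennreal_plus[symmetric] del: ennreal_plus)
qed

text \<open>The tail of the supremum at an exponential time with rate p is computed by splitting this time
  as in \<open>nn_exp_mean_mixture\<close> and applying the Markov property at the split.\<close>

lemma nn_exp_mean_supremum_greater_split:
  assumes p: "p > 0" and q: "q > 0" and less: "sup_rate p < sup_rate q"
  shows "nn_exp_mean p (\<lambda>r. nn_exp_mean q (\<lambda>t. \<integral>\<^sup>+\<omega>. indicator {1<..} (supremum (r + t, \<omega>)) \<partial>M)) =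
    ennreal (exp (- sup_rate p) + sup_rate p * (exp (- sup_rate p) - exp (- sup_rate q)) / (sup_rate q - sup_rate p) * drawdown_laplace p (sup_rate q))"
proof -
  have "nn_exp_mean p (\<lambda>r. nn_exp_mean q (\<lambda>t. \<integral>\<^sup>+\<omega>. indicator {1<..} (supremum (r + t, \<omega>)) \<partial>M)) = nn_exp_mean p (\<lambda>r. nn_exp_mean q (\<lambda>t.
      \<integral>\<^sup>+\<omega>. (\<integral>\<^sup>+\<omega>'. indicator {1<..} (max (supremum (r, \<omega>)) (position (r, \<omega>) + supremum (t, \<omega>'))) \<partial>M) \<partial>M))"
    by (intro nn_exp_mean_cong supremum_greater_restart)
  also have "\<dots> = nn_exp_mean p (\<lambda>r. \<integral>\<^sup>+\<omega>. nn_exp_mean q (\<lambda>t.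
      \<integral>\<^sup>+\<omega>'. indicator {1<..} (max (supremum (r, \<omega>)) (position (r, \<omega>) + supremum (t, \<omega>'))) \<partial>M) \<partial>M)"
    by (intro nn_exp_mean_cong nn_exp_mean_nn_integral_swap[where f="\<lambda>(t, \<omega>). \<integral>\<^sup>+\<omega>'. indicator {1<..} (max (supremum (_, \<omega>)) (position (_, \<omega>) + supremum (t, \<omega>'))) \<partial>M", unfolded prod.case]) measurable
  also have "\<dots> = nn_exp_mean p (\<lambda>r. \<integral>\<^sup>+\<omega>. indicator {1<..} (supremum (r, \<omega>)) +
      indicator {..1} (supremum (r, \<omega>)) * ennreal (exp (- sup_rate q * (1 - position (r, \<omega>)))) \<partial>M)"
    by (intro nn_exp_mean_cong nn_integral_cong nn_exp_mean_supremum_greater_restart[OF q])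
  also have "\<dots> = (\<integral>\<^sup>+z. indicator {1<..} (supremum z) + indicator {..1} (supremum z) * ennreal (exp (- sup_rate q * (1 - position z))) \<partial>exp_time p)"
    by (rule exp_time_nn_integral[OF p, symmetric]) measurable
  finally show ?thesis by (simp only: nn_integral_crossing_after_restart[OF p less])
qed

lemma drawdown_laplace_sup_rate:
  assumes p: "p > 0" and pq: "p < q"
  shows "drawdown_laplace p (sup_rate q) = p * (sup_rate q - sup_rate p) / (sup_rate p * (q - p))"
proof -
  let ?c = "sup_rate p" and ?d = "sup_rate q"
  have q: "q > 0" using p pq by simp
  have c: "?c > 0" and cd: "?c < ?d" using sup_rate_pos[OF p] sup_rate_less[OF assms] by auto
  define h where "h v = (\<integral>\<^sup>+\<omega>. indicator {1<..} (supremum (v, \<omega>)) \<partial>M)" for v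
  have [measurable]: "h \<in> borel_measurable borel" unfolding h_def by measurable
  have nn_exp_mean_h: "nn_exp_mean r h = ennreal (exp (- sup_rate r))" if "r > 0" for r
    using exp_time_nn_integral[OF that, of "\<lambda>z. indicator {1<..} (supremum z)"] nn_integral_supremum_greater[OF that, of 1]
    by (simp add: h_def)
  define I where "I = exp (- ?c) + ?c * (exp (- ?c) - exp (- ?d)) / (?d - ?c) * drawdown_laplace p ?d"
  have I: "I \<ge> 0" unfolding I_def using c cd drawdown_laplace_pos[OF p, of ?d]
    by (intro add_nonneg_nonneg mult_nonneg_nonneg divide_nonneg_nonneg) auto
  have "nn_exp_mean p (\<lambda>r. nn_exp_mean q (\<lambda>t. h (r + t))) = ennreal I"
    unfolding h_def I_def by (rule nn_exp_mean_supremum_greater_split[OF p q cd])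
  then have "ennreal (q - p) * ennreal I + ennreal p * ennreal (exp (- ?d)) = ennreal q * ennreal (exp (- ?c))"
    using nn_exp_mean_mixture[OF p pq, of h] by (simp add: nn_exp_mean_h p q)
  then have "ennreal ((q - p) * I + p * exp (- ?d)) = ennreal (q * exp (- ?c))"
    using pq p q I by (simp add: ennreal_mult[symmetric] ennreal_plus[symmetric] del: ennreal_plus)
  then have "(q - p) * I + p * exp (- ?d) = q * exp (- ?c)"
    using p pq I q by (subst (asm) ennreal_inj) auto
  moreover define E where "E = exp (- ?c) - exp (- ?d)"
  ultimately have "(q - p) * (exp (- ?c) + ?c * E / (?d - ?c) * drawdown_laplace p ?d) + p * (exp (- ?c) - E) = q * exp (- ?c)"
    unfolding I_def by simp
  then have "(q - p) * (?c * E / (?d - ?c) * drawdown_laplace p ?d)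
      = p * E" by (simp only: distrib_left right_diff_distrib left_diff_distrib)
  moreover have E: "E > 0" using cd by (simp add: E_def)
  ultimately have "(q - p) * ?c * drawdown_laplace p ?d * E = p * (?d - ?c) * E" using cd by (simp add: field_simps)
  then have "(q - p) * ?c * drawdown_laplace p ?d = p * (?d - ?c)" using E by simp
  then show ?thesis using pq c by (simp add: field_simps)
qed

lemma psi_difference_quotient:
  assumes p: "p > 0" and l: "l \<ge> 0" "l \<noteq> sup_rate p"
  shows "(\<psi> l - p) / (l - sup_rate p) = p / (sup_rate p * drawdown_laplace p l)"
proof (cases "l < sup_rate p")
  case True
  have "\<psi> l - p = - (p * (sup_rate p - l) / (sup_rate p * drawdown_laplace p l))" using psi_eq_below[OF p l(1) True] by simp
  also have "\<dots> = p / (sup_rate p * drawdown_laplace p l) * (l - sup_rate p)"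
    by (simp add: right_diff_distrib diff_divide_distrib)
  finally show ?thesis using l by simp
next
  case False
  then have above: "l > sup_rate p" using l by simp
  have "drawdown_laplace p l = p * (l - sup_rate p) / (sup_rate p * (\<psi> l - p))"
    using drawdown_laplace_sup_rate[OF p psi_greater[OF p above]] sup_rate_psi[OF p above] by simp
  then have "sup_rate p * drawdown_laplace p l = p * (l - sup_rate p) / (\<psi> l - p)" using sup_rate_pos[OF p] by simp
  then show ?thesis using p by simp
qed

lemma deriv_psi:
  assumes p: "p > 0"
  shows "deriv \<psi> (sup_rate p) = p / (sup_rate p * drawdown_laplace p (sup_rate p))"
proof (rule DERIV_imp_deriv)
  let ?c = "sup_rate p"
  have c: "?c > 0" by (rule sup_rate_pos[OF p])
  have "((\<lambda>l. p / (?c * drawdown_laplace p l)) \<longlongrightarrow> p / (?c * drawdown_laplace p ?c)) (at ?c)"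
    using c drawdown_laplace_pos[OF p, of ?c] by (intro tendsto_intros drawdown_laplace_tendsto[OF p c]) auto
  moreover have "\<forall>\<^sub>F l in at ?c. l > 0" using order_tendstoD(1)[OF tendsto_ident_at c] .
  then have "\<forall>\<^sub>F l in at ?c. p / (?c * drawdown_laplace p l) = (\<psi> l - \<psi> ?c) / (l - ?c)"
    using eventually_neq_at_within[of ?c]
    by eventually_elim (use psi_difference_quotient[OF p] psi_sup_rate[OF p] in auto)
  ultimately show "(\<psi> has_field_derivative p / (?c * drawdown_laplace p ?c)) (at ?c)"
    unfolding has_field_derivative_iff by (rule Lim_transform_eventually)
qed

end

section \<open>The scale function and the resolvent density\<close>

lemma indicator_atMost_tendsto:
  fixes d x :: real
  assumes f: "f \<longlonglongrightarrow> x" and d: "d = x \<Longrightarrow> (\<And>n. d \<le> f n)"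
  shows "(\<lambda>n. indicator {..f n} d :: real) \<longlonglongrightarrow> indicator {..x} d"
proof -
  consider "d < x" | "d > x" | "d = x" by linarith
  then have "\<forall>\<^sub>F n in sequentially. indicator {..x} d = (indicator {..f n} d :: real)"
  proof cases
    case 1
    show ?thesis using order_tendstoD(1)[OF f 1] by eventually_elim (use 1 in \<open>auto simp: indicator_def\<close>)
  next
    case 2
    show ?thesis using order_tendstoD(2)[OF f 2] by eventually_elim (use 2 in \<open>auto simp: indicator_def\<close>)
  next
    case 3
    then show ?thesis using d[OF 3] by simp
  qed
  then show ?thesis by (rule Lim_transform_eventually[OF tendsto_const])
qed

lemma nn_integral_exp_from:
  fixes c d l :: real
  assumes "c < l"
  shows "(\<integral>\<^sup>+y. ennreal (exp (- l * y)) * (ennreal (exp (c * (y - d))) * indicator {d..} y) \<partial>lborel)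
      = ennreal (exp (- l * d) / (l - c))"
proof -
  have "ennreal (exp (- l * (d + u))) * (ennreal (exp (c * (d + u - d))) * indicator {d..} (d + u))
      = ennreal (exp (- l * d) / (l - c)) * ennreal (exponential_density (l - c) u)" for u
  proof -
    have "exp (- l * (d + u)) * exp (c * u) = exp (- l * d) * exp (- (l - c) * u)"
      unfolding exp_add[symmetric] by (simp add: algebra_simps)
    then show ?thesis using assms by (simp add: exponential_density_eq indicator_def ennreal_mult'[symmetric])
  qed
  then have "(\<integral>\<^sup>+y. ennreal (exp (- l * y)) * (ennreal (exp (c * (y - d))) * indicator {d..} y) \<partial>lborel)
      = (\<integral>\<^sup>+u. ennreal (exp (- l * d) / (l - c)) * ennreal (exponential_density (l - c) u) \<partial>lborel)"
    by (subst nn_integral_real_affine[where c=1 and t=d]) auto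
  also have "\<dots> = ennreal (exp (- l * d) / (l - c))"
    using nn_exp_mean_one[of "l - c"] assms by (simp add: nn_integral_cmult)
  finally show ?thesis .
qed

context sn_levy
begin

definition tilted_drawdown :: "real \<Rightarrow> real set \<Rightarrow> real" where
  "tilted_drawdown p A = (\<integral>z. exp (- sup_rate p * drawdown z) * indicator A (drawdown z) \<partial>exp_time p)"

text \<open>At the exponential time, the position is the supremum minus the drawdown, the supremum being
  exponential and independent of the drawdown: \<open>p * resolvent_density p\<close> is the resulting density.\<close>

definition resolvent_density :: "real \<Rightarrow> real \<Rightarrow> real" where
  "resolvent_density p y = sup_rate p / p * exp (- sup_rate p * y) * tilted_drawdown p {- y..}"

definition scale :: "real \<Rightarrow> real \<Rightarrow> real" where
  "scale p x = sup_rate p / p * exp (sup_rate p * x) * tilted_drawdown p {..x}"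

lemma exp_sup_rate_drawdown_le: "p > 0 \<Longrightarrow> z \<in> space (exp_time p) \<Longrightarrow> exp (- sup_rate p * drawdown z) \<le> 1"
  by (rule exp_drawdown_le[OF less_imp_le[OF sup_rate_pos]])

lemma tilted_drawdown_integrable:
  assumes p: "p > 0" and [measurable]: "A \<in> sets borel"
  shows "integrable (exp_time p) (\<lambda>z. exp (- sup_rate p * drawdown z) * indicator A (drawdown z))"
  by (rule exp_time_integrable[OF p, where B=1])
     (use exp_sup_rate_drawdown_le[OF p] in \<open>auto simp: indicator_def\<close>)

lemma nn_integral_tilted_drawdown:
  assumes p: "p > 0" and A: "A \<in> sets borel"
  shows "(\<integral>\<^sup>+z. ennreal (exp (- sup_rate p * drawdown z) * indicator A (drawdown z)) \<partial>exp_time p)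
      = ennreal (tilted_drawdown p A)"
  unfolding tilted_drawdown_def by (rule nn_integral_eq_integral[OF tilted_drawdown_integrable[OF p A]]) auto

lemma tilted_drawdown_nonneg: "0 \<le> tilted_drawdown p A"
  unfolding tilted_drawdown_def by (intro Bochner_Integration.integral_nonneg) auto

lemma tilted_drawdown_atMost_neg: assumes "x < 0" shows "tilted_drawdown p {..x} = 0"
proof -
  have "tilted_drawdown p {..x} = (\<integral>z. 0 \<partial>exp_time p)"
    unfolding tilted_drawdown_def
  proof (rule Bochner_Integration.integral_cong[OF refl])
    fix z assume "z \<in> space (exp_time p)"
    then have "0 \<le> drawdown z" using drawdown_nonneg by (auto simp: space_exp_time)
    then show "exp (- sup_rate p * drawdown z) * indicator {..x} (drawdown z) = 0" using assms by simp
  qed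
  then show ?thesis by simp
qed

lemma resolvent_density_nonneg: "p > 0 \<Longrightarrow> 0 \<le> resolvent_density p y"
  unfolding resolvent_density_def using sup_rate_pos[of p] tilted_drawdown_nonneg[of p] by simp

lemma scale_nonneg: "p > 0 \<Longrightarrow> 0 \<le> scale p x"
  unfolding scale_def using sup_rate_pos[of p] tilted_drawdown_nonneg[of p] by simp

lemma scale_neg: "x < 0 \<Longrightarrow> scale p x = 0"
  by (simp add: scale_def tilted_drawdown_atMost_neg)

lemma resolvent_density_measurable [measurable]: assumes "p > 0" shows "resolvent_density p \<in> borel_measurable borel"
proof -
  interpret N: prob_space "exp_time p" by (rule prob_space_exp_time[OF assms])
  have "(\<lambda>y. \<integral>z. exp (- sup_rate p * drawdown z) * (if - y \<le> drawdown z then 1 else 0) \<partial>exp_time p) \<in> borel_measurable borel"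
    by measurable
  then show ?thesis unfolding resolvent_density_def tilted_drawdown_def by (simp add: indicator_def)
qed

lemma scale_measurable [measurable]: assumes "p > 0" shows "scale p \<in> borel_measurable borel"
proof -
  interpret N: prob_space "exp_time p" by (rule prob_space_exp_time[OF assms])
  have "(\<lambda>x. \<integral>z. exp (- sup_rate p * drawdown z) * (if drawdown z \<le> x then 1 else 0) \<partial>exp_time p) \<in> borel_measurable borel"
    by measurable
  then show ?thesis unfolding scale_def tilted_drawdown_def by (simp add: indicator_def)
qed

lemma nn_integral_exponential_density_drawdown:
  assumes p: "p > 0"
  shows "(\<integral>\<^sup>+z. ennreal (exponential_density (sup_rate p) (y + drawdown z)) \<partial>exp_time p)
      = ennreal (p * resolvent_density p y)"
proof -
  let ?c = "sup_rate p"
  have "(\<integral>\<^sup>+z. ennreal (exponential_density ?c (y + drawdown z)) \<partial>exp_time p)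
      = (\<integral>\<^sup>+z. ennreal (?c * exp (- ?c * y)) * ennreal (exp (- ?c * drawdown z) * indicator {- y..} (drawdown z)) \<partial>exp_time p)"
    using sup_rate_pos[OF p]
    by (intro nn_integral_cong)
       (auto simp: exponential_density_eq indicator_def exp_add[symmetric] ennreal_mult'[symmetric] algebra_simps)
  also have "\<dots> = ennreal (?c * exp (- ?c * y)) * ennreal (tilted_drawdown p {- y..})"
    using nn_integral_tilted_drawdown[OF p, of "{- y..}"] by (simp add: nn_integral_cmult)
  also have "\<dots> = ennreal (p * resolvent_density p y)"
    using p sup_rate_pos[OF p] by (simp add: resolvent_density_def ennreal_mult'[symmetric])
  finally show ?thesis .
qed

lemma position_nn_integral:
  assumes p: "p > 0" and [measurable]: "f \<in> borel_measurable borel"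
  shows "(\<integral>\<^sup>+z. f (position z) \<partial>exp_time p) = (\<integral>\<^sup>+y. ennreal (p * resolvent_density p y) * f y \<partial>lborel)"
proof -
  interpret N: prob_space "exp_time p" by (rule prob_space_exp_time[OF p])
  interpret NL: pair_sigma_finite "exp_time p" lborel ..
  let ?c = "sup_rate p"
  have "(\<integral>\<^sup>+z. f (position z) \<partial>exp_time p) = (\<integral>\<^sup>+z. nn_exp_mean ?c (\<lambda>s. f (s - drawdown z)) \<partial>exp_time p)"
    using supremum_drawdown_nn_integral[OF p, of "\<lambda>(s, d). f (s - d)"] by (simp add: position_eq)
  also have "\<dots> = (\<integral>\<^sup>+z. (\<integral>\<^sup>+y. ennreal (exponential_density ?c (y + drawdown z)) * f y \<partial>lborel) \<partial>exp_time p)"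
  proof (rule nn_integral_cong)
    show "nn_exp_mean ?c (\<lambda>s. f (s - drawdown z)) = (\<integral>\<^sup>+y. ennreal (exponential_density ?c (y + drawdown z)) * f y \<partial>lborel)" for z
      by (subst nn_integral_real_affine[where c=1 and t="drawdown z"]) (auto simp: add.commute)
  qed
  also have "\<dots> = (\<integral>\<^sup>+y. (\<integral>\<^sup>+z. ennreal (exponential_density ?c (y + drawdown z)) * f y \<partial>exp_time p) \<partial>lborel)"
    by (rule NL.Fubini'[symmetric]) measurable
  also have "\<dots> = (\<integral>\<^sup>+y. ennreal (p * resolvent_density p y) * f y \<partial>lborel)"
    by (simp add: nn_integral_multc nn_integral_exponential_density_drawdown[OF p])
  finally show ?thesis .
qed

lemma position_distr:
  assumes p: "p > 0"
  shows "distr (exp_time p) borel position = density lborel (\<lambda>y. ennreal (p * resolvent_density p y))"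
proof (rule measure_eqI)
  fix A assume "A \<in> sets (distr (exp_time p) borel position)"
  then have [measurable]: "A \<in> sets borel" by simp
  have [measurable]: "resolvent_density p \<in> borel_measurable borel" by (rule resolvent_density_measurable[OF p])
  have "emeasure (distr (exp_time p) borel position) A = (\<integral>\<^sup>+y. indicator A y \<partial>distr (exp_time p) borel position)" by simp
  also have "\<dots> = (\<integral>\<^sup>+z. indicator A (position z) \<partial>exp_time p)" by (rule nn_integral_distr) measurable
  also have "\<dots> = (\<integral>\<^sup>+y. ennreal (p * resolvent_density p y) * indicator A y \<partial>lborel)" by (rule position_nn_integral[OF p]) measurable
  finally show "emeasure (distr (exp_time p) borel position) A
      = emeasure (density lborel (\<lambda>y. ennreal (p * resolvent_density p y))) A"
    by (simp add: emeasure_density)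
qed simp

lemma position_integral:
  assumes p: "p > 0" and [measurable]: "f \<in> borel_measurable borel"
  shows "(\<integral>z. f (x + position z) \<partial>exp_time p) = p * (\<integral>y. resolvent_density p (y - x) * f y \<partial>lborel)"
proof -
  have [measurable]: "resolvent_density p \<in> borel_measurable borel" by (rule resolvent_density_measurable[OF p])
  have "(\<integral>z. f (x + position z) \<partial>exp_time p) = (\<integral>y. f (x + y) \<partial>distr (exp_time p) borel position)"
    by (subst integral_distr) auto
  also have "\<dots> = (\<integral>y. p * resolvent_density p y * f (x + y) \<partial>lborel)"
    unfolding position_distr[OF p] using resolvent_density_nonneg[OF p] p by (subst integral_real_density) auto
  also have "\<dots> = (\<integral>y. p * resolvent_density p (y - x) * f y \<partial>lborel)"
    by (subst lborel_integral_real_affine[where c=1 and t="-x"]) auto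
  finally show ?thesis by (simp add: mult.assoc)
qed

lemma position_no_atom: assumes p: "p > 0" shows "(\<integral>\<^sup>+z. indicator {a} (position z) \<partial>exp_time p) = 0"
proof -
  have "(\<integral>\<^sup>+z. indicator {a} (position z) \<partial>exp_time p)
      = (\<integral>\<^sup>+y. ennreal (p * resolvent_density p y) * indicator {a} y \<partial>lborel)"
    by (rule position_nn_integral[OF p]) simp
  also have "\<dots> = 0"
    using resolvent_density_measurable[OF p] by (subst nn_integral_0_iff_AE) (use AE_lborel_singleton[of a] in \<open>auto elim: eventually_mono\<close>)
  finally show ?thesis .
qed

text \<open>Apart from countably many times t, a drawdown of d at time t means that \<open>X_t = S_r - d\<close> for some
  rational r < t, where S is the supremum, and by the Markov property at r this only happens on a null
  set of times.\<close>

lemma AE_position_neq_past_supremum_minus: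
  assumes r: "r \<ge> 0"
  shows "AE \<omega> in M. AE t in lborel. r \<le> t \<longrightarrow> position (t, \<omega>) \<noteq> supremum (r, \<omega>) - d"
proof -
  let ?F = "\<lambda>w. nn_exp_mean 1 (\<lambda>u. indicator {0} (path_eval w (r + u) - (path_sup w 0 r - d)))"
  have "(\<integral>\<^sup>+\<omega>. ?F (sample \<omega>) \<partial>M) = (\<integral>\<^sup>+\<omega>. \<integral>\<^sup>+\<omega>'. ?F (restarted r (\<omega>, \<omega>')) \<partial>M \<partial>M)"
    by (rule markov_nn_integral[OF _ r]) measurable
  also have "\<dots> = (\<integral>\<^sup>+\<omega>. \<integral>\<^sup>+\<omega>'. nn_exp_mean 1 (\<lambda>u. indicator {supremum (r, \<omega>) - d - position (r, \<omega>)} (position (u, \<omega>'))) \<partial>M \<partial>M)"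
    by (intro nn_integral_cong nn_exp_mean_cong)
       (use r in \<open>auto simp: path_eval_restarted(2) path_sup_restarted(1) indicator_def\<close>)
  also have "\<dots> = (\<integral>\<^sup>+\<omega>. (\<integral>\<^sup>+z. indicator {supremum (r, \<omega>) - d - position (r, \<omega>)} (position z) \<partial>exp_time 1) \<partial>M)"
  proof (rule nn_integral_cong)
    fix \<omega>
    let ?a = "supremum (r, \<omega>) - d - position (r, \<omega>)"
    have "(\<integral>\<^sup>+\<omega>'. nn_exp_mean 1 (\<lambda>u. indicator {?a} (position (u, \<omega>'))) \<partial>M) = nn_exp_mean 1 (\<lambda>u. \<integral>\<^sup>+\<omega>'. indicator {?a} (position (u, \<omega>')) \<partial>M)"
      by (rule nn_exp_mean_nn_integral_swap[symmetric, where f="\<lambda>z. indicator {?a} (position z)"]) measurable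
    also have "\<dots> = (\<integral>\<^sup>+z. indicator {?a} (position z) \<partial>exp_time 1)"
      by (rule exp_time_nn_integral[symmetric]) auto
    finally show "(\<integral>\<^sup>+\<omega>'. nn_exp_mean 1 (\<lambda>u. indicator {?a} (position (u, \<omega>'))) \<partial>M) = (\<integral>\<^sup>+z. indicator {?a} (position z) \<partial>exp_time 1)" .
  qed
  also have "\<dots> = 0" by (simp add: position_no_atom)
  finally have "AE \<omega> in M. ?F (sample \<omega>) = 0" by (subst (asm) nn_integral_0_iff_AE) measurable
  then show ?thesis using AE_space
  proof eventually_elim
    case (elim \<omega>)
    have "AE u in lborel. ennreal (exponential_density 1 u) * indicator {supremum (r, \<omega>) - d} (position (r + u, \<omega>)) = 0"
      using elim r by (subst nn_integral_0_iff_AE[symmetric]) (auto simp: path_eval_sample path_sup_sample supremum_def indicator_def)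
    then have "AE u in lborel. 0 \<le> u \<longrightarrow> position (r + u, \<omega>) \<noteq> supremum (r, \<omega>) - d"
      by eventually_elim (auto simp: exponential_density_eq)
    then have "AE t in lborel. 0 \<le> - r + 1 * t \<longrightarrow> position (r + (- r + 1 * t), \<omega>) \<noteq> supremum (r, \<omega>) - d"
      using elim(2) by (intro AE_borel_affine) auto
    then show ?case by simp
  qed
qed

lemma AE_drawdown_neq:
  assumes d: "d > 0" and \<omega>: "\<omega> \<in> space M"
    and past: "\<And>r. r \<in> \<rat> \<Longrightarrow> 0 \<le> r \<Longrightarrow> AE t in lborel. r \<le> t \<longrightarrow> position (t, \<omega>) \<noteq> supremum (r, \<omega>) - d"
  shows "AE t in lborel. 0 < t \<longrightarrow> drawdown (t, \<omega>) \<noteq> d"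
proof -
  let ?f = "\<lambda>t. X t \<omega>"
  have "AE t in lborel. \<forall>r\<in>\<rat>. 0 \<le> r \<longrightarrow> r \<le> t \<longrightarrow> position (t, \<omega>) \<noteq> supremum (r, \<omega>) - d"
    using past by (intro AE_ball_countable'[OF _ countable_rat]) auto
  moreover have "AE t in lborel. t \<notin> {t. 0 < t \<and> run_sup ?f 0 t - ?f t = d \<and> (\<forall>r\<in>\<rat>. 0 \<le> r \<longrightarrow> r < t \<longrightarrow> run_sup ?f 0 r < run_sup ?f 0 t)}"
    by (intro AE_not_in countable_imp_null_set_lborel countable_new_max_below[OF sn_path_X[OF \<omega>] d])
  ultimately show ?thesis
  proof eventually_elim
    case (elim t)
    show ?case
    proof (intro impI notI)
      assume t: "0 < t" and eq: "drawdown (t, \<omega>) = d"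
      then have "run_sup ?f 0 t - ?f t = d" by (simp add: drawdown_def supremum_def position_def)
      then obtain r where r: "r \<in> \<rat>" "0 \<le> r" "r < t" "run_sup ?f 0 r \<ge> run_sup ?f 0 t" using elim(2) t by force
      then have "supremum (r, \<omega>) = supremum (t, \<omega>)"
        using supremum_mono[OF \<omega>, of r t] by (simp add: supremum_def)
      then have "position (t, \<omega>) = supremum (r, \<omega>) - d" using eq by (simp add: position_eq)
      then show False using elim(1) r by auto
    qed
  qed
qed

lemma drawdown_no_atom:
  assumes p: "p > 0" and d: "d > 0"
  shows "AE z in exp_time p. drawdown z \<noteq> d"
proof -
  have "AE \<omega> in M. \<forall>r\<in>\<rat>. 0 \<le> r \<longrightarrow> (AE t in lborel. r \<le> t \<longrightarrow> position (t, \<omega>) \<noteq> supremum (r, \<omega>) - d)"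
    using AE_position_neq_past_supremum_minus by (intro AE_ball_countable'[OF _ countable_rat]) auto
  then have "AE \<omega> in M. nn_exp_mean p (\<lambda>t. indicator {d} (drawdown (t, \<omega>))) = 0" using AE_space
  proof eventually_elim
    case (elim \<omega>)
    have "AE t in lborel. 0 < t \<longrightarrow> drawdown (t, \<omega>) \<noteq> d" using elim(1) by (intro AE_drawdown_neq[OF d elim(2)]) auto
    then have "AE t in lborel. ennreal (exponential_density p t) * indicator {d} (drawdown (t, \<omega>)) = 0"
      using AE_lborel_singleton[of 0] by eventually_elim (auto simp: exponential_density_eq indicator_def)
    then show ?case using elim(2) by (subst nn_integral_0_iff_AE) auto
  qed
  then have "(\<integral>\<^sup>+\<omega>. nn_exp_mean p (\<lambda>t. indicator {d} (drawdown (t, \<omega>))) \<partial>M) = 0"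
    by (subst nn_integral_0_iff_AE) auto
  moreover have "(\<integral>\<^sup>+z. indicator {d} (drawdown z) \<partial>exp_time p)
      = (\<integral>\<^sup>+\<omega>. nn_exp_mean p (\<lambda>t. indicator {d} (drawdown (t, \<omega>))) \<partial>M)"
    using nn_exp_mean_nn_integral_swap[of "\<lambda>z. indicator {d} (drawdown z)" p] by (subst exp_time_nn_integral[OF p]) auto
  ultimately have "AE z in exp_time p. indicator {d} (drawdown z) = (0::ennreal)"
    by (subst nn_integral_0_iff_AE[symmetric]) auto
  then show ?thesis by eventually_elim (auto simp: indicator_def split: if_splits)
qed

lemma AE_drawdown_eq_imp_zero: "p > 0 \<Longrightarrow> AE z in exp_time p. 0 \<le> drawdown z \<and> (drawdown z = x \<longrightarrow> x = 0)"
proof -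
  assume p: "p > 0"
  have nonneg: "AE z in exp_time p. 0 \<le> drawdown z" using drawdown_nonneg by (intro AE_I2) (auto simp: space_exp_time)
  show ?thesis
  proof (cases "x > 0")
    case True
    show ?thesis using drawdown_no_atom[OF p True] nonneg by eventually_elim simp
  next
    case False
    show ?thesis using nonneg by eventually_elim (use False in auto)
  qed
qed

definition inv_deriv_psi :: "real \<Rightarrow> real" where
  "inv_deriv_psi p = sup_rate p / p * drawdown_laplace p (sup_rate p)"

lemma inv_deriv_psi_pos: "p > 0 \<Longrightarrow> inv_deriv_psi p > 0"
  unfolding inv_deriv_psi_def using sup_rate_pos drawdown_laplace_pos[of p "sup_rate p"] by (simp add: less_imp_le)

lemma deriv_psi_eq_inverse: "p > 0 \<Longrightarrow> deriv \<psi> (sup_rate p) = 1 / inv_deriv_psi p"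
  by (simp add: deriv_psi inv_deriv_psi_def)

lemma resolvent_density_eq:
  assumes p: "p > 0" and y: "y \<noteq> 0"
  shows "resolvent_density p y = inv_deriv_psi p * exp (- sup_rate p * y) - scale p (- y)"
proof -
  let ?c = "sup_rate p"
  have "tilted_drawdown p {- y..} = (\<integral>z. exp (- ?c * drawdown z) - exp (- ?c * drawdown z) * indicator {..- y} (drawdown z) \<partial>exp_time p)"
    unfolding tilted_drawdown_def
  proof (rule integral_cong_AE)
    show "AE z in exp_time p. exp (- ?c * drawdown z) * indicator {- y..} (drawdown z) = exp (- ?c * drawdown z) - exp (- ?c * drawdown z) * indicator {..- y} (drawdown z)"
      using AE_drawdown_eq_imp_zero[OF p, of "- y"] by eventually_elim (use y in \<open>auto simp: indicator_def\<close>)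
  qed measurable
  also have "\<dots> = drawdown_laplace p ?c - tilted_drawdown p {..- y}"
    unfolding drawdown_laplace_def tilted_drawdown_def
    by (intro Bochner_Integration.integral_diff exp_drawdown_integrable tilted_drawdown_integrable p less_imp_le[OF sup_rate_pos]) simp
  finally show ?thesis unfolding resolvent_density_def scale_def inv_deriv_psi_def by (simp add: right_diff_distrib)
qed

lemma scale_continuous: assumes p: "p > 0" shows "continuous_on {0..} (scale p)"
proof -
  interpret N: prob_space "exp_time p" by (rule prob_space_exp_time[OF p])
  have "continuous_on {0..} (\<lambda>x. tilted_drawdown p {..x})"
    unfolding continuous_on_sequentially comp_def
  proof (intro ballI allI impI, elim conjE)
    fix x :: real and f assume f: "\<forall>n. f n \<in> {0..}" "f \<longlonglongrightarrow> x"
    show "(\<lambda>n. tilted_drawdown p {..f n}) \<longlonglongrightarrow> tilted_drawdown p {..x}"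
      unfolding tilted_drawdown_def
    proof (rule integral_dominated_convergence[where w="\<lambda>_. 1"])
      show "AE z in exp_time p. norm (exp (- sup_rate p * drawdown z) * indicator {..f n} (drawdown z)) \<le> 1" for n
        using exp_sup_rate_drawdown_le[OF p] by (intro AE_I2) (auto simp: indicator_def)
      show "AE z in exp_time p. (\<lambda>n. exp (- sup_rate p * drawdown z) * indicator {..f n} (drawdown z)) \<longlonglongrightarrow> exp (- sup_rate p * drawdown z) * indicator {..x} (drawdown z)"
        using AE_drawdown_eq_imp_zero[OF p, of x]
        by eventually_elim (use f in \<open>auto intro!: tendsto_mult_left indicator_atMost_tendsto\<close>)
    qed auto
  qed
  then show ?thesis unfolding scale_def[abs_def] by (intro continuous_intros)
qed

lemma ennreal_scale:
  assumes p: "p > 0"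
  shows "ennreal (scale p y) = (\<integral>\<^sup>+z. ennreal (sup_rate p / p) * (ennreal (exp (sup_rate p * (y - drawdown z))) * indicator {..y} (drawdown z)) \<partial>exp_time p)"
proof -
  let ?c = "sup_rate p"
  have "ennreal (scale p y) = ennreal (?c / p * exp (?c * y)) * (\<integral>\<^sup>+z. ennreal (exp (- ?c * drawdown z) * indicator {..y} (drawdown z)) \<partial>exp_time p)"
    unfolding scale_def nn_integral_tilted_drawdown[OF p atMost_borel]
    using p sup_rate_pos[OF p] tilted_drawdown_nonneg by (intro ennreal_mult) auto
  also have "\<dots> = (\<integral>\<^sup>+z. ennreal (?c / p * exp (?c * y)) * ennreal (exp (- ?c * drawdown z) * indicator {..y} (drawdown z)) \<partial>exp_time p)"
    by (rule nn_integral_cmult[symmetric]) measurable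
  also have "\<dots> = (\<integral>\<^sup>+z. ennreal (?c / p) * (ennreal (exp (?c * (y - drawdown z))) * indicator {..y} (drawdown z)) \<partial>exp_time p)"
    using p sup_rate_pos[OF p]
    by (intro nn_integral_cong)
       (auto simp: indicator_def ennreal_mult'[symmetric] exp_add[symmetric] algebra_simps)
  finally show ?thesis .
qed

lemma inverse_psi_diff:
  assumes p: "p > 0" and l: "l > sup_rate p"
  shows "sup_rate p / (p * (l - sup_rate p)) * drawdown_laplace p l = 1 / (\<psi> l - p)"
proof -
  have "\<psi> l - p = p / (sup_rate p * drawdown_laplace p l) * (l - sup_rate p)"
    using psi_difference_quotient[OF p, of l] sup_rate_pos[OF p] l by (simp add: divide_eq_eq)
  then show ?thesis by simp
qed

lemma nn_integral_scale_laplace: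
  assumes p: "p > 0" and l: "l > sup_rate p"
  shows "(\<integral>\<^sup>+y. ennreal (exp (- l * y) * scale p y) \<partial>lborel) = ennreal (1 / (\<psi> l - p))"
proof -
  interpret N: prob_space "exp_time p" by (rule prob_space_exp_time[OF p])
  interpret NL: pair_sigma_finite "exp_time p" lborel ..
  let ?c = "sup_rate p"
  let ?g = "\<lambda>z y. ennreal (exp (- l * y)) * (ennreal (exp (?c * (y - drawdown z))) * indicator {..y} (drawdown z))"
  have c: "?c > 0" by (rule sup_rate_pos[OF p])
  have [measurable]: "(\<lambda>(z, y). ?g z y) \<in> borel_measurable (exp_time p \<Otimes>\<^sub>M lborel)"
  proof -
    have "(\<lambda>(z, y). ennreal (exp (- l * y)) * (ennreal (exp (?c * (y - drawdown z))) * (if drawdown z \<le> y then 1 else 0))) \<in> borel_measurable (exp_time p \<Otimes>\<^sub>M lborel)"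
      by measurable
    then show ?thesis by (simp add: indicator_def)
  qed
  have "(\<integral>\<^sup>+y. ennreal (exp (- l * y) * scale p y) \<partial>lborel) = (\<integral>\<^sup>+y. (\<integral>\<^sup>+z. ennreal (?c / p) * ?g z y \<partial>exp_time p) \<partial>lborel)"
    by (simp add: ennreal_mult' ennreal_scale[OF p] nn_integral_cmult[symmetric] mult.left_commute)
  also have "\<dots> = (\<integral>\<^sup>+z. (\<integral>\<^sup>+y. ennreal (?c / p) * ?g z y \<partial>lborel) \<partial>exp_time p)" by (rule NL.Fubini') measurable
  also have "\<dots> = (\<integral>\<^sup>+z. ennreal (?c / (p * (l - ?c))) * ennreal (exp (- l * drawdown z)) \<partial>exp_time p)"
  proof (rule nn_integral_cong)
    fix z
    have "(\<integral>\<^sup>+y. ennreal (?c / p) * ?g z y \<partial>lborel)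
        = (\<integral>\<^sup>+y. ennreal (?c / p) * (ennreal (exp (- l * y)) * (ennreal (exp (?c * (y - drawdown z))) * indicator {drawdown z..} y)) \<partial>lborel)"
      by (intro nn_integral_cong) (simp add: indicator_def)
    also have "\<dots> = ennreal (?c / p) * ennreal (exp (- l * drawdown z) / (l - ?c))"
      using nn_integral_exp_from[OF l, of "drawdown z"] by (simp add: nn_integral_cmult)
    also have "\<dots> = ennreal (?c / (p * (l - ?c))) * ennreal (exp (- l * drawdown z))"
      using c p l by (simp add: ennreal_mult'[symmetric])
    finally show "(\<integral>\<^sup>+y. ennreal (?c / p) * ?g z y \<partial>lborel)
        = ennreal (?c / (p * (l - ?c))) * ennreal (exp (- l * drawdown z))" .
  qed
  also have "\<dots> = ennreal (?c / (p * (l - ?c))) * ennreal (drawdown_laplace p l)"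
    using nn_integral_exp_drawdown[OF p, of l] c l by (simp add: nn_integral_cmult)
  also have "\<dots> = ennreal (?c / (p * (l - ?c)) * drawdown_laplace p l)"
    by (rule ennreal_mult[symmetric]) (use c p l drawdown_laplace_pos[OF p, of l] in auto)
  finally show ?thesis by (simp only: inverse_psi_diff[OF assms])
qed

lemma scale_laplace:
  assumes p: "p > 0" and l: "l > sup_rate p"
  shows "((\<lambda>y. exp (- l * y) * scale p y) has_integral 1 / (\<psi> l - p)) {0..}"
  by (rule has_integral_atLeast_nn_integral)
     (use nn_integral_scale_laplace[OF assms] scale_nonneg[OF p] scale_neg psi_greater[OF assms] scale_measurable[OF p] in auto)

lemma scale_W_eq:
  assumes p: "p > 0"
  shows "scale_W M X p = scale p"
  unfolding scale_W_def Phi_eq_sup_rate[OF p]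
proof (rule the_equality)
  show "(\<forall>y<0. scale p y = 0) \<and> continuous_on {0..} (scale p) \<and>
      (\<forall>l>sup_rate p. ((\<lambda>y. exp (- l * y) * scale p y) has_integral 1 / (\<psi> l - p)) {0..})"
    using scale_neg scale_continuous[OF p] scale_laplace[OF p] by auto
  fix W assume W: "(\<forall>y<0. W y = 0) \<and> continuous_on {0..} W \<and>
      (\<forall>l>sup_rate p. ((\<lambda>y. exp (- l * y) * W y) has_integral 1 / (\<psi> l - p)) {0..})"
  show "W = scale p"
  proof
    fix y
    show "W y = scale p y"
    proof (cases "y < 0")
      case False
      have "W y - scale p y = 0"
      proof (rule laplace_transform_zero_imp_zero[where f="\<lambda>y. W y - scale p y" and L="sup_rate p"])
        show "continuous_on {0..} (\<lambda>y. W y - scale p y)" using W scale_continuous[OF p] by (intro continuous_intros) auto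
        fix l assume l: "l > sup_rate p"
        have "((\<lambda>y. exp (- l * y) * W y - exp (- l * y) * scale p y) has_integral 1 / (\<psi> l - p) - 1 / (\<psi> l - p)) {0..}"
          using W l scale_laplace[OF p] by (intro has_integral_diff) auto
        then show "((\<lambda>y. exp (- l * y) * (W y - scale p y)) has_integral 0) {0..}" by (simp add: right_diff_distrib)
      qed (use False in simp)
      then show ?thesis by simp
    qed (use W scale_neg in simp)
  qed
qed

end

section \<open>The Volterra equation between scale functions\<close>

context sn_levy
begin

lemma scale_loc_bounded: "p > 0 \<Longrightarrow> loc_bounded (scale p)"
  by (rule loc_bounded_continuous[OF scale_measurable scale_continuous])

lemma conv_scale_laplace:
  assumes p: "p > 0" and r: "r > 0" and l: "l > sup_rate p" "l > sup_rate r"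
  shows "((\<lambda>y. exp (- l * y) * conv (scale p) (scale r) y) has_integral 1 / (\<psi> l - p) * (1 / (\<psi> l - r))) {0..}"
proof (rule has_integral_atLeast_nn_integral)
  have \<psi>: "\<psi> l > p" "\<psi> l > r" using psi_greater[OF p l(1)] psi_greater[OF r l(2)] by auto
  have [measurable]: "conv (scale p) (scale r) \<in> borel_measurable borel"
    by (intro conv_measurable scale_measurable p r)
  show "(\<lambda>y. exp (- l * y) * conv (scale p) (scale r) y) \<in> borel_measurable borel" by measurable
  have "(\<integral>\<^sup>+y. ennreal (exp (- l * y) * conv (scale p) (scale r) y) \<partial>lborel)
      = ennreal (1 / (\<psi> l - p)) * ennreal (1 / (\<psi> l - r))"
    using nn_integral_exp_mult_conv[of "scale p" "scale r" "- l"]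
      scale_loc_bounded scale_nonneg scale_neg nn_integral_scale_laplace p r l by simp
  then show "(\<integral>\<^sup>+y. ennreal (exp (- l * y) * conv (scale p) (scale r) y) \<partial>lborel)
      = ennreal (1 / (\<psi> l - p) * (1 / (\<psi> l - r)))"
    using \<psi> by (simp add: ennreal_mult'[symmetric])
  show "0 \<le> exp (- l * y) * conv (scale p) (scale r) y" for y
    by (intro mult_nonneg_nonneg conv_nonneg scale_nonneg p r) simp
  show "0 \<le> 1 / (\<psi> l - p) * (1 / (\<psi> l - r))" using \<psi> by simp
qed (simp add: conv_eq_0)

theorem scale_volterra:
  assumes p: "p > 0" and q: "q \<ge> 0"
  shows "scale (p + q) y = scale p y + q * conv (scale p) (scale (p + q)) y"
proof (cases "y < 0")
  case True
  then show ?thesis by (simp add: scale_neg conv_eq_0)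
next
  case False
  have pq: "p + q > 0" using p q by simp
  let ?W = "scale p" and ?V = "scale (p + q)"
  have "?V y - ?W y - q * conv ?W ?V y = 0"
  proof (rule laplace_transform_zero_imp_zero[where f="\<lambda>y. ?V y - ?W y - q * conv ?W ?V y" and L="max (sup_rate p) (sup_rate (p + q))"])
    show "continuous_on {0..} (\<lambda>y. ?V y - ?W y - q * conv ?W ?V y)"
      by (intro continuous_intros scale_continuous conv_continuous scale_loc_bounded p pq)
    fix l assume "l > max (sup_rate p) (sup_rate (p + q))"
    then have l: "l > sup_rate p" "l > sup_rate (p + q)" by auto
    have "((\<lambda>y. exp (- l * y) * ?V y - exp (- l * y) * ?W y - q * (exp (- l * y) * conv ?W ?V y)) has_integral
        1 / (\<psi> l - (p + q)) - 1 / (\<psi> l - p) - q * (1 / (\<psi> l - p) * (1 / (\<psi> l - (p + q))))) {0..}"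
      by (intro has_integral_diff has_integral_mult_right scale_laplace conv_scale_laplace p pq l)
    moreover have "1 / (\<psi> l - (p + q)) - 1 / (\<psi> l - p) - q * (1 / (\<psi> l - p) * (1 / (\<psi> l - (p + q)))) = 0"
      using psi_greater[OF p l(1)] psi_greater[OF pq l(2)] by (simp add: diff_frac_eq)
    ultimately show "((\<lambda>y. exp (- l * y) * (?V y - ?W y - q * conv ?W ?V y)) has_integral 0) {0..}"
      by (simp only: right_diff_distrib mult.left_commute)
  qed (use False in simp)
  then show ?thesis by simp
qed

end

section \<open>The Feynman--Kac equation\<close>

lemma eq_if_quadratic_increments:
  fixes D :: "real \<Rightarrow> real"
  assumes T: "T \<ge> 0" and D: "\<And>s t. 0 \<le> s \<Longrightarrow> s \<le> t \<Longrightarrow> t \<le> T \<Longrightarrow> \<bar>D t - D s\<bar> \<le> C * (t - s)\<^sup>2"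
  shows "D T = D 0"
proof -
  have "\<bar>D T - D 0\<bar> \<le> C * T\<^sup>2 / real n" if n: "n > 0" for n
  proof -
    let ?t = "\<lambda>i. T * real i / real n"
    have "D T - D 0 = (\<Sum>i<n. D (?t (Suc i)) - D (?t i))"
      using sum_lessThan_telescope[of "\<lambda>i. D (?t i)" n] n by simp
    also have "\<bar>\<dots>\<bar> \<le> (\<Sum>i<n. C * (T / real n)\<^sup>2)"
    proof (intro order_trans[OF sum_abs] sum_mono)
      fix i assume i: "i \<in> {..<n}"
      have "T * real (Suc i) \<le> T * real n" using i T by (intro mult_left_mono) auto
      then have "?t (Suc i) \<le> T" using n by (simp add: divide_le_eq)
      then have "\<bar>D (?t (Suc i)) - D (?t i)\<bar> \<le> C * (?t (Suc i) - ?t i)\<^sup>2"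
        using T by (intro D) (auto intro!: divide_right_mono mult_left_mono)
      also have "?t (Suc i) - ?t i = T / real n" by (simp add: diff_divide_distrib[symmetric] algebra_simps)
      finally show "\<bar>D (?t (Suc i)) - D (?t i)\<bar> \<le> C * (T / real n)\<^sup>2" .
    qed
    also have "\<dots> = C * T\<^sup>2 / real n" using n by (simp add: power2_eq_square)
    finally show ?thesis .
  qed
  moreover have "(\<lambda>n. C * T\<^sup>2 / real n) \<longlonglongrightarrow> 0" by (rule lim_const_over_n)
  ultimately have "\<bar>D T - D 0\<bar> \<le> 0"
    by (intro LIMSEQ_le_const) (auto intro!: exI[of _ 1])
  then show ?thesis by simp
qed

lemma exp_diff_bounds:
  fixes x y :: real
  shows "exp x * (y - x) \<le> exp y - exp x" "exp y - exp x \<le> exp y * (y - x)"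
proof -
  have "exp x * (1 + (y - x)) \<le> exp x * exp (y - x)" "exp y * (1 + (x - y)) \<le> exp y * exp (x - y)"
    by (intro mult_left_mono exp_ge_add_one_self; simp)+
  then show "exp x * (y - x) \<le> exp y - exp x" "exp y - exp x \<le> exp y * (y - x)"
    by (simp_all add: exp_add[symmetric] algebra_simps)
qed

lemma exponential_density_triangle_integrable:
  assumes p: "p > 0"
  shows "integrable (lborel \<Otimes>\<^sub>M lborel) (\<lambda>(s, t). if 0 \<le> s \<and> s \<le> t then exponential_density p t else 0)"
proof (rule lborel_pair.Fubini_integrable)
  let ?b = "\<lambda>s t. if 0 \<le> s \<and> s \<le> t then exponential_density p t else 0"
  have b_eq: "?b s t = exponential_density p t * (if s \<le> t then 1 else 0)" if "0 \<le> s" for s t using that by simp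
  have int: "integrable lborel (?b s)" for s
  proof (cases "0 \<le> s")
    case True
    show ?thesis unfolding b_eq[OF True] by (rule exp_mean_integrable[OF p, where B=1]) auto
  qed simp
  then show "AE s in lborel. integrable lborel (\<lambda>t. case (s, t) of (s, t) \<Rightarrow> ?b s t)" by simp
  have "(\<integral>t. norm (?b s t) \<partial>lborel) = exponential_density p s / p" for s
  proof (cases "0 \<le> s")
    case True
    have "norm (?b s t) = exponential_density p t * (if s \<le> t then 1 else 0)" for t
      unfolding b_eq[OF True] using exponential_density_nonneg[OF p, of t] by simp
    then show ?thesis using exp_mean_atLeast[OF p True] p True by (simp add: exponential_density_eq)
  qed (simp add: exponential_density_eq)
  then show "integrable lborel (\<lambda>s. \<integral>t. norm (case (s, t) of (s, t) \<Rightarrow> ?b s t) \<partial>lborel)"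
    using integrable_exponential_density[OF p] by simp
qed measurable

locale bounded_rate =
  fixes k :: "real \<Rightarrow> real" and K :: real
  assumes k_measurable [measurable]: "k \<in> borel_measurable borel"
    and k_nonneg: "0 \<le> k s" and k_le: "k s \<le> K"
begin

definition cumulative :: "real \<Rightarrow> real" where "cumulative t = (LBINT v:{0..t}. k v)"

lemma cumulative_measurable [measurable]: "cumulative \<in> borel_measurable borel"
  unfolding cumulative_def[abs_def] by measurable

lemma K_nonneg: "0 \<le> K"
  using k_nonneg[of 0] k_le[of 0] by linarith

lemma k_set_integrable: "set_integrable lborel {s..t} k"
  by (rule set_integrable_Icc_bounded[where B=K]) (use k_nonneg k_le in auto)

lemma cumulative_diff: "0 \<le> s \<Longrightarrow> s \<le> t \<Longrightarrow> cumulative t - cumulative s = (LBINT v:{s..t}. k v)"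
  unfolding cumulative_def by (subst set_integral_Icc_combine[of 0 s t]) (auto intro: k_set_integrable)

lemma cumulative_mono:
  assumes "0 \<le> s" "s \<le> t"
  shows "cumulative s \<le> cumulative t"
proof -
  have "0 \<le> (LBINT v:{s..t}. k v)"
    unfolding set_lebesgue_integral_def by (rule Bochner_Integration.integral_nonneg) (simp add: k_nonneg)
  then show ?thesis using cumulative_diff[OF assms] by simp
qed

lemma cumulative_diff_le: "0 \<le> s \<Longrightarrow> s \<le> t \<Longrightarrow> cumulative t - cumulative s \<le> K * (t - s)"
  using abs_set_integral_Icc_le[of k s t K] k_nonneg k_le by (simp add: cumulative_diff)

lemma cumulative_add: "0 \<le> s \<Longrightarrow> 0 \<le> u \<Longrightarrow> cumulative (s + u) = cumulative s + (LBINT v:{0..u}. k (s + v))"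
  using cumulative_diff[of s "s + u"] set_integral_Icc_shift[of 0 s u k] by (simp add: add.commute)

lemma exp_cumulative_set_integrable: "0 \<le> s \<Longrightarrow> set_integrable lborel {s..t} (\<lambda>v. k v * exp (cumulative v))"
  by (rule set_integrable_Icc_bounded[where B="K * exp (cumulative t)"])
     (use k_nonneg k_le K_nonneg cumulative_mono in \<open>auto simp: abs_mult intro!: mult_mono\<close>)

text \<open>As k is merely measurable, the fundamental theorem of calculus is replaced by the observation
  that the difference of the two sides has quadratically small increments.\<close>

lemma set_integral_exp_cumulative:
  assumes T: "T \<ge> 0"
  shows "(LBINT s:{0..T}. k s * exp (cumulative s)) = exp (cumulative T) - 1"
proof -
  let ?P = cumulative and ?Q = "\<lambda>t. LBINT s:{0..t}. k s * exp (cumulative s)"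
  have "exp (?P T) - ?Q T = exp (?P 0) - ?Q 0"
  proof (rule eq_if_quadratic_increments[OF T, where C="exp (?P T) * K\<^sup>2"])
    fix s t assume st: "0 \<le> s" "s \<le> t" "t \<le> T"
    have between: "?P s \<le> ?P v" "?P v \<le> ?P t" if "v \<in> {s..t}" for v using that st cumulative_mono by auto
    have Q_diff: "?Q t - ?Q s = (LBINT v:{s..t}. k v * exp (?P v))"
      using st by (subst set_integral_Icc_combine[of 0 s t]) (auto intro: exp_cumulative_set_integrable)
    have const: "(LBINT v:{s..t}. k v * exp r) = exp r * (?P t - ?P s)" for r
      using cumulative_diff[OF st(1,2)] by simp
    have lower: "exp (?P s) * (?P t - ?P s) \<le> ?Q t - ?Q s"
      unfolding Q_diff const[symmetric] using st between k_nonneg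
      by (intro set_integral_mono) (auto intro: exp_cumulative_set_integrable k_set_integrable intro!: mult_left_mono)
    have upper: "?Q t - ?Q s \<le> exp (?P t) * (?P t - ?P s)"
      unfolding Q_diff const[symmetric] using st between k_nonneg
      by (intro set_integral_mono) (auto intro: exp_cumulative_set_integrable k_set_integrable intro!: mult_left_mono)
    have "\<bar>(exp (?P t) - ?Q t) - (exp (?P s) - ?Q s)\<bar> \<le> (exp (?P t) - exp (?P s)) * (?P t - ?P s)"
      using lower upper exp_diff_bounds[where x="?P s" and y="?P t"] by (simp add: abs_le_iff left_diff_distrib)
    also have "\<dots> \<le> (exp (?P t) * (?P t - ?P s)) * (?P t - ?P s)"
      using exp_diff_bounds(2) cumulative_mono[OF st(1,2)] by (intro mult_right_mono) auto
    also have "\<dots> = exp (?P t) * (?P t - ?P s)\<^sup>2" by (simp add: power2_eq_square)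
    also have "\<dots> \<le> exp (?P T) * (K * (t - s))\<^sup>2"
      using st cumulative_mono cumulative_diff_le by (intro mult_mono power_mono) auto
    finally show "\<bar>(exp (?P t) - ?Q t) - (exp (?P s) - ?Q s)\<bar> \<le> exp (?P T) * K\<^sup>2 * (t - s)\<^sup>2"
      by (simp add: power_mult_distrib)
  qed
  moreover have "?P 0 = 0" "?Q 0 = 0" by (simp_all only: cumulative_def set_integral_Icc_degenerate[OF order_refl])
  ultimately show ?thesis by simp
qed

lemma exp_minus_cumulative:
  assumes t: "t \<ge> 0"
  shows "exp (- cumulative t) = 1 - (LBINT s:{0..t}. k s * exp (- (cumulative t - cumulative s)))"
proof -
  have split: "k s * exp (- (cumulative t - cumulative s)) = exp (- cumulative t) * (k s * exp (cumulative s))" for s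
    by (simp add: exp_add[symmetric])
  have "(LBINT s:{0..t}. k s * exp (- (cumulative t - cumulative s))) = exp (- cumulative t) * (exp (cumulative t) - 1)"
    unfolding split by (simp add: set_integral_exp_cumulative[OF t])
  then show ?thesis by (simp add: right_diff_distrib exp_add[symmetric])
qed

text \<open>The joint density of killing at time s with rate k and of an independent exponential time t
  after s, weighted with the payoff f t and the chance to survive from s to t.\<close>

definition killing_density :: "real \<Rightarrow> (real \<Rightarrow> real) \<Rightarrow> real \<Rightarrow> real \<Rightarrow> real" where
  "killing_density p f s t =
    (if 0 \<le> s \<and> s \<le> t then exponential_density p t * (f t * (k s * exp (- (cumulative t - cumulative s)))) else 0)"

lemma killing_density_integrable:
  assumes p: "p > 0" and f [measurable]: "f \<in> borel_measurable borel" and B: "\<And>t. \<bar>f t\<bar> \<le> B"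
  shows "integrable (lborel \<Otimes>\<^sub>M lborel) (\<lambda>(s, t). killing_density p f s t)"
proof (rule Bochner_Integration.integrable_bound)
  show "integrable (lborel \<Otimes>\<^sub>M lborel) (\<lambda>w. B * K * (case w of (s, t) \<Rightarrow> if 0 \<le> s \<and> s \<le> t then exponential_density p t else 0))"
    by (rule integrable_mult_right) (rule exponential_density_triangle_integrable[OF p])
  show "(\<lambda>(s, t). killing_density p f s t) \<in> borel_measurable (lborel \<Otimes>\<^sub>M lborel)"
    unfolding killing_density_def by measurable
  have "\<bar>killing_density p f s t\<bar> \<le> exponential_density p t * (B * K)" if "0 \<le> s" "s \<le> t" for s t
  proof -
    have "\<bar>f t\<bar> * (k s * exp (- (cumulative t - cumulative s))) \<le> B * (K * 1)"
      using B[of t] k_nonneg k_le K_nonneg cumulative_mono[OF that] by (intro mult_mono) auto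
    then show ?thesis
      using that exponential_density_nonneg[OF p, of t] k_nonneg[of s]
      by (simp add: killing_density_def abs_mult mult_left_mono)
  qed
  then show "AE w in lborel \<Otimes>\<^sub>M lborel. norm (case w of (s, t) \<Rightarrow> killing_density p f s t)
      \<le> norm (B * K * (case w of (s, t) \<Rightarrow> if 0 \<le> s \<and> s \<le> t then exponential_density p t else 0))"
    by (intro AE_I2) (auto simp: killing_density_def mult.commute intro: order_trans[OF _ abs_ge_self])
qed

lemma integral_killing_density_killing_time:
  "exponential_density p t * (exp (- cumulative t) * f t)
      = exponential_density p t * f t - (\<integral>s. killing_density p f s t \<partial>lborel)"
proof (cases "t \<ge> 0")
  case True
  have "(\<integral>s. killing_density p f s t \<partial>lborel)
      = (LBINT s:{0..t}. (exponential_density p t * f t) * (k s * exp (- (cumulative t - cumulative s))))"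
    unfolding set_lebesgue_integral_def
    by (rule Bochner_Integration.integral_cong) (auto simp: killing_density_def indicator_def)
  also have "\<dots> = (exponential_density p t * f t) * (1 - exp (- cumulative t))"
    by (simp add: exp_minus_cumulative[OF True])
  finally show ?thesis by (simp add: algebra_simps)
next
  case False
  then have "killing_density p f s t = 0" for s by (simp add: killing_density_def)
  then show ?thesis using False by (simp add: exponential_density_eq)
qed

lemma integral_killing_density_end_time:
  assumes p: "p > 0"
  shows "(\<integral>t. killing_density p f s t \<partial>lborel)
      = exponential_density p s * (k s * exp_mean p (\<lambda>u. exp (- (LBINT v:{0..u}. k (s + v))) * f (s + u))) / p"
proof (cases "s \<ge> 0")
  case True
  have "(\<integral>t. killing_density p f s t \<partial>lborel)
      = exp_mean p (\<lambda>t. if s \<le> t then f t * (k s * exp (- (cumulative t - cumulative s))) else 0)"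
    by (rule Bochner_Integration.integral_cong) (use True in \<open>auto simp: killing_density_def\<close>)
  also have "\<dots> = exp (- p * s) * exp_mean p (\<lambda>u. f (s + u) * (k s * exp (- (cumulative (s + u) - cumulative s))))"
    by (rule exp_mean_shift[OF True])
  also have "exp_mean p (\<lambda>u. f (s + u) * (k s * exp (- (cumulative (s + u) - cumulative s)))) = exp_mean p (\<lambda>u. k s * (exp (- (LBINT v:{0..u}. k (s + v))) * f (s + u)))"
    by (rule exp_mean_cong) (simp add: cumulative_add[OF True])
  also have "\<dots> = k s * exp_mean p (\<lambda>u. exp (- (LBINT v:{0..u}. k (s + v))) * f (s + u))"
    by (simp add: mult.left_commute)
  finally show ?thesis using True p by (simp add: exponential_density_eq)
qed (simp add: killing_density_def exponential_density_eq)

lemma exp_mean_killed: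
  assumes p: "p > 0" and f [measurable]: "f \<in> borel_measurable borel" and B: "\<And>t. \<bar>f t\<bar> \<le> B"
  shows "exp_mean p (\<lambda>t. exp (- cumulative t) * f t) =
    exp_mean p f - exp_mean p (\<lambda>s. k s * exp_mean p (\<lambda>u. exp (- (LBINT v:{0..u}. k (s + v))) * f (s + u))) / p"
proof -
  note int = killing_density_integrable[OF assms]
  have "exp_mean p (\<lambda>t. exp (- cumulative t) * f t) = exp_mean p f - (\<integral>t. (\<integral>s. killing_density p f s t \<partial>lborel) \<partial>lborel)"
    unfolding integral_killing_density_killing_time
    using exp_mean_integrable[OF p f] B lborel_pair.integrable_snd[OF int] by (subst Bochner_Integration.integral_diff) auto
  also have "(\<integral>t. (\<integral>s. killing_density p f s t \<partial>lborel) \<partial>lborel) = (\<integral>s. (\<integral>t. killing_density p f s t \<partial>lborel) \<partial>lborel)"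
    by (rule lborel_pair.Fubini_integral[OF int])
  finally show ?thesis by (simp add: integral_killing_density_end_time[OF p])
qed

end

locale killed_process = sn_levy M X + bounded_rate k K for M :: "'a measure" and X and k K +
  fixes p :: real
  assumes p: "p > 0"
begin

definition killing :: "real \<Rightarrow> real \<Rightarrow> 'a \<Rightarrow> real" where
  "killing t y \<omega> = (LBINT v:{0..t}. k (y + position (v, \<omega>)))"

definition resolvent :: "(real \<Rightarrow> real) \<Rightarrow> real \<Rightarrow> real" where
  "resolvent f y = (\<integral>z. exp (- killing (fst z) y (snd z)) * f (y + position z) \<partial>exp_time p) / p"

lemma killing_measurable [measurable (raw)]:
  assumes [measurable]: "t \<in> borel_measurable N" "y \<in> borel_measurable N" "w \<in> measurable N M"
  shows "(\<lambda>x. killing (t x) (y x) (w x)) \<in> borel_measurable N"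
  unfolding killing_def by measurable

lemma k_set_integral_nonneg: "0 \<le> (LBINT v:{0..t}. k (g v))"
  unfolding set_lebesgue_integral_def by (rule Bochner_Integration.integral_nonneg) (simp add: k_nonneg)

lemma resolvent_nonneg: "(\<And>y. 0 \<le> f y) \<Longrightarrow> 0 \<le> resolvent f y"
  unfolding resolvent_def using p by (intro divide_nonneg_nonneg Bochner_Integration.integral_nonneg) auto

definition restart_payoff :: "(real \<Rightarrow> real) \<Rightarrow> real \<Rightarrow> real \<Rightarrow> (real \<Rightarrow> real) \<Rightarrow> real" where
  "restart_payoff f y s w = k (y + path_eval w s) *
    exp_mean p (\<lambda>u. exp (- (LBINT v:{0..u}. k (y + path_eval w (s + v)))) * f (y + path_eval w (s + u)))"

context
  fixes f :: "real \<Rightarrow> real" and B :: real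
  assumes f_measurable [measurable]: "f \<in> borel_measurable borel" and f_bound: "\<bar>f y\<bar> \<le> B"
begin

lemma exp_minus_mult_bound: "0 \<le> r \<Longrightarrow> \<bar>exp (- r) * f y\<bar> \<le> B"
  using mult_mono[of "exp (- r)" 1 "\<bar>f y\<bar>" B] f_bound[of y] by (simp add: abs_mult)

lemma killed_payoff_bound: "\<bar>exp (- killing t y \<omega>) * f z\<bar> \<le> B"
  unfolding killing_def by (rule exp_minus_mult_bound[OF k_set_integral_nonneg])

lemma resolvent_measurable [measurable]: "resolvent f \<in> borel_measurable borel"
proof -
  interpret N: prob_space "exp_time p" by (rule prob_space_exp_time[OF p])
  show ?thesis unfolding resolvent_def by measurable
qed

lemma abs_resolvent_le: "\<bar>resolvent f y\<bar> \<le> B / p"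
proof -
  interpret N: prob_space "exp_time p" by (rule prob_space_exp_time[OF p])
  have "\<bar>\<integral>z. exp (- killing (fst z) y (snd z)) * f (y + position z) \<partial>exp_time p\<bar> \<le> (\<integral>z. B \<partial>exp_time p)"
    by (rule order_trans[OF integral_abs_bound Bochner_Integration.integral_mono])
       (auto intro!: integrable_abs exp_time_integrable[OF p, where B=B] killed_payoff_bound)
  then show ?thesis using p by (simp add: resolvent_def N.prob_space divide_right_mono)
qed

lemma restart_payoff_measurable [measurable (raw)]:
  assumes [measurable]: "g \<in> borel_measurable N" "w \<in> measurable N path_space"
  shows "(\<lambda>x. restart_payoff f y (g x) (w x)) \<in> borel_measurable N"
  unfolding restart_payoff_def by measurable

lemma restart_payoff_bound:
  assumes "w \<in> space path_space"
  shows "\<bar>restart_payoff f y s w\<bar> \<le> K * B"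
proof -
  have [measurable]: "(\<lambda>_. w) \<in> measurable N path_space" for N using assms by simp
  have "\<bar>exp_mean p (\<lambda>u. exp (- (LBINT v:{0..u}. k (y + path_eval w (s + v)))) * f (y + path_eval w (s + u)))\<bar> \<le> B"
    by (rule abs_exp_mean_le[OF p]) (auto intro: exp_minus_mult_bound k_set_integral_nonneg)
  then show ?thesis
    unfolding restart_payoff_def abs_mult using k_nonneg k_le K_nonneg by (intro mult_mono) auto
qed

lemma restart_payoff_markov:
  assumes s: "s \<ge> 0"
  shows "(\<integral>\<omega>. restart_payoff f y s (sample \<omega>) \<partial>M)
      = (\<integral>\<omega>. k (y + position (s, \<omega>)) * (p * resolvent f (y + position (s, \<omega>))) \<partial>M)"
proof -
  have "(\<integral>\<omega>. restart_payoff f y s (sample \<omega>) \<partial>M) = (\<integral>\<omega>. \<integral>\<omega>'. restart_payoff f y s (restarted s (\<omega>, \<omega>')) \<partial>M \<partial>M)"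
    by (rule markov_integral[where B="K * B"]) (use restart_payoff_bound s in auto)
  also have "\<dots> = (\<integral>\<omega>. \<integral>\<omega>'. k (y + position (s, \<omega>)) *
      exp_mean p (\<lambda>u. exp (- killing u (y + position (s, \<omega>)) \<omega>') * f (y + position (s, \<omega>) + position (u, \<omega>'))) \<partial>M \<partial>M)"
  proof (intro Bochner_Integration.integral_cong refl)
    fix \<omega> \<omega>' assume \<omega>: "\<omega> \<in> space M" "\<omega>' \<in> space M"
    have "(LBINT v:{0..u}. k (y + path_eval (restarted s (\<omega>, \<omega>')) (s + v))) = killing u (y + position (s, \<omega>)) \<omega>'" for u
      unfolding killing_def
      by (rule set_lebesgue_integral_cong) (use \<omega> s in \<open>auto simp: path_eval_restarted(2) add.assoc\<close>)
    then show "restart_payoff f y s (restarted s (\<omega>, \<omega>')) = k (y + position (s, \<omega>)) *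
        exp_mean p (\<lambda>u. exp (- killing u (y + position (s, \<omega>)) \<omega>') * f (y + position (s, \<omega>) + position (u, \<omega>')))"
      unfolding restart_payoff_def using \<omega> s
      by (intro arg_cong2[where f="(*)"] exp_mean_cong) (simp_all add: path_eval_restarted add.assoc)
  qed
  also have "\<dots> = (\<integral>\<omega>. k (y + position (s, \<omega>)) * (p * resolvent f (y + position (s, \<omega>))) \<partial>M)"
    unfolding resolvent_def using p
    by (simp add: exp_time_integral_time_inner[OF p _ killed_payoff_bound])
  finally show ?thesis .
qed

lemma killed_exp_mean_sample:
  assumes \<omega>: "\<omega> \<in> space M"
  shows "exp_mean p (\<lambda>t. exp (- killing t y \<omega>) * f (y + position (t, \<omega>))) =
    exp_mean p (\<lambda>t. f (y + position (t, \<omega>)) - restart_payoff f y t (sample \<omega>) / p)"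
proof -
  have [measurable]: "(\<lambda>_. \<omega>) \<in> measurable borel M" using \<omega> by simp
  have sample: "sample \<omega> \<in> space path_space" by (rule measurable_space[OF sample_measurable \<omega>])
  have [measurable]: "(\<lambda>_. sample \<omega>) \<in> measurable borel path_space" using sample by simp
  interpret path: bounded_rate "\<lambda>s. k (y + position (s, \<omega>))" K
    by unfold_locales (use k_nonneg k_le in auto)
  have "exp_mean p (\<lambda>t. exp (- killing t y \<omega>) * f (y + position (t, \<omega>))) =
      exp_mean p (\<lambda>t. f (y + position (t, \<omega>))) - exp_mean p (\<lambda>t. restart_payoff f y t (sample \<omega>)) / p"
    using path.exp_mean_killed[OF p _ f_bound, of "\<lambda>t. y + position (t, \<omega>)"]
    by (simp add: path.cumulative_def killing_def restart_payoff_def path_eval_sample[OF \<omega>])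
  also have "\<dots> = exp_mean p (\<lambda>t. f (y + position (t, \<omega>)) - restart_payoff f y t (sample \<omega>) / p)"
    using exp_mean_integrable[OF p, of "\<lambda>t. f (y + position (t, \<omega>))" B] exp_mean_integrable[OF p, of "\<lambda>t. restart_payoff f y t (sample \<omega>)" "K * B"]
      f_bound restart_payoff_bound[OF sample] by (simp add: right_diff_distrib)
  finally show ?thesis .
qed

theorem feynman_kac:
  "resolvent f y = (\<integral>z. f (y + position z) \<partial>exp_time p) / p - (\<integral>z. k (y + position z) * resolvent f (y + position z) \<partial>exp_time p) / p"
proof -
  have sample_bound: "\<bar>restart_payoff f y s (sample \<omega>)\<bar> \<le> K * B" if "\<omega> \<in> space M" for s \<omega>
    by (rule restart_payoff_bound[OF measurable_space[OF sample_measurable that]])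
  have diff_bound: "\<bar>f (y + position (t, \<omega>)) - restart_payoff f y t (sample \<omega>) / p\<bar> \<le> B + K * B / p" if "\<omega> \<in> space M" for t \<omega>
    using f_bound[of "y + position (t, \<omega>)"] divide_right_mono[OF sample_bound[OF that, of t], of p] p
    by (intro order_trans[OF abs_triangle_ineq4] add_mono) auto
  have resolvent_term_bound: "\<bar>k x * (p * resolvent f x)\<bar> \<le> K * B" for x
  proof -
    have "p * \<bar>resolvent f x\<bar> \<le> B" using abs_resolvent_le[of x] p by (simp add: pos_le_divide_eq mult.commute)
    then show ?thesis using mult_mono[OF k_le[of x] _ K_nonneg, of "p * \<bar>resolvent f x\<bar>" B] k_nonneg p by (simp add: abs_mult)
  qed
  have "p * resolvent f y = (\<integral>\<omega>. exp_mean p (\<lambda>t. exp (- killing t y \<omega>) * f (y + position (t, \<omega>))) \<partial>M)"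
    unfolding resolvent_def using p by (simp add: exp_time_integral_time_inner[OF p _ killed_payoff_bound])
  also have "\<dots> = (\<integral>\<omega>. exp_mean p (\<lambda>t. f (y + position (t, \<omega>)) - restart_payoff f y t (sample \<omega>) / p) \<partial>M)"
    by (intro Bochner_Integration.integral_cong refl killed_exp_mean_sample)
  also have "\<dots> = (\<integral>z. f (y + position z) - restart_payoff f y (fst z) (sample (snd z)) / p \<partial>exp_time p)"
    by (subst exp_time_integral_time_inner[OF p, where B="B + K * B / p"]) (use diff_bound in \<open>auto simp: space_exp_time\<close>)
  also have "\<dots> = (\<integral>z. f (y + position z) \<partial>exp_time p) - (\<integral>z. restart_payoff f y (fst z) (sample (snd z)) \<partial>exp_time p) / p"
    using exp_time_integrable[OF p, of "\<lambda>z. f (y + position z)" B] f_bound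
      exp_time_integrable[OF p, of "\<lambda>z. restart_payoff f y (fst z) (sample (snd z))" "K * B"] sample_bound
    by (auto simp: space_exp_time)
  also have "(\<integral>z. restart_payoff f y (fst z) (sample (snd z)) \<partial>exp_time p)
      = exp_mean p (\<lambda>s. \<integral>\<omega>. restart_payoff f y s (sample \<omega>) \<partial>M)"
    by (subst exp_time_integral_time_outer[OF p, where B="K * B"]) (use sample_bound in \<open>auto simp: space_exp_time\<close>)
  also have "\<dots> = exp_mean p (\<lambda>s. \<integral>\<omega>. k (y + position (s, \<omega>)) * (p * resolvent f (y + position (s, \<omega>))) \<partial>M)"
    by (rule exp_mean_cong) (rule restart_payoff_markov)
  also have "\<dots> = (\<integral>z. k (y + position z) * (p * resolvent f (y + position z)) \<partial>exp_time p)"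
    by (subst exp_time_integral_time_outer[OF p, where B="K * B"]) (use resolvent_term_bound in auto)
  also have "\<dots> = p * (\<integral>z. k (y + position z) * resolvent f (y + position z) \<partial>exp_time p)"
    by (simp add: mult.left_commute)
  finally show ?thesis using p by (simp add: field_simps)
qed

end

end

section \<open>Solving the resolvent equation\<close>

text \<open>Here W and V stand for the scale functions of orders p and p + q, c for \<open>\<Phi>(p)\<close> and \<open>\<kappa>\<close> for
  \<open>1 / \<psi>'(\<Phi>(p))\<close>. In the paper's notation \<open>volterra_solution expo\<close> is \<open>\<H>\<close>, \<open>truncate (x - a) V\<close> is
  \<open>\<W>\<close> with index \<open>x - a\<close>, and the two braces are \<open>truncate (- y)\<close> applied to these two functions.\<close>

locale scale_pair =
  fixes W V :: "real \<Rightarrow> real" and c q a \<kappa> :: real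
  assumes W_loc_bounded: "loc_bounded W" and V_loc_bounded: "loc_bounded V"
    and W_neg: "\<And>x. x < 0 \<Longrightarrow> W x = 0" and V_neg: "\<And>x. x < 0 \<Longrightarrow> V x = 0" and V_nonneg: "\<And>x. 0 \<le> V x"
    and volterra: "\<And>x. V x = W x + q * conv W V x"
    and q_nonneg: "q \<ge> 0" and a_pos: "a > 0" and \<kappa>_pos: "\<kappa> > 0"
begin

lemmas W_measurable [measurable] = loc_bounded_measurable[OF W_loc_bounded]
lemmas V_measurable [measurable] = loc_bounded_measurable[OF V_loc_bounded]

definition volterra_solution :: "(real \<Rightarrow> real) \<Rightarrow> real \<Rightarrow> real" where
  "volterra_solution g x = g x + q * conv V g x"

lemma volterra_solution_loc_bounded: "loc_bounded g \<Longrightarrow> loc_bounded (volterra_solution g)"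
  unfolding volterra_solution_def[abs_def]
  by (intro loc_bounded_add_scaled conv_loc_bounded V_loc_bounded)

lemma volterra_solution_W: "volterra_solution W = V"
proof
  show "volterra_solution W x = V x" for x
    using volterra[of x] by (simp add: volterra_solution_def conv_commute)
qed

lemma conv_W_volterra_solution:
  assumes g: "loc_bounded g"
  shows "conv W (volterra_solution g) x = conv V g x"
proof -
  note W = W_loc_bounded and V = V_loc_bounded
  have "conv W (volterra_solution g) x = conv W g x + q * conv W (conv V g) x"
    unfolding volterra_solution_def[abs_def] by (intro conv_add_scaled_right conv_loc_bounded W V g)
  also have "conv W (conv V g) x = conv (conv W V) g x" by (rule conv_assoc[OF W V g])
  also have "conv W g x + q * conv (conv W V) g x = conv (\<lambda>z. W z + q * conv W V z) g x"
    by (intro conv_add_scaled_left[symmetric] conv_loc_bounded W V g)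
  also have "\<dots> = conv V g x" by (simp only: volterra[symmetric])
  finally show ?thesis .
qed

lemma volterra_solution_eq: "loc_bounded g \<Longrightarrow> volterra_solution g x = g x + q * conv (volterra_solution g) W x"
  using conv_W_volterra_solution[of g x] by (simp add: volterra_solution_def conv_commute)

lemma volterra_solution_unique:
  assumes f: "loc_bounded f" and g: "loc_bounded g"
    and eq: "\<And>z. 0 \<le> z \<Longrightarrow> z \<le> T \<Longrightarrow> f z = g z + q * conv W f z" and x: "0 \<le> x" "x \<le> T"
  shows "f x = volterra_solution g x"
proof -
  note W = W_loc_bounded and V = V_loc_bounded
  have VW: "conv V W = conv W V" by (rule ext, rule conv_commute)
  have "conv V f x = conv V (\<lambda>z. g z + q * conv W f z) x" by (rule conv_cong) (use eq x in auto)
  also have "\<dots> = conv V g x + q * conv V (conv W f) x" by (intro conv_add_scaled_right conv_loc_bounded W V f g)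
  also have "conv V (conv W f) x = conv (conv W V) f x" using conv_assoc[OF V W f] by (simp add: VW)
  finally have "conv V f x = conv V g x + q * conv (conv W V) f x" .
  moreover have "conv V f x = conv (\<lambda>z. W z + q * conv W V z) f x" by (simp only: volterra[symmetric])
  moreover have "\<dots> = conv W f x + q * conv (conv W V) f x" by (intro conv_add_scaled_left conv_loc_bounded W V f)
  ultimately have "conv W f x = conv V g x" by simp
  then show ?thesis using eq[OF x] by (simp add: volterra_solution_def)
qed

lemma conv_volterra_solution_swap:
  assumes g: "loc_bounded g" and h: "loc_bounded h"
  shows "conv g (volterra_solution h) x = conv (volterra_solution g) h x"
proof -
  note V = V_loc_bounded
  have "conv g (volterra_solution h) x = conv g h x + q * conv g (conv V h) x"
    unfolding volterra_solution_def[abs_def] by (intro conv_add_scaled_right conv_loc_bounded V g h)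
  also have "conv g (conv V h) x = conv (conv g V) h x" by (rule conv_assoc[OF g V h])
  also have "conv g V = conv V g" by (rule ext, rule conv_commute)
  also have "conv g h x + q * conv (conv V g) h x = conv (volterra_solution g) h x"
    unfolding volterra_solution_def[abs_def] by (intro conv_add_scaled_left[symmetric] conv_loc_bounded V g h)
  finally show ?thesis .
qed

definition shifted_W :: "real \<Rightarrow> real \<Rightarrow> real" where "shifted_W b s = W (s + b)"

lemma W_bounded: obtains B where "B \<ge> 0" "\<And>x. x \<le> T \<Longrightarrow> \<bar>W x\<bar> \<le> B"
  using loc_bounded_atMostD[OF W_loc_bounded W_neg] by metis

lemma shifted_W_loc_bounded: "loc_bounded (shifted_W b)"
  unfolding loc_bounded_def
proof (intro conjI allI)
  fix T
  obtain B where "\<And>x. x \<le> T + b \<Longrightarrow> \<bar>W x\<bar> \<le> B" using W_bounded[where T="T + b"] by blast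
  then show "\<exists>B. \<forall>x\<in>{0..T}. \<bar>shifted_W b x\<bar> \<le> B" by (intro exI[of _ B]) (auto simp: shifted_W_def)
qed (simp add: shifted_W_def[abs_def])

definition truncate :: "real \<Rightarrow> (real \<Rightarrow> real) \<Rightarrow> real \<Rightarrow> real" where
  "truncate b f v = f v - q * (LBINT u:{0..b}. f (v - u) * W u)"

lemma conv_W_split:
  assumes f: "loc_bounded f" and w: "0 \<le> w \<or> (\<forall>z<0. f z = 0)"
  shows "conv f W (w + b) = (LBINT u:{0..b}. f (w + b - u) * W u) + conv f (shifted_W b) w"
proof -
  consider "w < 0" | "0 \<le> w" "0 \<le> b" | "0 \<le> w" "b < 0" by linarith
  then show ?thesis
  proof cases
    case 1
    then have "conv f W (w + b) = (LBINT u:{0..b}. f (w + b - u) * W u)"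
      using w unfolding conv_def set_lebesgue_integral_def
      by (intro Bochner_Integration.integral_cong) (auto simp: indicator_def)
    then show ?thesis using 1 by (simp add: conv_eq_0)
  next
    case 2
    have "conv f W (w + b) = (LBINT u:{0..b}. f (w + b - u) * W u) + (LBINT u:{b..w + b}. f (w + b - u) * W u)"
      unfolding conv_def by (rule set_integral_Icc_combine) (use 2 conv_set_integrable[OF f W_loc_bounded] in auto)
    also have "(LBINT u:{b..w + b}. f (w + b - u) * W u) = conv f (shifted_W b) w"
      using set_integral_Icc_shift[of 0 b w "\<lambda>u. f (w + b - u) * W u"] by (simp add: conv_def shifted_W_def)
    finally show ?thesis .
  next
    case 3
    have "conv f (shifted_W b) w = (LBINT s:{- b..w}. f (w - s) * W (s + b))"
      unfolding conv_def shifted_W_def set_lebesgue_integral_def using 3 W_neg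
      by (intro Bochner_Integration.integral_cong) (auto simp: indicator_def)
    also have "\<dots> = conv f W (w + b)"
      using set_integral_Icc_shift[of 0 "- b" "w + b" "\<lambda>s. f (w - s) * W (s + b)"] by (simp add: conv_def algebra_simps)
    finally show ?thesis using 3 by (simp add: set_lebesgue_integral_def)
  qed
qed

lemma truncate_volterra_solution:
  assumes g: "loc_bounded g" and w: "0 \<le> w \<or> (\<forall>z<0. volterra_solution g z = 0)"
  shows "truncate b (volterra_solution g) (w + b) = g (w + b) + q * conv (volterra_solution g) (shifted_W b) w"
  using conv_W_split[OF volterra_solution_loc_bounded[OF g] w, of b] volterra_solution_eq[OF g, of "w + b"]
  by (simp add: truncate_def algebra_simps)

lemma truncate_V: "truncate b V (w + b) = volterra_solution (shifted_W b) w"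
  using truncate_volterra_solution[OF W_loc_bounded, of w b] V_neg
  by (simp add: volterra_solution_W) (simp add: volterra_solution_def shifted_W_def)

lemma truncate_truncate:
  assumes f [measurable]: "f \<in> borel_measurable borel" and bound: "\<And>x. x \<le> v \<Longrightarrow> \<bar>f x\<bar> \<le> B"
  shows "truncate b (truncate d f) v = f v - q * (LBINT u:{0..d}. f (v - u) * W u) - q * (LBINT u:{0..b}. f (v - u) * W u)
    + q\<^sup>2 * (LBINT u:{0..b}. LBINT z:{0..d}. f (v - u - z) * (W z * W u))"
proof -
  have B: "0 \<le> B" using bound[of v] by linarith
  obtain BW where BW: "BW \<ge> 0" "\<And>z. z \<le> max b d \<Longrightarrow> \<bar>W z\<bar> \<le> BW" using W_bounded[where T="max b d"] by blast
  have "set_integrable lborel {0..b} (\<lambda>u. f (v - u) * W u)"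
    by (rule set_integrable_Icc_bounded[where B="B * BW"])
       (use bound BW B in \<open>auto simp: abs_mult intro!: mult_mono\<close>)
  moreover have "set_integrable lborel {0..b} (\<lambda>u. LBINT z:{0..d}. f (v - u - z) * (W z * W u))"
  proof (rule set_integrable_Icc_bounded)
    fix u assume "0 \<le> u" "u \<le> b"
    then show "\<bar>LBINT z:{0..d}. f (v - u - z) * (W z * W u)\<bar> \<le> B * (BW * BW) * max 0 (d - 0)"
      using bound BW B by (intro abs_set_integral_Icc_le) (auto simp: abs_mult intro!: mult_mono)
  qed measurable
  moreover have "truncate d f (v - u) * W u = f (v - u) * W u - q * (LBINT z:{0..d}. f (v - u - z) * (W z * W u))" for u
    by (simp add: truncate_def left_diff_distrib mult.assoc[symmetric])
  ultimately have "(LBINT u:{0..b}. truncate d f (v - u) * W u) =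
      (LBINT u:{0..b}. f (v - u) * W u) - q * (LBINT u:{0..b}. LBINT z:{0..d}. f (v - u - z) * (W z * W u))"
    by simp
  then show ?thesis
    unfolding truncate_def[of b] by (simp add: truncate_def power2_eq_square right_diff_distrib)
qed

lemma truncate_commute:
  assumes f [measurable]: "f \<in> borel_measurable borel" and bound: "\<And>x. x \<le> v \<Longrightarrow> \<bar>f x\<bar> \<le> B"
  shows "truncate b (truncate d f) v = truncate d (truncate b f) v"
proof -
  have B: "0 \<le> B" using bound[of v] by linarith
  obtain BW where BW: "BW \<ge> 0" "\<And>z. z \<le> max b d \<Longrightarrow> \<bar>W z\<bar> \<le> BW" using W_bounded[where T="max b d"] by blast
  have "(LBINT u:{0..b}. LBINT z:{0..d}. f (v - u - z) * (W z * W u))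
      = (LBINT z:{0..d}. LBINT u:{0..b}. f (v - u - z) * (W z * W u))"
    by (rule set_integral_Icc_swap[where B="B * (BW * BW)"])
       (use bound BW B in \<open>auto simp: abs_mult intro!: mult_mono\<close>)
  also have "\<dots> = (LBINT z:{0..d}. LBINT u:{0..b}. f (v - z - u) * (W u * W z))"
    by (simp add: algebra_simps)
  finally show ?thesis using truncate_truncate[OF assms] by simp
qed

text \<open>For x in \<open>[0, a]\<close> this is the Volterra solution itself. Elsewhere it is the extension solving the
  equation in which the convolution with W is cut off at a.\<close>

definition interval_solution :: "(real \<Rightarrow> real) \<Rightarrow> real \<Rightarrow> real" where
  "interval_solution g x = truncate (x - a) (volterra_solution g) x"

lemma interval_solution_eq_volterra_solution: "x \<le> a \<Longrightarrow> interval_solution g x = volterra_solution g x"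
  by (simp add: interval_solution_def truncate_def set_integral_Icc_degenerate)

lemma interval_solution_eq:
  assumes g: "loc_bounded g"
  shows "interval_solution g x = g x + q * (LBINT z:{0..a}. W (x - z) * volterra_solution g z)"
proof -
  have "conv (volterra_solution g) (shifted_W (x - a)) a = (LBINT z:{0..a}. W (x - z) * volterra_solution g z)"
    by (subst conv_commute) (simp add: conv_def shifted_W_def)
  then show ?thesis
    using truncate_volterra_solution[OF g, of a "x - a"] a_pos by (simp add: interval_solution_def)
qed

lemma truncate_truncate_V: "truncate (- y) (truncate (x - a) V) (x - y) = interval_solution (shifted_W (- y)) x"
proof -
  have V_shift: "truncate (- y) V (x - y - z) = volterra_solution (shifted_W (- y)) (x - z)" for z
    using truncate_V[of "- y" "x - z"] by (simp add: algebra_simps)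
  obtain B where "\<And>v. v \<le> x - y \<Longrightarrow> \<bar>V v\<bar> \<le> B" using loc_bounded_atMostD[OF V_loc_bounded V_neg] by metis
  then have "truncate (- y) (truncate (x - a) V) (x - y) = truncate (x - a) (truncate (- y) V) (x - y)"
    by (intro truncate_commute) auto
  then show ?thesis
    using V_shift[of 0] by (simp add: interval_solution_def truncate_def[of "x - a"] V_shift)
qed

abbreviation expo :: "real \<Rightarrow> real" where "expo x \<equiv> exp (c * x)"

definition free_kernel :: "real \<Rightarrow> real" where "free_kernel x = \<kappa> * expo x - W x"

lemma free_kernel_measurable [measurable]: "free_kernel \<in> borel_measurable borel"
  unfolding free_kernel_def[abs_def] by measurable

lemma free_kernel_bounded: obtains B where "B \<ge> 0" "\<And>x. - T \<le> x \<Longrightarrow> x \<le> T \<Longrightarrow> \<bar>free_kernel x\<bar> \<le> B"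
proof -
  obtain B where B: "B \<ge> 0" "\<And>x. x \<le> T \<Longrightarrow> \<bar>W x\<bar> \<le> B" using W_bounded[where T=T] by blast
  have "\<bar>free_kernel x\<bar> \<le> \<kappa> * exp (\<bar>c\<bar> * T) + B" if x: "- T \<le> x" "x \<le> T" for x
  proof -
    have "c * x \<le> \<bar>c\<bar> * \<bar>x\<bar>" by (metis abs_ge_self abs_mult)
    also have "\<dots> \<le> \<bar>c\<bar> * T" using x by (intro mult_left_mono) auto
    finally have "\<bar>\<kappa> * expo x\<bar> \<le> \<kappa> * exp (\<bar>c\<bar> * T)" using \<kappa>_pos by simp
    then show ?thesis unfolding free_kernel_def using B(2)[OF x(2)] by linarith
  qed
  then show ?thesis using that[of "\<kappa> * exp (\<bar>c\<bar> * T) + B"] \<kappa>_pos B(1) by auto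
qed

lemma free_kernel_reflected_loc_bounded: "loc_bounded (\<lambda>z. free_kernel (x - z))"
  unfolding loc_bounded_def
proof (intro conjI allI)
  fix T
  obtain B where "\<And>z. - (\<bar>x\<bar> + T) \<le> z \<Longrightarrow> z \<le> \<bar>x\<bar> + T \<Longrightarrow> \<bar>free_kernel z\<bar> \<le> B"
    using free_kernel_bounded[where T="\<bar>x\<bar> + T"] by blast
  then show "\<exists>B. \<forall>z\<in>{0..T}. \<bar>free_kernel (x - z)\<bar> \<le> B" by (intro exI[of _ B]) auto
qed measurable

lemma W_reflected_loc_bounded: "loc_bounded (\<lambda>z. W (x - z))"
  unfolding loc_bounded_def
proof (intro conjI allI)
  fix T
  obtain B where "\<And>z. z \<le> x \<Longrightarrow> \<bar>W z\<bar> \<le> B" using W_bounded[where T=x] by blast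
  then show "\<exists>B. \<forall>z\<in>{0..T}. \<bar>W (x - z)\<bar> \<le> B" by (intro exI[of _ B]) auto
qed measurable

lemma free_kernel_set_integrable: "loc_bounded f \<Longrightarrow> set_integrable lborel {0..a} (\<lambda>z. free_kernel (x - z) * f z)"
  by (intro loc_bounded_set_integrable loc_bounded_mult free_kernel_reflected_loc_bounded)

lemma free_kernel_set_integral:
  assumes f: "loc_bounded f"
  shows "(LBINT z:{0..a}. free_kernel (x - z) * f z) =
    \<kappa> * expo x * (LBINT z:{0..a}. exp (- c * z) * f z) - (LBINT z:{0..a}. W (x - z) * f z)"
proof -
  have kernel: "free_kernel (x - z) * f z = \<kappa> * expo x * (exp (- c * z) * f z) - W (x - z) * f z" for z
  proof -
    have "expo (x - z) = expo x * exp (- c * z)" unfolding exp_add[symmetric] by (simp add: algebra_simps)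
    then show ?thesis by (simp add: free_kernel_def left_diff_distrib)
  qed
  have "set_integrable lborel {0..a} (\<lambda>z. exp (- c * z) * f z)" "set_integrable lborel {0..a} (\<lambda>z. W (x - z) * f z)"
    by (intro loc_bounded_set_integrable loc_bounded_mult loc_bounded_exp W_reflected_loc_bounded f)+
  then show ?thesis unfolding kernel by simp
qed

definition interval_laplace :: "(real \<Rightarrow> real) \<Rightarrow> real" where
  "interval_laplace g = (LBINT z:{0..a}. exp (- c * z) * volterra_solution g z)"

lemma interval_solution_free_kernel:
  assumes g: "loc_bounded g"
  shows "q * (LBINT z:{0..a}. free_kernel (x - z) * interval_solution g z)
      = q * \<kappa> * expo x * interval_laplace g - (interval_solution g x - g x)"
proof -
  have "(LBINT z:{0..a}. free_kernel (x - z) * interval_solution g z)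
      = (LBINT z:{0..a}. free_kernel (x - z) * volterra_solution g z)"
    by (rule set_lebesgue_integral_cong) (auto simp: interval_solution_eq_volterra_solution)
  then show ?thesis
    unfolding interval_solution_eq[OF g, of x] interval_laplace_def
    by (simp add: free_kernel_set_integral[OF volterra_solution_loc_bounded[OF g]] right_diff_distrib)
qed

lemma volterra_solution_expo_pos: "0 < volterra_solution expo x"
  unfolding volterra_solution_def using q_nonneg V_nonneg by (intro add_pos_nonneg mult_nonneg_nonneg conv_nonneg) auto

lemma interval_laplace_expo_nonneg: "0 \<le> interval_laplace expo"
  unfolding interval_laplace_def set_lebesgue_integral_def
  by (rule Bochner_Integration.integral_nonneg) (auto intro!: mult_nonneg_nonneg less_imp_le[OF volterra_solution_expo_pos])

definition denominator :: real where "denominator = 1 / \<kappa> + q * interval_laplace expo"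

lemma denominator_pos: "0 < denominator"
  using \<kappa>_pos q_nonneg interval_laplace_expo_nonneg by (auto simp: denominator_def intro!: add_pos_nonneg)

definition coefficient :: "real \<Rightarrow> real" where
  "coefficient y = exp (- c * a) * truncate (- y) (volterra_solution expo) (a - y) / denominator"

lemma coefficient_eq: "coefficient y = (exp (- c * y) + q * interval_laplace (shifted_W (- y))) / denominator"
proof -
  have "truncate (- y) (volterra_solution expo) (a - y)
      = expo (a - y) + q * conv (volterra_solution expo) (shifted_W (- y)) a"
    using truncate_volterra_solution[OF loc_bounded_exp, of a c "- y"] a_pos by simp
  also have "conv (volterra_solution expo) (shifted_W (- y)) a = conv expo (volterra_solution (shifted_W (- y))) a"
    by (rule conv_volterra_solution_swap[OF loc_bounded_exp shifted_W_loc_bounded, symmetric])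
  also have "\<dots> = expo a * interval_laplace (shifted_W (- y))" by (simp add: conv_exp interval_laplace_def)
  finally have "exp (- c * a) * truncate (- y) (volterra_solution expo) (a - y) =
      exp (- c * a) * expo (a - y) + q * (exp (- c * a) * expo a * interval_laplace (shifted_W (- y)))"
    by (simp add: distrib_left)
  also have "exp (- c * a) * expo (a - y) = exp (- c * y)" unfolding exp_add[symmetric] by (simp add: algebra_simps)
  also have "exp (- c * a) * expo a = 1" unfolding exp_add[symmetric] by simp
  finally show ?thesis by (simp add: coefficient_def)
qed

definition killed_kernel :: "real \<Rightarrow> real \<Rightarrow> real" where
  "killed_kernel x y = coefficient y * interval_solution expo x - interval_solution (shifted_W (- y)) x"

theorem killed_kernel_equation:
  "killed_kernel x y = free_kernel (x - y) - q * (LBINT z:{0..a}. free_kernel (x - z) * killed_kernel z y)"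
proof -
  let ?\<alpha> = "coefficient y" and ?I = interval_laplace and ?w = "shifted_W (- y)"
  let ?R = "\<lambda>g. LBINT z:{0..a}. free_kernel (x - z) * interval_solution g z"
  note expo = loc_bounded_exp[of c] and w = shifted_W_loc_bounded[of "- y"]
  have int: "set_integrable lborel {0..a} (\<lambda>z. free_kernel (x - z) * interval_solution g z)" if "loc_bounded g" for g
    using free_kernel_set_integrable[OF volterra_solution_loc_bounded[OF that], of x]
    by (rule set_integrable_cong[THEN iffD1, rotated -1]) (auto simp: interval_solution_eq_volterra_solution)
  have "free_kernel (x - z) * killed_kernel z y =
      ?\<alpha> * (free_kernel (x - z) * interval_solution expo z) - free_kernel (x - z) * interval_solution ?w z" for z
    by (simp add: killed_kernel_def algebra_simps)
  then have "(LBINT z:{0..a}. free_kernel (x - z) * killed_kernel z y) = ?\<alpha> * ?R expo - ?R ?w"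
    using int[OF expo] int[OF w] by simp
  then have "q * (LBINT z:{0..a}. free_kernel (x - z) * killed_kernel z y) = ?\<alpha> * (q * ?R expo) - q * ?R ?w"
    by (simp add: right_diff_distrib mult.left_commute)
  also have "\<dots> = \<kappa> * expo x * (q * ?I expo * ?\<alpha> - q * ?I ?w) + ?\<alpha> * expo x - ?w x - killed_kernel x y"
    unfolding interval_solution_free_kernel[OF expo] interval_solution_free_kernel[OF w] killed_kernel_def
    by (simp add: algebra_simps)
  also have "q * ?I expo * ?\<alpha> - q * ?I ?w = exp (- c * y) - ?\<alpha> / \<kappa>"
    using coefficient_eq[of y] denominator_pos by (simp add: denominator_def field_simps)
  also have "\<kappa> * expo x * (exp (- c * y) - ?\<alpha> / \<kappa>) + ?\<alpha> * expo x = \<kappa> * expo (x - y)"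
    using \<kappa>_pos by (simp add: right_diff_distrib exp_diff exp_minus field_simps)
  finally show ?thesis by (simp add: free_kernel_def shifted_W_def)
qed

lemma free_kernel_equation_zero:
  assumes d: "loc_bounded d"
    and eq: "\<And>x. 0 \<le> x \<Longrightarrow> x \<le> a \<Longrightarrow> d x = - q * (LBINT z:{0..a}. free_kernel (x - z) * d z)"
    and x: "0 \<le> x" "x \<le> a"
  shows "d x = 0"
proof -
  define \<beta> where "\<beta> = - q * \<kappa> * (LBINT z:{0..a}. exp (- c * z) * d z)"
  have volterra_d: "d z = \<beta> * expo z + q * conv W d z" if z: "0 \<le> z" "z \<le> a" for z
  proof -
    have W_part: "(LBINT u:{0..a}. W (z - u) * d u) = conv W d z"
      unfolding conv_def set_lebesgue_integral_def
      by (rule Bochner_Integration.integral_cong) (use z W_neg in \<open>auto simp: indicator_def\<close>)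
    have "d z = - q * (LBINT u:{0..a}. free_kernel (z - u) * d u)" by (rule eq[OF z])
    also have "\<dots> = - q * (\<kappa> * expo z * (LBINT u:{0..a}. exp (- c * u) * d u) - conv W d z)"
      by (simp only: free_kernel_set_integral[OF d] W_part)
    also have "\<dots> = \<beta> * expo z + q * conv W d z" by (simp add: \<beta>_def right_diff_distrib)
    finally show ?thesis .
  qed
  have d_eq: "d z = \<beta> * volterra_solution expo z" if z: "0 \<le> z" "z \<le> a" for z
  proof -
    have "d z = volterra_solution (\<lambda>z. \<beta> * expo z) z"
      by (rule volterra_solution_unique[OF d _ volterra_d z]) (intro loc_bounded_scaled loc_bounded_exp)
    then show ?thesis by (simp add: volterra_solution_def conv_scaled_right algebra_simps)
  qed
  have "(LBINT z:{0..a}. exp (- c * z) * d z) = (LBINT z:{0..a}. \<beta> * (exp (- c * z) * volterra_solution expo z))"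
    by (rule set_lebesgue_integral_cong) (auto simp: d_eq)
  also have "\<dots> = \<beta> * interval_laplace expo" by (simp only: set_integral_mult_right interval_laplace_def)
  finally have "\<beta> = - q * \<kappa> * (\<beta> * interval_laplace expo)" using \<beta>_def by metis
  then have "\<beta> * (1 + q * \<kappa> * interval_laplace expo) = 0" by (simp add: algebra_simps)
  moreover have "1 + q * \<kappa> * interval_laplace expo > 0" using \<kappa>_pos q_nonneg interval_laplace_expo_nonneg by (auto intro!: add_pos_nonneg)
  ultimately show ?thesis using d_eq[OF x] by simp
qed

theorem free_kernel_equation_unique:
  assumes f: "loc_bounded f" and g: "loc_bounded g"
    and "\<And>x. f x = h x - q * (LBINT z:{0..a}. free_kernel (x - z) * f z)"
    and "\<And>x. g x = h x - q * (LBINT z:{0..a}. free_kernel (x - z) * g z)"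
  shows "f = g"
proof
  let ?d = "\<lambda>z. f z + (- 1) * g z"
  have diff: "?d x = - q * (LBINT z:{0..a}. free_kernel (x - z) * ?d z)" for x
    using assms(3)[of x] assms(4)[of x] free_kernel_set_integrable[OF f, of x] free_kernel_set_integrable[OF g, of x]
    by (simp add: right_diff_distrib)
  have "?d z = 0" if "0 \<le> z" "z \<le> a" for z
    by (rule free_kernel_equation_zero[OF loc_bounded_add_scaled[OF f g] diff that])
  then have "(LBINT z:{0..a}. free_kernel (x - z) * ?d z) = (LBINT z:{0..a}. 0)" for x
    by (intro set_lebesgue_integral_cong) auto
  then show "f x = g x" for x using diff[of x] by simp
qed

lemma volterra_solution_shifted_W_measurable [measurable (raw)]:
  assumes [measurable]: "f \<in> borel_measurable N" "g \<in> borel_measurable N"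
  shows "(\<lambda>w. volterra_solution (shifted_W (g w)) (f w)) \<in> borel_measurable N"
  unfolding volterra_solution_def conv_def shifted_W_def by measurable

lemma killed_kernel_measurable [measurable (raw)]:
  assumes [measurable]: "f \<in> borel_measurable N" "g \<in> borel_measurable N"
  shows "(\<lambda>w. killed_kernel (f w) (g w)) \<in> borel_measurable N"
proof -
  have [measurable]: "volterra_solution expo \<in> borel_measurable borel"
    by (intro loc_bounded_measurable volterra_solution_loc_bounded loc_bounded_exp)
  show ?thesis
    unfolding killed_kernel_def coefficient_eq interval_laplace_def interval_solution_eq[OF loc_bounded_exp]
      interval_solution_eq[OF shifted_W_loc_bounded] unfolding shifted_W_def[of _ "f _"] by measurable
qed

lemma volterra_solution_shifted_W_bounded:
  obtains B where "B \<ge> 0" "\<And>y z. \<bar>y\<bar> \<le> n \<Longrightarrow> 0 \<le> z \<Longrightarrow> z \<le> a \<Longrightarrow> \<bar>volterra_solution (shifted_W (- y)) z\<bar> \<le> B"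
proof -
  obtain BV where BV: "BV \<ge> 0" "\<And>z. 0 \<le> z \<Longrightarrow> z \<le> a \<Longrightarrow> \<bar>V z\<bar> \<le> BV" using loc_boundedD[OF V_loc_bounded] by metis
  obtain BW where BW: "BW \<ge> 0" "\<And>z. z \<le> a + n \<Longrightarrow> \<bar>W z\<bar> \<le> BW" using W_bounded[where T="a + n"] by blast
  have "\<bar>volterra_solution (shifted_W (- y)) z\<bar> \<le> BW + q * (BV * BW * a)" if y: "\<bar>y\<bar> \<le> n" and z: "0 \<le> z" "z \<le> a" for y z
  proof -
    have "\<bar>conv V (shifted_W (- y)) z\<bar> \<le> BV * BW * max 0 z"
      by (rule abs_conv_le) (use y z BV BW loc_bounded_measurable[OF shifted_W_loc_bounded] in \<open>auto simp: shifted_W_def\<close>)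
    also have "\<dots> \<le> BV * BW * a" using z BV BW by (intro mult_left_mono) auto
    finally have "\<bar>q * conv V (shifted_W (- y)) z\<bar> \<le> q * (BV * BW * a)" using q_nonneg by (simp add: abs_mult mult_left_mono)
    moreover have "\<bar>shifted_W (- y) z\<bar> \<le> BW" using BW(2)[of "z - y"] y z by (simp add: shifted_W_def)
    ultimately show ?thesis unfolding volterra_solution_def by linarith
  qed
  moreover have "0 \<le> BW + q * (BV * BW * a)" using BV BW q_nonneg a_pos by simp
  ultimately show ?thesis using that by blast
qed

lemma coefficient_bounded:
  obtains B where "B \<ge> 0" "\<And>y. \<bar>y\<bar> \<le> n \<Longrightarrow> \<bar>coefficient y\<bar> \<le> B"
proof -
  obtain E where E: "E \<ge> 0" "\<And>z. 0 \<le> z \<Longrightarrow> z \<le> a \<Longrightarrow> \<bar>exp (- c * z)\<bar> \<le> E" using loc_boundedD[OF loc_bounded_exp] by metis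
  obtain C where C: "C \<ge> 0" "\<And>y z. \<bar>y\<bar> \<le> n \<Longrightarrow> 0 \<le> z \<Longrightarrow> z \<le> a \<Longrightarrow> \<bar>volterra_solution (shifted_W (- y)) z\<bar> \<le> C"
    using volterra_solution_shifted_W_bounded[where n=n] by blast
  define B where "B = (exp (\<bar>c\<bar> * n) + q * (E * C * a)) / denominator"
  have "\<bar>coefficient y\<bar> \<le> B" if y: "\<bar>y\<bar> \<le> n" for y
  proof -
    have "\<bar>interval_laplace (shifted_W (- y))\<bar> \<le> E * C * max 0 (a - 0)"
      unfolding interval_laplace_def
    proof (rule abs_set_integral_Icc_le)
      show "\<bar>exp (- c * z) * volterra_solution (shifted_W (- y)) z\<bar> \<le> E * C" if "0 \<le> z" "z \<le> a" for z
        unfolding abs_mult using that y E C by (intro mult_mono) auto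
    qed measurable
    then have "\<bar>q * interval_laplace (shifted_W (- y))\<bar> \<le> q * (E * C * a)"
      using q_nonneg a_pos by (simp add: abs_mult mult_left_mono)
    moreover have "- c * y \<le> \<bar>c\<bar> * n"
      using mult_left_mono[OF y, of "\<bar>c\<bar>"] abs_ge_minus_self[of "c * y"] by (simp add: abs_mult)
    then have "\<bar>exp (- c * y)\<bar> \<le> exp (\<bar>c\<bar> * n)" by simp
    ultimately have "\<bar>exp (- c * y) + q * interval_laplace (shifted_W (- y))\<bar> \<le> exp (\<bar>c\<bar> * n) + q * (E * C * a)" by linarith
    then show ?thesis
      unfolding coefficient_eq B_def using denominator_pos by (simp add: divide_right_mono)
  qed
  moreover have "0 \<le> B"
    unfolding B_def using E C q_nonneg a_pos denominator_pos by (intro divide_nonneg_nonneg add_nonneg_nonneg mult_nonneg_nonneg) auto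
  ultimately show ?thesis using that by blast
qed

lemma killed_kernel_bounded_interval:
  obtains B where "B \<ge> 0" "\<And>z y. 0 \<le> z \<Longrightarrow> z \<le> a \<Longrightarrow> \<bar>y\<bar> \<le> n \<Longrightarrow> \<bar>killed_kernel z y\<bar> \<le> B"
proof -
  obtain BH where BH: "BH \<ge> 0" "\<And>z. 0 \<le> z \<Longrightarrow> z \<le> a \<Longrightarrow> \<bar>volterra_solution expo z\<bar> \<le> BH"
    using loc_boundedD[OF volterra_solution_loc_bounded[OF loc_bounded_exp]] by metis
  obtain BC where BC: "BC \<ge> 0" "\<And>y. \<bar>y\<bar> \<le> n \<Longrightarrow> \<bar>coefficient y\<bar> \<le> BC" using coefficient_bounded[where n=n] by blast
  obtain C where C: "C \<ge> 0" "\<And>y z. \<bar>y\<bar> \<le> n \<Longrightarrow> 0 \<le> z \<Longrightarrow> z \<le> a \<Longrightarrow> \<bar>volterra_solution (shifted_W (- y)) z\<bar> \<le> C"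
    using volterra_solution_shifted_W_bounded[where n=n] by blast
  have "\<bar>killed_kernel z y\<bar> \<le> BC * BH + C" if "0 \<le> z" "z \<le> a" "\<bar>y\<bar> \<le> n" for z y
  proof -
    have "\<bar>coefficient y * volterra_solution expo z\<bar> \<le> BC * BH" unfolding abs_mult using that BC BH by (intro mult_mono) auto
    then show ?thesis using C(2)[of y z] that by (simp add: killed_kernel_def interval_solution_eq_volterra_solution)
  qed
  then show ?thesis using that[of "BC * BH + C"] BC BH C by simp
qed

lemma killed_kernel_bounded:
  obtains B where "B \<ge> 0" "\<And>x y. \<bar>x\<bar> \<le> T \<Longrightarrow> \<bar>y\<bar> \<le> n \<Longrightarrow> \<bar>killed_kernel x y\<bar> \<le> B"
proof -
  obtain BK where BK: "BK \<ge> 0" "\<And>z y. 0 \<le> z \<Longrightarrow> z \<le> a \<Longrightarrow> \<bar>y\<bar> \<le> n \<Longrightarrow> \<bar>killed_kernel z y\<bar> \<le> BK"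
    using killed_kernel_bounded_interval[where n=n] by blast
  obtain BF where BF: "BF \<ge> 0" "\<And>z. - (T + \<bar>n\<bar> + a) \<le> z \<Longrightarrow> z \<le> T + \<bar>n\<bar> + a \<Longrightarrow> \<bar>free_kernel z\<bar> \<le> BF"
    using free_kernel_bounded[where T="T + \<bar>n\<bar> + a"] by blast
  have "\<bar>killed_kernel x y\<bar> \<le> BF + q * (BF * BK * a)" if xy: "\<bar>x\<bar> \<le> T" "\<bar>y\<bar> \<le> n" for x y
  proof -
    have "\<bar>LBINT z:{0..a}. free_kernel (x - z) * killed_kernel z y\<bar> \<le> BF * BK * max 0 (a - 0)"
    proof (rule abs_set_integral_Icc_le)
      show "\<bar>free_kernel (x - z) * killed_kernel z y\<bar> \<le> BF * BK" if "0 \<le> z" "z \<le> a" for z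
        unfolding abs_mult using that xy BF BK by (intro mult_mono) auto
    qed measurable
    then have "\<bar>q * (LBINT z:{0..a}. free_kernel (x - z) * killed_kernel z y)\<bar> \<le> q * (BF * BK * a)"
      using q_nonneg a_pos by (simp add: abs_mult mult_left_mono)
    moreover have "\<bar>free_kernel (x - y)\<bar> \<le> BF" using xy a_pos by (intro BF) auto
    ultimately show ?thesis unfolding killed_kernel_equation[of x y] by linarith
  qed
  moreover have "0 \<le> BF + q * (BF * BK * a)" using BF BK q_nonneg a_pos by simp
  ultimately show ?thesis using that by blast
qed

context
  fixes A :: "real set" and n :: real
  assumes A [measurable]: "A \<in> sets borel" and A_bounded: "A \<subseteq> {- n..n}"
begin

lemma set_integrable_bounded_set:
  fixes h :: "real \<Rightarrow> real"
  assumes [measurable]: "h \<in> borel_measurable borel" and "\<And>y. \<bar>y\<bar> \<le> n \<Longrightarrow> \<bar>h y\<bar> \<le> B"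
  shows "set_integrable lborel A h"
  by (rule set_integrable_subset[OF set_integrable_Icc_bounded[of h "- n" n B]]) (use assms A_bounded in auto)

lemma killed_kernel_set_integrable: "set_integrable lborel A (killed_kernel x)"
proof -
  obtain B where "\<And>x' y. \<bar>x'\<bar> \<le> \<bar>x\<bar> \<Longrightarrow> \<bar>y\<bar> \<le> n \<Longrightarrow> \<bar>killed_kernel x' y\<bar> \<le> B"
    using killed_kernel_bounded[where T="\<bar>x\<bar>" and n=n] by blast
  then show ?thesis by (intro set_integrable_bounded_set[where B=B]) auto
qed

lemma set_integral_killed_kernel_loc_bounded: "loc_bounded (\<lambda>x. LBINT y:A. killed_kernel x y)"
  unfolding loc_bounded_def
proof (intro conjI allI)
  show "(\<lambda>x. LBINT y:A. killed_kernel x y) \<in> borel_measurable borel"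
    unfolding set_lebesgue_integral_def by measurable
  fix T
  obtain B where B: "B \<ge> 0" "\<And>x y. \<bar>x\<bar> \<le> T \<Longrightarrow> \<bar>y\<bar> \<le> n \<Longrightarrow> \<bar>killed_kernel x y\<bar> \<le> B"
    using killed_kernel_bounded[where T=T and n=n] by blast
  have "\<bar>LBINT y:A. killed_kernel x y\<bar> \<le> B * max 0 (n - - n)" if x: "x \<in> {0..T}" for x
    unfolding set_integral_subset_Icc[OF A_bounded]
    by (rule abs_set_integral_Icc_le) (use B x in \<open>auto simp: indicator_def\<close>)
  then show "\<exists>B. \<forall>x\<in>{0..T}. \<bar>LBINT y:A. killed_kernel x y\<bar> \<le> B" by blast
qed

lemma set_integral_killed_kernel_swap:
  "(LBINT y:A. LBINT z:{0..a}. free_kernel (x - z) * killed_kernel z y)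
      = (LBINT z:{0..a}. free_kernel (x - z) * (LBINT y:A. killed_kernel z y))"
proof -
  obtain BK where BK: "BK \<ge> 0" "\<And>z y. 0 \<le> z \<Longrightarrow> z \<le> a \<Longrightarrow> \<bar>y\<bar> \<le> n \<Longrightarrow> \<bar>killed_kernel z y\<bar> \<le> BK"
    using killed_kernel_bounded_interval[where n=n] by blast
  obtain BF where BF: "BF \<ge> 0" "\<And>z. 0 \<le> z \<Longrightarrow> z \<le> a \<Longrightarrow> \<bar>free_kernel (x - z)\<bar> \<le> BF"
    using loc_boundedD[OF free_kernel_reflected_loc_bounded] by metis
  have "(LBINT y:A. LBINT z:{0..a}. free_kernel (x - z) * killed_kernel z y) =
      (LBINT y:{- n..n}. LBINT z:{0..a}. indicator A y * (free_kernel (x - z) * killed_kernel z y))"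
    by (simp add: set_integral_subset_Icc[OF A_bounded])
  also have "\<dots> = (LBINT z:{0..a}. LBINT y:{- n..n}. indicator A y * (free_kernel (x - z) * killed_kernel z y))"
  proof (rule set_integral_Icc_swap[where B="BF * BK"])
    fix y z assume "- n \<le> y" "y \<le> n" "0 \<le> z" "z \<le> a"
    then have "\<bar>free_kernel (x - z) * killed_kernel z y\<bar> \<le> BF * BK"
      unfolding abs_mult using BF BK by (intro mult_mono) auto
    then show "\<bar>indicator A y * (free_kernel (x - z) * killed_kernel z y)\<bar> \<le> BF * BK"
      using BF(1) BK(1) by (simp add: indicator_def)
  qed measurable
  also have "\<dots> = (LBINT z:{0..a}. free_kernel (x - z) * (LBINT y:A. killed_kernel z y))"
    by (simp only: set_integral_subset_Icc[OF A_bounded] mult.left_commute[of "indicator A _"] set_integral_mult_right)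
  finally show ?thesis .
qed

lemma set_integral_killed_kernel_eq:
  "(LBINT y:A. killed_kernel x y) =
    (LBINT y:A. free_kernel (x - y)) - q * (LBINT z:{0..a}. free_kernel (x - z) * (LBINT y:A. killed_kernel z y))"
proof -
  obtain B where "\<And>z. - (\<bar>x\<bar> + \<bar>n\<bar>) \<le> z \<Longrightarrow> z \<le> \<bar>x\<bar> + \<bar>n\<bar> \<Longrightarrow> \<bar>free_kernel z\<bar> \<le> B"
    using free_kernel_bounded[where T="\<bar>x\<bar> + \<bar>n\<bar>"] by blast
  then have "set_integrable lborel A (\<lambda>y. free_kernel (x - y))"
    by (intro set_integrable_bounded_set[where B=B]) auto
  then have "(LBINT y:A. free_kernel (x - y)) - (LBINT y:A. killed_kernel x y)
      = (LBINT y:A. free_kernel (x - y) - killed_kernel x y)"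
    using killed_kernel_set_integrable by simp
  also have "\<dots> = q * (LBINT y:A. LBINT z:{0..a}. free_kernel (x - z) * killed_kernel z y)"
    by (subst killed_kernel_equation) simp
  finally show ?thesis by (simp add: set_integral_killed_kernel_swap)
qed

end

lemma truncate_eq_interval_integral:
  "f v - q * (LBINT z=0..ereal b. f (v - z) * W z) = truncate b f v"
  using interval_integral_eq_set_integral_Icc[of b 0 "\<lambda>z. f (v - z) * W z"] W_neg
  by (simp add: truncate_def zero_ereal_def)

lemma interval_solution_eq_interval_integral:
  "volterra_solution g x - q * (LBINT z=ereal a..ereal x. W (x - z) * volterra_solution g z) = interval_solution g x"
proof -
  have "(LBINT z=ereal a..ereal x. W (x - z) * volterra_solution g z) = (LBINT z:{a..x}. W (x - z) * volterra_solution g z)"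
    by (rule interval_integral_eq_set_integral_Icc) (simp add: W_neg)
  also have "\<dots> = (LBINT u:{0..x - a}. volterra_solution g (x - u) * W u)"
    by (subst set_integral_Icc_reflect[where r=x]) (simp add: mult.commute)
  finally show ?thesis by (simp add: interval_solution_def truncate_def)
qed

lemma volterra_solution_expo_eq_interval_integral:
  "expo x * (1 + q * (LBINT z=0..ereal x. exp (- c * z) * V z)) = volterra_solution expo x"
  using interval_integral_eq_set_integral_Icc[of x 0 "\<lambda>z. exp (- c * z) * V z"] V_neg
  by (simp add: volterra_solution_def conv_commute[of V] conv_exp zero_ereal_def distrib_left)

end

section \<open>The density of the killed resolvent\<close>

lemma exp_mean_eq_set_integral: "exp_mean p f = p * (LBINT t:{0..}. exp (- p * t) * f t)"
  unfolding set_lebesgue_integral_def integral_mult_right_zero[symmetric]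
  by (rule Bochner_Integration.integral_cong) (auto simp: exponential_density_eq indicator_def)

locale killed_levy = sn_levy M X for M :: "'a measure" and X +
  fixes p q a :: real
  assumes parameters: "p > 0" "q \<ge> 0" "a > 0"
begin

sublocale killed_process M X "\<lambda>z. q * indicator {0<..<a} z" q p
  by unfold_locales (use parameters in \<open>auto simp: indicator_def\<close>)

sublocale scale_pair "scale p" "scale (p + q)" "sup_rate p" q a "inv_deriv_psi p"
proof
  have "p + q > 0" using parameters by simp
  then show "loc_bounded (scale p)" "loc_bounded (scale (p + q))" "0 \<le> scale (p + q) x" for x
    using scale_loc_bounded scale_nonneg parameters by auto
  show "scale (p + q) x = scale p x + q * conv (scale p) (scale (p + q)) x" for x
    using parameters by (intro scale_volterra)
qed (use parameters inv_deriv_psi_pos scale_neg in auto)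

lemma position_integral_free_kernel:
  assumes [measurable]: "f \<in> borel_measurable borel"
  shows "(\<integral>z. f (x + position z) \<partial>exp_time p) / p = (\<integral>y. free_kernel (x - y) * f y \<partial>lborel)"
proof -
  have [measurable]: "resolvent_density p \<in> borel_measurable borel" by (rule resolvent_density_measurable[OF p])
  have "resolvent_density p (y - x) = free_kernel (x - y)" if "y \<noteq> x" for y
    using resolvent_density_eq[OF p, of "y - x"] that by (simp add: free_kernel_def algebra_simps)
  then have "(\<integral>y. resolvent_density p (y - x) * f y \<partial>lborel) = (\<integral>y. free_kernel (x - y) * f y \<partial>lborel)"
    using AE_lborel_singleton[of x] by (intro integral_cong_AE) (auto elim: eventually_mono)
  then show ?thesis using position_integral[OF p, of f x] p by simp
qed

lemma resolvent_equation:
  assumes f [measurable]: "f \<in> borel_measurable borel" and bound: "\<And>y. \<bar>f y\<bar> \<le> B"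
  shows "resolvent f x = (\<integral>y. free_kernel (x - y) * f y \<partial>lborel) - q * (LBINT z:{0..a}. free_kernel (x - z) * resolvent f z)"
proof -
  have [measurable]: "resolvent f \<in> borel_measurable borel" by (rule resolvent_measurable[OF f bound])
  have "(\<integral>z. q * indicator {0<..<a} (x + position z) * resolvent f (x + position z) \<partial>exp_time p) / p
      = (\<integral>z. free_kernel (x - z) * (q * indicator {0<..<a} z * resolvent f z) \<partial>lborel)"
    by (rule position_integral_free_kernel[of "\<lambda>z. q * indicator {0<..<a} z * resolvent f z"]) measurable
  also have "\<dots> = (LBINT z:{0..a}. q * (free_kernel (x - z) * resolvent f z))"
    unfolding set_lebesgue_integral_def
  proof (rule integral_cong_AE)
    show "AE z in lborel. free_kernel (x - z) * (q * indicator {0<..<a} z * resolvent f z) = indicator {0..a} z *\<^sub>R (q * (free_kernel (x - z) * resolvent f z))"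
      using AE_lborel_singleton[of 0] AE_lborel_singleton[of a] by eventually_elim (auto simp: indicator_def)
  qed measurable
  finally show ?thesis
    using feynman_kac[OF f bound, of x] position_integral_free_kernel[OF f, of x] by simp
qed

lemma resolvent_loc_bounded:
  assumes f: "f \<in> borel_measurable borel" and bound: "\<And>y. \<bar>f y\<bar> \<le> B"
  shows "loc_bounded (resolvent f)"
  unfolding loc_bounded_def using resolvent_measurable[OF assms] abs_resolvent_le[OF assms] by blast

lemma resolvent_bounded_set:
  assumes A [measurable]: "A \<in> sets borel" and "A \<subseteq> {- n..n}"
  shows "resolvent (indicator A) x = (LBINT y:A. killed_kernel x y)"
proof -
  have bound: "\<bar>indicator A y\<bar> \<le> (1::real)" for y by (simp add: indicator_def)
  have "resolvent (indicator A) = (\<lambda>x. LBINT y:A. killed_kernel x y)"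
  proof (rule free_kernel_equation_unique)
    show "loc_bounded (resolvent (indicator A))" by (rule resolvent_loc_bounded[OF _ bound]) measurable
    show "loc_bounded (\<lambda>x. LBINT y:A. killed_kernel x y)" by (rule set_integral_killed_kernel_loc_bounded[OF assms])
    show "(LBINT y:A. killed_kernel x y) = (LBINT y:A. free_kernel (x - y))
        - q * (LBINT z:{0..a}. free_kernel (x - z) * (LBINT y:A. killed_kernel z y))" for x
      by (rule set_integral_killed_kernel_eq[OF assms])
    show "resolvent (indicator A) x = (LBINT y:A. free_kernel (x - y)) - q * (LBINT z:{0..a}. free_kernel (x - z) * resolvent (indicator A) z)" for x
      using resolvent_equation[OF borel_measurable_indicator[OF A] bound, of x] by (simp add: set_lebesgue_integral_def mult.commute)
  qed
  then show ?thesis by simp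
qed

lemma AE_killed_kernel_nonneg: "AE y in lborel. 0 \<le> killed_kernel x y"
proof -
  have "AE y in lborel. \<bar>y\<bar> \<le> real n \<longrightarrow> 0 \<le> killed_kernel x y" for n
  proof -
    define B where "B = {y. \<bar>y\<bar> \<le> real n \<and> killed_kernel x y < 0}"
    have B [measurable]: "B \<in> sets borel" unfolding B_def by measurable
    have sub: "B \<subseteq> {- real n..real n}" by (auto simp: B_def)
    have int: "integrable lborel (\<lambda>y. indicator B y * killed_kernel x y)"
      using killed_kernel_set_integrable[OF B sub, of x] by (simp add: set_integrable_def)
    have "0 \<le> (LBINT y:B. killed_kernel x y)"
      unfolding resolvent_bounded_set[OF B sub, symmetric] by (rule resolvent_nonneg) simp
    moreover have "0 \<le> (\<integral>y. - (indicator B y * killed_kernel x y) \<partial>lborel)"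
      by (rule Bochner_Integration.integral_nonneg) (auto simp: B_def indicator_def)
    ultimately have "(\<integral>y. - (indicator B y * killed_kernel x y) \<partial>lborel) = 0" by (simp add: set_lebesgue_integral_def)
    then have "AE y in lborel. - (indicator B y * killed_kernel x y) = 0"
      using int by (subst (asm) integral_nonneg_eq_0_iff_AE) (auto simp: B_def indicator_def)
    then show ?thesis by eventually_elim (force simp: B_def indicator_def split: if_splits)
  qed
  then have "AE y in lborel. \<forall>n::nat. \<bar>y\<bar> \<le> real n \<longrightarrow> 0 \<le> killed_kernel x y" unfolding AE_all_countable by blast
  then show ?thesis
  proof eventually_elim
    case (elim y)
    obtain n :: nat where "\<bar>y\<bar> \<le> real n" using real_arch_simple by blast
    then show ?case using elim by blast
  qed
qed

lemma resolvent_tendsto: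
  assumes [measurable]: "\<And>n. f n \<in> borel_measurable borel" "g \<in> borel_measurable borel"
    and bound: "\<And>n y. \<bar>f n y\<bar> \<le> B" and lim: "\<And>y. (\<lambda>n. f n y) \<longlonglongrightarrow> g y"
  shows "(\<lambda>n. resolvent (f n) x) \<longlonglongrightarrow> resolvent g x"
proof -
  interpret N: prob_space "exp_time p" by (rule prob_space_exp_time[OF p])
  show ?thesis
    unfolding resolvent_def
  proof (intro tendsto_divide tendsto_const integral_dominated_convergence[where w="\<lambda>_. B"])
    show "AE z in exp_time p. norm (exp (- killing (fst z) x (snd z)) * f n (x + position z)) \<le> B" for n
      using killed_payoff_bound[of "f n" B] bound by (intro AE_I2) simp
    show "AE z in exp_time p. (\<lambda>n. exp (- killing (fst z) x (snd z)) * f n (x + position z)) \<longlonglongrightarrow> exp (- killing (fst z) x (snd z)) * g (x + position z)"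
      by (intro AE_I2 tendsto_mult_left lim)
  qed (use p in auto)
qed

theorem killed_resolvent_density:
  assumes A [measurable]: "A \<in> sets borel"
  shows "set_integrable lborel A (killed_kernel x)" "(LBINT y:A. killed_kernel x y) = resolvent (indicator A) x"
proof -
  define S where "S n = A \<inter> {- real n..real n}" for n
  have S [measurable]: "S n \<in> sets borel" and sub: "S n \<subseteq> {- real n..real n}" for n by (auto simp: S_def)
  let ?f = "\<lambda>n y. indicator (S n) y * killed_kernel x y"
  have indicator_lim: "(\<lambda>n. indicator (S n) y :: real) \<longlonglongrightarrow> indicator A y" for y
  proof (rule Lim_transform_eventually[OF tendsto_const])
    obtain N :: nat where "\<bar>y\<bar> \<le> real N" using real_arch_simple by blast
    then show "\<forall>\<^sub>F n in sequentially. indicator A y = (indicator (S n) y :: real)"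
      by (intro eventually_sequentiallyI[of N]) (auto simp: S_def indicator_def)
  qed
  have int: "integrable lborel (?f n)" for n
    using killed_kernel_set_integrable[OF S sub, of n x] by (simp add: set_integrable_def)
  have mono: "AE y in lborel. mono (\<lambda>n. ?f n y)"
    using AE_killed_kernel_nonneg[of x]
  proof eventually_elim
    case (elim y)
    show ?case by (rule monoI, rule mult_right_mono[OF _ elim]) (auto simp: S_def indicator_def)
  qed
  have lim: "AE y in lborel. (\<lambda>n. ?f n y) \<longlonglongrightarrow> indicator A y * killed_kernel x y"
    by (intro AE_I2 tendsto_mult_right indicator_lim)
  have "(\<lambda>n. resolvent (indicator (S n)) x) \<longlonglongrightarrow> resolvent (indicator A) x"
    by (rule resolvent_tendsto[where B=1]) (auto intro: indicator_lim)
  then have int_lim: "(\<lambda>n. \<integral>y. ?f n y \<partial>lborel) \<longlonglongrightarrow> resolvent (indicator A) x"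
    by (simp add: resolvent_bounded_set[OF S sub] set_lebesgue_integral_def)
  show "set_integrable lborel A (killed_kernel x)"
    using integrable_monotone_convergence[OF int mono lim int_lim] by (simp add: set_integrable_def)
  show "(LBINT y:A. killed_kernel x y) = resolvent (indicator A) x"
    using integral_monotone_convergence[OF int mono lim int_lim] by (simp add: set_lebesgue_integral_def)
qed

lemma resolvent_eq_time_integral:
  assumes [measurable]: "f \<in> borel_measurable borel" and bound: "\<And>y. \<bar>f y\<bar> \<le> B"
  shows "resolvent f x = (LBINT t:{0..}. exp (- p * t) *
    (\<integral>\<omega>. exp (- q * (LBINT s:{0..t}. indicator {0<..<a} (x + X s \<omega>))) * f (x + X t \<omega>) \<partial>M))"
proof -
  have "p * resolvent f x = exp_mean p (\<lambda>t. \<integral>\<omega>. exp (- killing t x \<omega>) * f (x + position (t, \<omega>)) \<partial>M)"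
    unfolding resolvent_def using p by (simp add: exp_time_integral_time_outer[OF p _ killed_payoff_bound[OF assms]])
  also have "\<dots> = exp_mean p (\<lambda>t. \<integral>\<omega>. exp (- q * (LBINT s:{0..t}. indicator {0<..<a} (x + X s \<omega>))) * f (x + X t \<omega>) \<partial>M)"
  proof (rule exp_mean_cong)
    fix t :: real assume "t \<ge> 0"
    have "killing t x \<omega> = q * (LBINT s:{0..t}. indicator {0<..<a} (x + X s \<omega>))" for \<omega>
      unfolding killing_def set_integral_mult_right
      by (intro arg_cong2[where f="(*)"] refl set_lebesgue_integral_cong) (auto simp: position_def)
    then show "(\<integral>\<omega>. exp (- killing t x \<omega>) * f (x + position (t, \<omega>)) \<partial>M) =
        (\<integral>\<omega>. exp (- q * (LBINT s:{0..t}. indicator {0<..<a} (x + X s \<omega>))) * f (x + X t \<omega>) \<partial>M)"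
      using \<open>t \<ge> 0\<close> by (simp add: position_def)
  qed
  finally show ?thesis using p by (simp add: exp_mean_eq_set_integral)
qed

lemma scale_functions_eq:
  shows "levy_Phi M X p = sup_rate p" "scale_W M X p = scale p" "scale_H M X p q = volterra_solution expo"
    and "scale_Wpq M X p q b = truncate b (scale (p + q))"
proof -
  have pq: "p + q > 0" using parameters by simp
  note scale_eqs = Phi_eq_sup_rate[OF p] scale_W_eq[OF p] scale_W_eq[OF pq]
  show "levy_Phi M X p = sup_rate p" "scale_W M X p = scale p" by (fact scale_eqs)+
  show "scale_H M X p q = volterra_solution expo"
    by (rule ext) (simp only: scale_H_def scale_eqs volterra_solution_expo_eq_interval_integral)
  show "scale_Wpq M X p q b = truncate b (scale (p + q))"
    by (rule ext) (simp only: scale_Wpq_def scale_eqs truncate_eq_interval_integral)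
qed

lemma killed_kernel_formula:
  "exp (- sup_rate p * a) *
      ((volterra_solution expo x - q * (LBINT z=a..x. scale p (x - z) * volterra_solution expo z)) /
       (deriv \<psi> (sup_rate p) + q * (LBINT z=0..a. exp (- sup_rate p * z) * volterra_solution expo z))) *
      (volterra_solution expo (a - y) - q * (LBINT z=0..-y. volterra_solution expo (a - y - z) * scale p z))
    - (truncate (x - a) (scale (p + q)) (x - y) - q * (LBINT z=0..-y. truncate (x - a) (scale (p + q)) (x - y - z) * scale p z))
    = killed_kernel x y"
proof -
  have "(LBINT z=0..a. exp (- sup_rate p * z) * volterra_solution expo z) = interval_laplace expo"
    using interval_integral_eq_set_integral_Icc[of a 0 "\<lambda>z. exp (- sup_rate p * z) * volterra_solution expo z"] a_pos
    by (simp add: zero_ereal_def interval_laplace_def)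
  then show ?thesis
    unfolding interval_solution_eq_interval_integral truncate_eq_interval_integral truncate_truncate_V
      killed_kernel_def coefficient_def denominator_def deriv_psi_eq_inverse[OF p]
    by simp
qed

end

theorem mainTheorem2:
  fixes M :: "'a measure" and X :: "real \<Rightarrow> 'a \<Rightarrow> real" and a q x p :: real
  assumes "spectrally_negative_levy M X" and "a > 0" and "q \<ge> 0" and "p > 0"
  shows "\<forall>A \<in> sets borel.
    (let \<Phi> = levy_Phi M X p;
         W = scale_W M X p;
         H = scale_H M X p q;
         \<W> = scale_Wpq M X p q (x - a);
         f = (\<lambda>y. exp (- \<Phi> * a) *
               ((H x - q * (LBINT z=a..x. W (x - z) * H z)) /
                (deriv (levy_psi M X) \<Phi> + q * (LBINT z=0..a. exp (- \<Phi> * z) * H z))) *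
               (H (a - y) - q * (LBINT z=0..-y. H (a - y - z) * W z))
             - (\<W> (x - y) - q * (LBINT z=0..-y. \<W> (x - y - z) * W z)))
     in set_integrable lborel A f \<and>
        (LINT t:{0..}|lborel. exp (- p * t) *
           (\<integral>\<omega>. exp (- q * (LINT s:{0..t}|lborel. indicator {0<..<a} (x + X s \<omega>)))
                 * indicator A (x + X t \<omega>) \<partial>M))
        = (LINT y:A|lborel. f y))"
proof -
  have "prob_space M" using assms(1) by (simp add: spectrally_negative_levy_def levy_process_def)
  then interpret killed_levy M X p q a
    using assms by (simp add: killed_levy_def killed_levy_axioms_def sn_levy_def sn_levy_axioms_def)
  have "\<bar>indicator A y\<bar> \<le> (1::real)" for A and y :: real by (simp add: indicator_def)
  note time_integral = resolvent_eq_time_integral[OF borel_measurable_indicator this]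
  show ?thesis
    unfolding Let_def scale_functions_eq killed_kernel_formula
    using killed_resolvent_density time_integral by simp
qed

end
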